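(* Let $n\geq 3$ and let $a,b,c_1,\dots,c_n$ be complex numbers. The monodromy group $\mathbf{Mon}$ of Lauricella's hypergeometric system $E_C(a,b,c)$, $c=(c_1,\dots,c_n)$, is finite irreducible if and only if the following two conditions hold: (A) for each $k=1,\dots,n$, the monodromy group of Gauss' hypergeometric differential equation ${}_2E_1(a,b,c_k)$ is finite irreducible; (B) at least $n$ of the $n+2$ numbers $c_1,\dots,c_n$, $b-a$, $c_1+\cdots+c_n-a-b-\frac{n-1}{2}$ (counted as a list of $n+2$ entries) are congruent to $\frac12$ modulo $\mathbb{Z}$.
   Context: $E_C(a,b,c)$ is the system of differential equations $[\theta_k(\theta_k+c_k-1)-x_k(\theta+a)(\theta+b)]f=0$ ($k=1,\dots,n$) in variables $x_1,\dots,x_n$, where $\theta_k=x_k\partial/\partial x_k$ and $\theta=\theta_1+\cdots+\theta_n$. Its rank is $2^n$, and for $n=1$ it is the Gauss equation ${}_2E_1(a,b,c_1)$. Its monodromy group is given concretely as follows. Put $\alpha=e^{2\pi\sqrt{-1}a}$, $\beta=e^{2\pi\sqrt{-1}b}$, $\gamma_k=e^{2\pi\sqrt{-1}c_k}$. For any $n\ge 1$ and nonzero complex numbers $\alpha,\beta,\gamma_1,\dots,\gamma_n$, let $\mathbb{C}^{2^n}$ have basis $\{e_I\}$ indexed by $I=(i_1,\dots,i_n)\in\{0,1\}^n$, and put $|I|=i_1+\cdots+i_n$. For $k=1,\dots,n$ define the linear map $M_k$ by $M_ke_I=e_I$ if $i_k=0$, and $M_ke_I=-\gamma_k^{-1}e_{I'}+\gamma_k^{-1}e_I$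 if $i_k=1$, where $I'$ is $I$ with its $k$-th entry replaced by $0$. Define $M_0$ by $M_0e_I=e_I-v_Ie_{(1,\dots,1)}$, where $v_{(0,\dots,0)}=(-1)^n\frac{(\alpha-1)(\beta-1)\prod_{k=1}^n\gamma_k}{\alpha\beta}$ and, for $I\ne(0,\dots,0)$, $v_I=(-1)^{n+|I|}\frac{(\alpha\beta+(-1)^{|I|}\prod_{k=1}^n\gamma_k^{i_k})\prod_{k=1}^n\gamma_k^{1-i_k}}{\alpha\beta}$. The monodromy group is the subgroup $\mathbf{Mon}^{(n)}(\alpha,\beta,(\gamma_1,\dots,\gamma_n))=\langle M_0,M_1,\dots,M_n\rangle$ of $GL_{2^n}(\mathbb{C})$. These are the circuit matrices of $E_C(a,b,c)$ in a suitable basis of local solutions when the irreducibility condition below holds. In the theorem, $\mathbf{Mon}=\mathbf{Mon}^{(n)}(\alpha,\beta,(\gamma_1,\dots,\gamma_n))$, and the monodromy group of ${}_2E_1(a,b,c_k)$ is $\mathbf{Mon}^{(1)}(\alpha,\beta,\gamma_k)$. "Finite irreducible" means that the group is finite and acts irreducibly on $\mathbb{C}^{2^n}$. It is known that $\mathbf{Mon}^{(n)}(\alpha,\beta,(\gamma_1,\dots,\gamma_n))$ is irreducible if and only if $\alpha\neq\prod_{k=1}^n\gamma_k^{i_k}$ and $\beta\neq\prod_{k=1}^n\gamma_k^{i_k}$ for all $(i_1,\dots,i_n)\in\{0,1\}^n$ (equivalently, $a-\sum_k i_kc_k\notin\mathbb{Z}$ and $b-\sum_k i_kc_k\notin\mathbb{Z}$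 for all such indices). *)

theory Defs
  imports "Jordan_Normal_Form.VS_Connect" "HOL-Algebra.Generated_Groups"
begin

text \<open>
  The basis of \<open>\<complex>\<^sup>N\<close>, \<open>N = 2 ^ n\<close>, is indexed by \<open>{0,1}\<^sup>n\<close>. A multi-index
  \<open>(i\<^sub>1,\<dots>,i\<^sub>n)\<close> is encoded by the number \<open>I < 2 ^ n\<close> with binary digits \<open>i\<^sub>k\<close>, the
  digit \<open>i\<^sub>k\<close> being the coefficient of \<open>2 ^ (k - 1)\<close>. So \<open>(0,\<dots>,0)\<close> is \<open>0\<close> and
  \<open>(1,\<dots>,1)\<close> is \<open>2 ^ n - 1\<close>. Parameters \<open>\<gamma>\<close> and \<open>c\<close> are used at \<open>1,\<dots>,n\<close> only.
\<close>

definition digit :: "nat \<Rightarrow> nat \<Rightarrow> nat" where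
  "digit I k = of_bool (bit I (k - 1))"

definition weight :: "nat \<Rightarrow> nat \<Rightarrow> nat" where
  "weight n I = (\<Sum>k=1..n. digit I k)"

abbreviation basis_vec :: "nat \<Rightarrow> nat \<Rightarrow> complex vec" where
  "basis_vec n I \<equiv> unit_vec (2 ^ n) I"

text \<open>Linear maps of \<open>\<complex>\<^sup>N\<close> are matrices acting on column vectors: column \<open>I\<close> is the image of
  \<open>e\<^sub>I\<close>.\<close>

definition circuit_mat :: "nat \<Rightarrow> (nat \<Rightarrow> complex) \<Rightarrow> nat \<Rightarrow> complex mat" where
  "circuit_mat n \<gamma> k = mat_of_cols (2 ^ n)
     (map (\<lambda>I. if digit I k = 0 then basis_vec n I
               else (- inverse (\<gamma> k)) \<cdot>\<^sub>v basis_vec n (unset_bit (k - 1) I)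
                      + inverse (\<gamma> k) \<cdot>\<^sub>v basis_vec n I)
       [0..<2 ^ n])"

definition refl_coeff :: "nat \<Rightarrow> complex \<Rightarrow> complex \<Rightarrow> (nat \<Rightarrow> complex) \<Rightarrow> nat \<Rightarrow> complex" where
  "refl_coeff n \<alpha> \<beta> \<gamma> I =
     (if I = 0 then (-1) ^ n * ((\<alpha> - 1) * (\<beta> - 1) * (\<Prod>k=1..n. \<gamma> k)) / (\<alpha> * \<beta>)
      else (-1) ^ (n + weight n I)
             * ((\<alpha> * \<beta> + (-1) ^ weight n I * (\<Prod>k=1..n. \<gamma> k ^ digit I k))
                * (\<Prod>k=1..n. \<gamma> k ^ (1 - digit I k))) / (\<alpha> * \<beta>))"

definition refl_mat :: "nat \<Rightarrow> complex \<Rightarrow> complex \<Rightarrow> (nat \<Rightarrow> complex) \<Rightarrow> complex mat" where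
  "refl_mat n \<alpha> \<beta> \<gamma> = mat_of_cols (2 ^ n)
     (map (\<lambda>I. basis_vec n I - refl_coeff n \<alpha> \<beta> \<gamma> I \<cdot>\<^sub>v basis_vec n (2 ^ n - 1)) [0..<2 ^ n])"

definition GL :: "nat \<Rightarrow> complex mat monoid" where
  "GL N = units_of (ring_mat TYPE(complex) N ())"

definition Mon :: "nat \<Rightarrow> complex \<Rightarrow> complex \<Rightarrow> (nat \<Rightarrow> complex) \<Rightarrow> complex mat set" where
  "Mon n \<alpha> \<beta> \<gamma> = generate (GL (2 ^ n)) (insert (refl_mat n \<alpha> \<beta> \<gamma>) (circuit_mat n \<gamma> ` {1..n}))"

text \<open>\<open>VS_Connect\<close> hides the short name of the predicate \<open>VectorSpace.subspace K W V\<close>, ``\<open>W\<close> is a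
  \<open>K\<close>-linear subspace of \<open>V\<close>''.\<close>

definition irreducible_on :: "nat \<Rightarrow> complex mat set \<Rightarrow> bool" where
  "irreducible_on N G \<longleftrightarrow> N \<noteq> 0 \<and>
     (\<forall>W. VectorSpace.subspace class_ring W (module_vec TYPE(complex) N)
          \<and> (\<forall>g\<in>G. \<forall>w\<in>W. g *\<^sub>v w \<in> W)
        \<longrightarrow> W = {0\<^sub>v N} \<or> W = carrier_vec N)"

definition finite_irreducible :: "nat \<Rightarrow> complex mat set \<Rightarrow> bool" where
  "finite_irreducible N G \<longleftrightarrow> finite G \<and> irreducible_on N G"

definition e2pi :: "complex \<Rightarrow> complex" where
  "e2pi z = exp (2 * of_real pi * \<i> * z)"

definition Mon_EC :: "nat \<Rightarrow> complex \<Rightarrow> complex \<Rightarrow> (nat \<Rightarrow> complex) \<Rightarrow> complex mat set" where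
  "Mon_EC n a b c = Mon n (e2pi a) (e2pi b) (\<lambda>k. e2pi (c k))"

definition Mon_Gauss :: "complex \<Rightarrow> complex \<Rightarrow> complex \<Rightarrow> complex mat set" where
  "Mon_Gauss a b c = Mon_EC 1 a b (\<lambda>_. c)"

definition cong_half :: "complex \<Rightarrow> bool" where
  "cong_half z \<longleftrightarrow> z - 1 / 2 \<in> \<int>"

definition exponent_list :: "nat \<Rightarrow> complex \<Rightarrow> complex \<Rightarrow> (nat \<Rightarrow> complex) \<Rightarrow> complex list" where
  "exponent_list n a b c =
     map c [1..<n + 1] @ [b - a, (\<Sum>k=1..n. c k) - a - b - (of_nat n - 1) / 2]"

text \<open>For nonzero parameters the generators are invertible, so \<^const>\<open>Mon\<close> is a subgroup of
  the general linear group.\<close>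

lemma circuit_mat_carrier [simp]: "circuit_mat n \<gamma> k \<in> carrier_mat (2 ^ n) (2 ^ n)"
  by (rule carrier_matI) (simp_all add: circuit_mat_def mat_of_cols_def)

lemma refl_mat_carrier [simp]: "refl_mat n \<alpha> \<beta> \<gamma> \<in> carrier_mat (2 ^ n) (2 ^ n)"
  by (rule carrier_matI) (simp_all add: refl_mat_def mat_of_cols_def)

lemma unset_bit_less: "bit (I::nat) m \<Longrightarrow> unset_bit m I < I"
proof -
  assume "bit I m"
  then have "unset_bit m I \<noteq> I" by (metis bit_unset_bit_iff)
  moreover have "int (unset_bit m I) \<le> int I"
    unfolding of_nat_unset_bit_eq by (rule unset_bit_less_eq)
  ultimately show ?thesis by simp
qed

lemma circuit_mat_index:
  assumes "i < 2 ^ n" "j < 2 ^ n"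
  shows "circuit_mat n \<gamma> k $$ (i, j) =
    (if digit j k = 0 then (if i = j then 1 else 0)
     else (if i = unset_bit (k - 1) j then - inverse (\<gamma> k) else 0)
            + (if i = j then inverse (\<gamma> k) else 0))"
  using assms by (auto simp: circuit_mat_def mat_of_cols_index unit_vec_def)

lemma refl_mat_index:
  assumes "i < 2 ^ n" "j < 2 ^ n"
  shows "refl_mat n \<alpha> \<beta> \<gamma> $$ (i, j) =
    (if i = j then 1 else 0) - (if i = 2 ^ n - 1 then refl_coeff n \<alpha> \<beta> \<gamma> j else 0)"
  using assms by (auto simp: refl_mat_def mat_of_cols_index unit_vec_def)

lemma circuit_mat_Units:
  assumes "\<gamma> k \<noteq> 0"
  shows "circuit_mat n \<gamma> k \<in> Units (ring_mat TYPE(complex) (2 ^ n) ())"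
proof (rule det_non_zero_imp_unit)
  let ?M = "circuit_mat n \<gamma> k"
  have "upper_triangular ?M"
  proof
    fix i j assume "j < i" "i < dim_row ?M"
    then have "i < 2 ^ n" "j < 2 ^ n" by (auto simp: circuit_mat_def)
    with \<open>j < i\<close> show "?M $$ (i, j) = 0"
      using unset_bit_less[of j "k - 1"] by (auto simp: circuit_mat_index digit_def)
  qed
  moreover have "?M $$ (i, i) \<noteq> 0" if "i < 2 ^ n" for i
    using that assms unset_bit_less[of i "k - 1"] by (auto simp: circuit_mat_index digit_def)
  ultimately show "det ?M \<noteq> 0"
    by (subst det_upper_triangular[where n = "2 ^ n"])
       (auto simp: diag_mat_def prod_list_zero_iff circuit_mat_def)
qed simp

lemma refl_mat_Units:
  assumes "\<alpha> \<noteq> 0" "\<beta> \<noteq> 0" "\<forall>k\<in>{1..n}. \<gamma> k \<noteq> 0" "n > 0"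
  shows "refl_mat n \<alpha> \<beta> \<gamma> \<in> Units (ring_mat TYPE(complex) (2 ^ n) ())"
proof (rule det_non_zero_imp_unit)
  let ?M = "refl_mat n \<alpha> \<beta> \<gamma>"
  have d: "digit (2 ^ n - 1) k = 1" if "k \<in> {1..n}" for k
    using that bit_mask_iff[where 'a = nat, of n "k - 1"]
    by (auto simp: digit_def mask_eq_exp_minus_1)
  then have w: "weight n (2 ^ n - 1) = n" by (simp add: weight_def)
  have nz: "(2::nat) ^ n - 1 \<noteq> 0" using one_less_power[of "2::nat" n] \<open>n > 0\<close> by simp
  have v: "refl_coeff n \<alpha> \<beta> \<gamma> (2 ^ n - 1) = (\<alpha> * \<beta> + (-1) ^ n * (\<Prod>k=1..n. \<gamma> k)) / (\<alpha> * \<beta>)"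
    using nz d w by (simp add: refl_coeff_def flip: power_add)
  have "(\<Prod>k=1..n. \<gamma> k) \<noteq> 0" using assms(3) by simp
  then have v1: "refl_coeff n \<alpha> \<beta> \<gamma> (2 ^ n - 1) \<noteq> 1"
    using assms(1,2) unfolding v by (simp add: divide_eq_eq)
  have "?M $$ (i, i) \<noteq> 0" if "i < 2 ^ n" for i
    using that v1 by (auto simp: refl_mat_index)
  moreover have "?M $$ (i, j) = 0" if "i < j" "j < 2 ^ n" for i j
    using that by (auto simp: refl_mat_index)
  ultimately show "det ?M \<noteq> 0"
    by (subst det_lower_triangular[where n = "2 ^ n"])
       (auto simp: diag_mat_def prod_list_zero_iff refl_mat_def)
qed simp

lemma GL_group: "group (GL N)"
proof -
  interpret ring "ring_mat TYPE(complex) N ()" by (rule ring_mat)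
  show ?thesis unfolding GL_def by (rule units_group)
qed

lemma Mon_subgroup:
  assumes "\<alpha> \<noteq> 0" "\<beta> \<noteq> 0" "\<forall>k\<in>{1..n}. \<gamma> k \<noteq> 0" "n > 0"
  shows "subgroup (Mon n \<alpha> \<beta> \<gamma>) (GL (2 ^ n))"
  unfolding Mon_def using assms
  by (intro group.generate_is_subgroup[OF GL_group])
     (auto simp: GL_def units_of_carrier circuit_mat_Units refl_mat_Units)

end

theory Submission
  imports Defs "HOL-Number_Theory.Number_Theory" "Jordan_Normal_Form.Char_Poly"
    "HOL-Library.Nat_Bijection"
begin

text \<open>
  The proof replaces finiteness by positivity of a Hermitian form.

  Suppose \<open>\<gamma>\<^sub>k \<noteq> 1\<close> for all \<open>k\<close>. The commuting matrices \<open>M\<^sub>1, \<dots>, M\<^sub>n\<close> then have a common eigenbasis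
  \<open>f\<^sub>I\<close>, indexed by the subsets \<open>I\<close> of \<open>{1..n}\<close>, with pairwise different characters. Scaled suitably,
  its vectors add up to the special vector \<open>e\<^sub>(\<^sub>1\<^sub>,\<^sub>\<dots>\<^sub>,\<^sub>1\<^sub>)\<close> of the reflection \<open>M\<^sub>0\<close>, which becomes
  \<open>y \<mapsto> y - (\<Sum>\<^sub>I w\<^sub>I y\<^sub>I) (1, \<dots>, 1)\<close> with
  \<open>w\<^sub>I = (-1)\<^bsup>|I|\<^esup> C (\<gamma>\<^sup>I - \<alpha>) (\<gamma>\<^sup>I - \<beta>) / \<gamma>\<^sup>I\<close>, where \<open>\<gamma>\<^sup>I\<close> is the product of the \<open>\<gamma>\<^sub>k\<close>, \<open>k \<in> I\<close>. An
  invariant Hermitian form is diagonal in this basis, and invariance under \<open>M\<^sub>0\<close> makes \<open>w\<^sub>I\<close> a fixed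
  multiple of the norm of \<open>f\<^sub>I\<close>. So a positive definite invariant form exists exactly if all ratios
  \<open>w\<^sub>I / w\<^sub>\<emptyset>\<close> are positive. In terms of real exponents this says that
  \<open>(-1)\<^bsup>|I|\<^esup> sin \<pi>(c\<^sub>I - a) sin \<pi>(c\<^sub>I - b)\<close>, with \<open>c\<^sub>I\<close> the sum of the \<open>c\<^sub>k\<close>, \<open>k \<in> I\<close>, has the same sign for
  all \<open>I\<close> (\<open>alternating\<close>).

  A finite group has a positive definite invariant form, and its parameters are roots of unity, of
  common order \<open>N\<close> say. Raising them to a power \<open>t\<close> prime to \<open>N\<close> is a field automorphism, so it again
  gives a finite group and all these conjugates satisfy the sign condition. If conversely all conjugates
  have positive forms, then the matrix entries of the group lie in \<open>\<int>[\<zeta>]\<close> and all their conjugates are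
  bounded; there are only finitely many such numbers. This gives
  \<open>finite_irreducible_Mon_EC_iff\<close>: the monodromy group is finite irreducible if and only if the
  exponents are rational and \<open>(ta, tb, tc)\<close> satisfies the sign condition for all \<open>t\<close> prime to \<open>N\<close>. It
  holds for all \<open>n \<ge> 1\<close> and therefore describes both sides of the theorem.

  Condition (A) is the sign condition, for all conjugates, on the edges of the cube at the origin. For (B), the sign
  condition on a three-dimensional face shows that among the five numbers
  \<open>c\<^sub>p, c\<^sub>q, c\<^sub>r, b - a, c\<^sub>p + c\<^sub>q + c\<^sub>r - a - b\<close> the distances of any three to the nearest integers add up
  to more than \<open>1\<close> (\<open>alternating_triple\<close>). This holds for all conjugates. But the mean of the distance of
  \<open>t z\<close> to the nearest integer, over the units \<open>t\<close> modulo \<open>N\<close>, is at most \<open>1/3\<close> unless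
  \<open>z \<equiv> 1/2\<close> (\<open>sum_int_dist_multiples_le\<close>), so any three of the five numbers include one that is \<open>1/2\<close>
  modulo \<open>1\<close>. Conversely, under (B) at most two of the \<open>c\<^sub>k\<close> are not \<open>1/2\<close>, and symmetries of the
  function \<open>sin \<pi>(s - a) sin \<pi>(s - b)\<close> deduce all signs from those on the edges
  (\<open>alternating_if_count_half_ge\<close>).
\<close>

section \<open>Conjugates of sums of roots of unity\<close>

definition int_eval :: "int poly \<Rightarrow> complex \<Rightarrow> complex" where
  "int_eval P z = poly (of_int_poly P) z"

lemma int_eval_simps [simp]:
  "int_eval 0 z = 0" "int_eval 1 z = 1"
  "int_eval (P + Q) z = int_eval P z + int_eval Q z"
  "int_eval (P - Q) z = int_eval P z - int_eval Q z"
  "int_eval (- P) z = - int_eval P z"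
  "int_eval (P * Q) z = int_eval P z * int_eval Q z"
  "int_eval (P ^ m) z = int_eval P z ^ m"
  "int_eval (Polynomial.monom c m) z = of_int c * z ^ m"
  "int_eval (of_int c) z = of_int c"
  "int_eval [:c:] z = of_int c"
  "int_eval (smult c P) z = of_int c * int_eval P z"
  "int_eval (pCons c P) z = of_int c + z * int_eval P z"
  "int_eval (pcompose P Q) z = int_eval P (int_eval Q z)"
  by (simp_all add: int_eval_def hom_distribs poly_monom poly_pcompose of_int_hom.map_poly_pCons_hom)

lemma int_eval_sum [simp]: "int_eval (sum f A) z = (\<Sum>x\<in>A. int_eval (f x) z)"
  by (induction A rule: infinite_finite_induct) auto

lemma int_eval_altdef: "int_eval P z = (\<Sum>i\<le>degree P. of_int (poly.coeff P i) * z ^ i)"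
  unfolding int_eval_def by (subst poly_altdef) simp

lemma power_mod_root:
  fixes \<zeta> :: "'a :: monoid_mult"
  assumes "\<zeta> ^ N = 1"
  shows "\<zeta> ^ (m mod N) = \<zeta> ^ m"
proof -
  have "\<zeta> ^ m = \<zeta> ^ (N * (m div N) + m mod N)" by simp
  also have "\<dots> = \<zeta> ^ (m mod N)" unfolding power_add power_mult assms by simp
  finally show ?thesis by simp
qed

text \<open>
  Multiplication by \<open>y = P(\<zeta>)\<close> maps the span of \<open>1, \<zeta>, \<dots>, \<zeta>\<^bsup>N-1\<^esup>\<close> over the integers to itself, so \<open>y\<close> is an
  eigenvalue of an integer matrix and a root of its characteristic polynomial.
\<close>

lemma algebraic_int_int_eval:
  assumes "\<zeta> ^ N = 1" "N > 0"
  shows "algebraic_int (int_eval P \<zeta>)"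
proof -
  define y where "y = int_eval P \<zeta>"
  \<comment> \<open>reduction of the exponents modulo \<open>N\<close> makes multiplication by \<open>P(\<zeta>)\<close> an integer matrix\<close>
  define A :: "int mat" where
    "A = mat N N (\<lambda>(i,j). \<Sum>m\<in>{m. m \<le> degree P \<and> (i + m) mod N = j}. poly.coeff P m)"
  define v :: "complex vec" where "v = vec N (\<lambda>i. \<zeta> ^ i)"
  have A: "A \<in> carrier_mat N N" by (simp add: A_def)
  have v: "v \<in> carrier_vec N" by (simp add: v_def)
  have "map_mat of_int A *\<^sub>v v = y \<cdot>\<^sub>v v"
  proof (rule eq_vecI)
    fix i assume "i < dim_vec (y \<cdot>\<^sub>v v)"
    then have i: "i < N" by (simp add: v_def)
    have "(map_mat of_int A *\<^sub>v v) $ i =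
      (\<Sum>j<N. (\<Sum>m\<in>{m. m \<le> degree P \<and> (i + m) mod N = j}. of_int (poly.coeff P m)) * \<zeta> ^ j)"
      using i A by (simp add: scalar_prod_def v_def A_def lessThan_atLeast0)
    also have "\<dots> = (\<Sum>j<N. \<Sum>m\<in>{m. m \<le> degree P \<and> (i + m) mod N = j}.
        of_int (poly.coeff P m) * \<zeta> ^ (i + m))"
      using power_mod_root[OF assms(1)]
      by (auto simp: sum_distrib_right intro!: sum.cong)
    also have "\<dots> = (\<Sum>m\<le>degree P. of_int (poly.coeff P m) * \<zeta> ^ (i + m))"
      using sum.group[of "{..degree P}" "{..<N}" "\<lambda>m. (i + m) mod N"
         "\<lambda>m. of_int (poly.coeff P m) * \<zeta> ^ (i + m)"] assms(2) by (simp add: image_subset_iff)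
    also have "\<dots> = y * \<zeta> ^ i"
      by (simp add: y_def int_eval_altdef sum_distrib_left power_add mult_ac)
    finally show "(map_mat of_int A *\<^sub>v v) $ i = (y \<cdot>\<^sub>v v) $ i" using i by (simp add: v_def)
  qed (use A in \<open>simp add: v_def\<close>)
  moreover have "v $ 0 = 1" using assms(2) by (simp add: v_def)
  then have "v \<noteq> 0\<^sub>v N" using assms(2) by auto
  ultimately have "eigenvector (map_mat of_int A) v y"
    using A v by (auto simp: eigenvector_def)
  then have "poly (char_poly (map_mat of_int A)) y = 0"
    using eigenvalue_root_char_poly[of "map_mat of_int A" N y] A
    unfolding eigenvalue_def by auto
  then have "poly (of_int_poly (char_poly A)) y = 0"
    by (simp add: of_int_hom.char_poly_hom[OF A])
  moreover have "lead_coeff (char_poly A) = 1"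
    using degree_monic_char_poly[OF A] by auto
  ultimately show ?thesis unfolding y_def
    by (auto simp: algebraic_int_altdef_ipoly)
qed

text \<open>
  The Frobenius congruence \<open>P(z)\<^sup>p \<equiv> P(z\<^sup>p)\<close> modulo \<open>p\<close>, uniformly in \<open>z\<close>. It is the only place where
  the arithmetic of a prime enters the irreducibility argument below.
\<close>

lemma int_eval_power_prime:
  assumes "prime p"
  shows "\<exists>Q. \<forall>z. int_eval P z ^ p = int_eval P (z ^ p) + of_nat p * int_eval Q z"
proof (induction P)
  case 0
  show ?case using assms prime_gt_0_nat[OF assms] by (intro exI[of _ 0]) simp
next
  case (pCons c P)
  then obtain Q where Q: "\<And>z. int_eval P z ^ p = int_eval P (z ^ p) + of_nat p * int_eval Q z"
    by blast
  have p0: "p > 0" using assms prime_gt_0_nat by blast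
  define S where "S = (\<Sum>k\<in>{1..<p}. of_int (int (p choose k) div int p) * [:c:] ^ k * [:0, 1:] ^ (p - k) * P ^ (p - k))"
  have "[c ^ p = c] (mod int p)"
  proof -
    define a where "a = nat (c mod int p)"
    have a: "int a = c mod int p" using p0 by (simp add: a_def)
    have "[a ^ p = a] (mod p)"
    proof (cases "p dvd a")
      case True
      then show ?thesis using p0 dvd_trans[OF True dvd_power[of p a]] by (auto simp: cong_def)
    next
      case False
      have "[a ^ (p - 1) * a = 1 * a] (mod p)"
        using fermat_theorem[OF assms False] by (rule cong_scalar_right)
      moreover have "a ^ (p - 1) * a = a ^ p" using p0 by (rule power_minus_mult)
      ultimately show ?thesis by simp
    qed
    then have "[int a ^ p = int a] (mod int p)" by (metis cong_int_iff of_nat_power)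
    then show ?thesis by (simp add: a cong_def power_mod)
  qed
  then obtain d where d: "c ^ p = c + int p * d"
    using cong_sym[of "c ^ p"] by (auto simp: cong_iff_lin)
  have ch: "int (p choose k) = int p * (int (p choose k) div int p)" if "k \<in> {1..<p}" for k
  proof -
    have "p dvd (p choose k)" using that assms by (intro dvd_choose_prime) auto
    then show ?thesis by simp
  qed
  show ?case
  proof (intro exI[of _ "[:d:] + [:0,1:] ^ p * Q + S"] allI)
    fix z
    have "int_eval (pCons c P) z ^ p = (of_int c + z * int_eval P z) ^ p" by simp
    also have "\<dots> = (\<Sum>k\<le>p. of_nat (p choose k) * of_int c ^ k * (z * int_eval P z) ^ (p - k))"
      by (rule binomial_ring)
    also have "{..p} = insert 0 (insert p {1..<p})" using p0 by auto
    also have "(\<Sum>k\<in>insert 0 (insert p {1..<p}). of_nat (p choose k) * of_int c ^ k * (z * int_eval P z) ^ (p - k))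
       = (z * int_eval P z) ^ p + of_int c ^ p +
         (\<Sum>k\<in>{1..<p}. of_nat (p choose k) * of_int c ^ k * (z * int_eval P z) ^ (p - k))"
      using p0 by (simp add: sum.insert_if)
    also have "(\<Sum>k\<in>{1..<p}. of_nat (p choose k) * of_int c ^ k * (z * int_eval P z) ^ (p - k))
       = of_nat p * int_eval S z"
    proof -
      have "of_nat (p choose k) = (of_nat p * of_int (int (p choose k) div int p) :: complex)"
        if "k \<in> {1..<p}" for k
        using arg_cong[OF ch[OF that], of "of_int :: int \<Rightarrow> complex"] by simp
      then show ?thesis
        by (auto simp: S_def sum_distrib_left power_mult_distrib mult_ac intro!: sum.cong)
    qed
    also have "of_int c ^ p = (of_int c + of_nat p * of_int d :: complex)"
      using arg_cong[OF d, of "of_int :: int \<Rightarrow> complex"] by simp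
    finally show "int_eval (pCons c P) z ^ p = int_eval (pCons c P) (z ^ p) +
        of_nat p * int_eval ([:d:] + [:0,1:] ^ p * Q + S) z"
      by (simp add: power_mult_distrib Q algebra_simps)
  qed
qed


text \<open>
  A nonzero element of \<open>\<int>[\<zeta>]\<close> divides a nonzero integer, the constant term of a polynomial that
  annihilates it. So only finitely many primes divide it.
\<close>

lemma bounded_prime_divisors:
  assumes "\<zeta> ^ N = 1" "N > 0" "int_eval P \<zeta> \<noteq> 0"
  shows "\<exists>c. \<forall>p Q. prime p \<longrightarrow> int_eval P \<zeta> = of_nat p * int_eval Q \<zeta> \<longrightarrow> p \<le> (c :: nat)"
proof -
  define y where "y = int_eval P \<zeta>"
  obtain g :: "int poly" where g: "lead_coeff g = 1" "poly (of_int_poly g) y = 0"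
    using algebraic_int_int_eval[OF assms(1,2)] unfolding y_def algebraic_int_altdef_ipoly by blast
  have "g \<noteq> 0" using g(1) by auto
  \<comment> \<open>a power of the variable is split off to obtain a nonzero constant term\<close>
  from order_decomp[OF this, of 0] obtain h where
    h: "g = [:0, 1:] ^ order 0 g * h" "\<not> [:0, 1:] dvd h" by auto
  have hy: "int_eval h y = 0"
  proof -
    have "int_eval g y = 0" using g(2) by (simp add: int_eval_def)
    then have "y ^ order 0 g * int_eval h y = 0" by (subst (asm) h(1)) simp
    then show ?thesis using assms(3) by (simp add: y_def)
  qed
  obtain c0 q where q: "h = pCons c0 q" by (cases h)
  have c0: "c0 \<noteq> 0" using h(2) unfolding q using poly_eq_0_iff_dvd[of "pCons c0 q" 0] by auto
  show ?thesis
  proof (intro exI[of _ "nat \<bar>c0\<bar>"] allI impI)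
    fix p Q assume p: "prime p" and Q: "int_eval P \<zeta> = of_nat p * int_eval Q \<zeta>"
    have p0: "p > 0" using p prime_gt_0_nat by blast
    define s where "s = int_eval (Q * pcompose q P) \<zeta>"
    have ps: "of_nat p * s = - of_int c0"
      using hy Q unfolding q s_def y_def by (simp add: eq_neg_iff_add_eq_0 add.commute mult.assoc)
    then have "s = of_rat (- of_int c0 / of_nat p)"
      using p0 by (simp add: field_simps of_rat_divide of_rat_minus)
    then have "s \<in> \<rat>" by simp
    moreover have "algebraic_int s" unfolding s_def by (rule algebraic_int_int_eval[OF assms(1,2)])
    ultimately obtain k where "s = of_int k"
      using rational_algebraic_int_is_int by (metis Ints_cases)
    then have "of_int (int p * k) = (of_int (- c0) :: complex)" using ps by simp
    then have "int p * k = - c0" by (rule of_int_eq_iff[THEN iffD1])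
    then have "int p dvd c0" by (metis dvd_minus_iff dvd_triv_left)
    then have "int p \<le> \<bar>c0\<bar>" using c0 zdvd_imp_le by (metis abs_ge_zero abs_of_nat dvd_imp_le_int)
    then show "p \<le> nat \<bar>c0\<bar>" by simp
  qed
qed

text \<open>
  Adding to \<open>t\<close> the right multiple of \<open>d\<close> avoids all primes that divide \<open>M\<close>: the factor runs over just
  those primes that do not divide \<open>t\<close> already. With \<open>M\<close> a multiple of \<open>d\<close> this lifts units; with a
  factorial for \<open>M\<close> it gives a representative all of whose prime factors are large.
\<close>

lemma lift_coprime:
  fixes t d M :: nat
  assumes "coprime t d" "M > 0"
  shows "\<exists>t'. [t' = t] (mod d) \<and> coprime t' M"
proof -
  define S where "S = {p. prime p \<and> p dvd M \<and> \<not> p dvd t}"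
  have fS: "finite S" unfolding S_def using assms(2) by (rule_tac finite_subset[OF _ finite_divisors_nat[of M]]) auto
  define t' where "t' = t + d * \<Prod>S"
  have "coprime t' M"
  proof (rule ccontr)
    assume "\<not> coprime t' M"
    then obtain p where p: "prime p" "p dvd t'" "p dvd M"
      by (metis coprime_iff_gcd_eq_1 prime_factor_nat gcd_greatest_iff gcd_nat.bounded_iff)
    show False
    proof (cases "p dvd t")
      case True
      then have "p dvd d * \<Prod>S" using p(2) unfolding t'_def by (metis dvd_add_right_iff)
      moreover have "\<not> p dvd d" using True assms(1) p(1)
        by (meson coprime_common_divisor_nat not_prime_unit coprime_def)
      ultimately have "p dvd \<Prod>S" using p(1) prime_dvd_mult_iff by blast
      then obtain q where "q \<in> S" "p dvd q" using p(1) fS by (auto simp: prime_dvd_prod_iff)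
      then show False using True p(1) primes_dvd_imp_eq by (auto simp: S_def)
    next
      case False
      then have "p dvd \<Prod>S" using p fS by (auto simp: S_def intro!: dvd_prodI[where f = "\<lambda>x. x"])
      then have "p dvd t" using p(2) unfolding t'_def by (metis dvd_add_left_iff dvd_mult)
      then show False using False by simp
    qed
  qed
  moreover have "[t' = t] (mod d)" by (simp add: t'_def cong_def)
  ultimately show ?thesis by blast
qed

text \<open>
  This is the irreducibility of the cyclotomic polynomial, in the form needed here: \<open>\<zeta> \<mapsto> \<zeta>\<^sup>t\<close> respects all
  polynomial relations. The proof is Landau's. For a large prime \<open>p\<close> the Frobenius congruence makes
  \<open>P(\<zeta>\<^bsup>jp\<^esup>)\<close> divisible by \<open>p\<close> if \<open>P(\<zeta>\<^sup>j) = 0\<close>; as there are only finitely many values \<open>P(\<zeta>\<^sup>i)\<close>, it vanishes. It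
  remains to write \<open>t\<close>, modulo \<open>N\<close>, as a product of large primes.
\<close>

theorem int_eval_root_power_coprime:
  assumes "\<zeta> ^ N = 1" "N > 0" "int_eval P \<zeta> = 0" "coprime t N"
  shows "int_eval P (\<zeta> ^ t) = 0"
proof -
  define Y where "Y = (\<lambda>i. int_eval P (\<zeta> ^ i)) ` {..<N} - {0}"
  have "\<exists>c. \<forall>p Q. prime p \<longrightarrow> y = of_nat p * int_eval Q \<zeta> \<longrightarrow> p \<le> (c :: nat)" if yY: "y \<in> Y" for y
  proof -
    obtain i :: nat where "y = int_eval P (\<zeta> ^ i)" using yY by (auto simp: Y_def)
    then have y: "y = int_eval (pcompose P (Polynomial.monom 1 i)) \<zeta>" by simp
    have "y \<noteq> 0" using that by (simp add: Y_def)
    then show ?thesis unfolding y by (rule bounded_prime_divisors[OF assms(1,2)])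
  qed
  then obtain c where c: "\<And>y p Q. y \<in> Y \<Longrightarrow> prime p \<Longrightarrow> y = of_nat p * int_eval Q \<zeta> \<Longrightarrow> p \<le> (c y :: nat)"
    by metis
  define B where "B = (\<Sum>y\<in>Y. c y)"
  have "finite Y" by (simp add: Y_def)
  have step: "int_eval P (\<zeta> ^ (j * p)) = 0" if pp: "prime p" and pB: "p > B" and Pj: "int_eval P (\<zeta> ^ j) = 0" for p j
  proof (rule ccontr)
    assume nz: "int_eval P (\<zeta> ^ (j * p)) \<noteq> 0"
    obtain Q where Q: "\<And>z. int_eval P z ^ p = int_eval P (z ^ p) + of_nat p * int_eval Q z"
      using int_eval_power_prime[OF pp, of P] by blast
    have "int_eval P (\<zeta> ^ (j * p)) = of_nat p * int_eval (pcompose (- Q) (Polynomial.monom 1 j)) \<zeta>"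
      using Q[of "\<zeta> ^ j"] Pj prime_gt_0_nat[OF pp]
      by (simp add: power_mult power_0_left eq_neg_iff_add_eq_0)
    moreover have "int_eval P (\<zeta> ^ (j * p)) \<in> Y"
      using nz assms(2) power_mod_root[OF assms(1), of "j * p"]
      by (auto simp: Y_def intro!: image_eqI[of _ _ "(j * p) mod N"])
    ultimately have "p \<le> c (int_eval P (\<zeta> ^ (j * p)))" using c pp by blast
    also have "\<dots> \<le> B" unfolding B_def
      using \<open>finite Y\<close> \<open>_ \<in> Y\<close> by (intro member_le_sum) auto
    finally show False using pB by simp
  qed
  \<comment> \<open>all prime factors of \<open>t'\<close> exceed \<open>B\<close>\<close>
  obtain t' where t': "[t' = t] (mod N)" "coprime t' (fact B)"
    using lift_coprime[OF assms(4), of "fact B"] by auto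
  have ind: "int_eval P (\<zeta> ^ s) = 0" if "coprime s (fact B :: nat)" "s > 0" for s
    using that
  proof (induction s rule: prime_divisors_induct)
    case zero
    then show ?case by simp
  next
    case (unit x)
    then show ?case using assms(3) by simp
  next
    case (factor p x)
    then have "p > B" using prime_dvd_fact_iff[of p B]
      by (metis coprime_mult_left_iff coprime_absorb_left leI not_prime_unit)
    then show ?case using step[of p x] factor by (simp add: mult.commute)
  qed
  have eq: "\<zeta> ^ t' = \<zeta> ^ t" using t'(1) power_mod_root[OF assms(1)] unfolding cong_def by metis
  show ?thesis
  proof (cases "t' = 0")
    case True
    then have "N dvd t" using cong_sym[OF t'(1)] by (simp add: cong_0_iff)
    then have "N = 1" using assms(4) by (metis coprime_absorb_right nat_dvd_1_iff_1)
    then show ?thesis using assms(1,3) by simp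
  next
    case False
    then show ?thesis using ind[of t'] t'(2) eq by simp
  qed
qed

section \<open>Sums over the units modulo an integer\<close>

definition units_mod :: "nat \<Rightarrow> nat set" where
  "units_mod N = {t. t < N \<and> coprime t N}"

lemma finite_units_mod [simp]: "finite (units_mod N)"
  by (simp add: units_mod_def)

lemma units_mod_1 [simp]: "units_mod (Suc 0) = {0}"
  by (auto simp: units_mod_def)

lemma mod_in_units_mod: "N > 0 \<Longrightarrow> coprime t N \<Longrightarrow> t mod N \<in> units_mod N"
  by (auto simp: units_mod_def coprime_mod_left_iff)

lemma card_units_mod_pos: "N > 0 \<Longrightarrow> card (units_mod N) > 0"
  using mod_in_units_mod[of N 1] by (auto simp: card_gt_0_iff)

lemma bij_betw_units_mod_mult:
  assumes "coprime g N" "N > 0"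
  shows "bij_betw (\<lambda>t. g * t mod N) (units_mod N) (units_mod N)"
proof -
  have "inj_on (\<lambda>t. g * t mod N) (units_mod N)"
  proof (rule inj_onI)
    fix s t assume st: "s \<in> units_mod N" "t \<in> units_mod N" "g * s mod N = g * t mod N"
    then have "[g * s = g * t] (mod N)" by (simp add: cong_def)
    then have "[s = t] (mod N)" using assms(1) by (simp add: cong_mult_lcancel_nat)
    then show "s = t" using st by (simp add: cong_def units_mod_def)
  qed
  moreover have "(\<lambda>t. g * t mod N) ` units_mod N \<subseteq> units_mod N"
    using assms by (auto intro!: mod_in_units_mod simp: units_mod_def)
  ultimately show ?thesis
    by (simp add: bij_betw_def endo_inj_surj)
qed

lemma sum_units_mod_mult:
  assumes "coprime g N" "N > 0" "\<And>t. f (t mod N) = f t"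
  shows "(\<Sum>t\<in>units_mod N. f (g * t)) = (\<Sum>t\<in>units_mod N. f t)"
  using sum.reindex_bij_betw[OF bij_betw_units_mod_mult[OF assms(1,2)], of f] assms(3) by simp

text \<open>
  The units modulo \<open>N\<close> cover each unit modulo a divisor \<open>d\<close> equally often. Both sides are the sum of
  \<open>f (g t)\<close> over all pairs of a unit \<open>g\<close> modulo \<open>d\<close> and a unit \<open>t\<close> modulo \<open>N\<close>: multiplication by \<open>t\<close> permutes
  the units modulo \<open>d\<close>, and multiplication by a lift of \<open>g\<close> permutes those modulo \<open>N\<close>.
\<close>

lemma sum_units_mod_equidistributed:
  fixes f :: "nat \<Rightarrow> real"
  assumes "d dvd N" "N > 0" "\<And>t. f (t mod d) = f t"
  shows "real (card (units_mod d)) * (\<Sum>t\<in>units_mod N. f t)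
       = real (card (units_mod N)) * (\<Sum>t\<in>units_mod d. f t)"
proof -
  have d: "d > 0" using assms(1,2) by (auto intro: Nat.gr0I)
  have f_cong: "f s = f t" if "[s = t] (mod d)" for s t
    using that assms(3) unfolding cong_def by metis
  have fN: "f (t mod N) = f t" for t using assms(1) by (intro f_cong) (simp add: cong_def mod_mod_cancel)
  have 1: "(\<Sum>t\<in>units_mod N. f (g * t)) = (\<Sum>t\<in>units_mod N. f t)" if g: "g \<in> units_mod d" for g
  proof -
    obtain g' where g': "[g' = g] (mod d)" "coprime g' N"
      using lift_coprime[of g d N] g assms(2) by (auto simp: units_mod_def)
    have "(\<Sum>t\<in>units_mod N. f (g' * t)) = (\<Sum>t\<in>units_mod N. f t)"
      using sum_units_mod_mult[of g' N f] g'(2) assms(2) fN by blast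
    moreover have "f (g' * t) = f (g * t)" for t by (intro f_cong cong_mult g'(1)) simp
    ultimately show ?thesis by simp
  qed
  have 2: "(\<Sum>g\<in>units_mod d. f (g * t)) = (\<Sum>g\<in>units_mod d. f g)" if t: "t \<in> units_mod N" for t
  proof -
    have "coprime t d" using t assms(1) by (auto simp: units_mod_def dest: coprime_divisors[OF dvd_refl])
    then show ?thesis using sum_units_mod_mult[of t d f] d assms(3) by (simp add: mult.commute)
  qed
  have "real (card (units_mod d)) * (\<Sum>t\<in>units_mod N. f t)
      = (\<Sum>g\<in>units_mod d. \<Sum>t\<in>units_mod N. f (g * t))" using 1 by simp
  also have "\<dots> = (\<Sum>t\<in>units_mod N. \<Sum>g\<in>units_mod d. f (g * t))" by (rule sum.swap)
  also have "\<dots> = real (card (units_mod N)) * (\<Sum>t\<in>units_mod d. f t)" using 2 by simp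
  finally show ?thesis .
qed

lemma e2pi_of_real: "e2pi (of_real x) = cis (2 * pi * x)"
  by (simp add: e2pi_def cis_conv_exp mult_ac)

lemma e2pi_add: "e2pi (x + y) = e2pi x * e2pi y"
  by (simp add: e2pi_def distrib_left exp_add)

lemma e2pi_0 [simp]: "e2pi 0 = 1" by (simp add: e2pi_def)

lemma e2pi_nonzero [simp]: "e2pi z \<noteq> 0" by (simp add: e2pi_def)

lemma e2pi_of_nat_mult: "e2pi (of_nat m * z) = e2pi z ^ m"
  unfolding e2pi_def exp_of_nat_mult[symmetric] by (simp add: mult_ac)

lemma e2pi_of_int [simp]: "e2pi (of_int k) = 1"
  using e2pi_of_real[of "of_int k"] cis_multiple_2pi[of "of_int k"] by simp

lemma e2pi_of_nat [simp]: "e2pi (of_nat k) = 1"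
  using e2pi_of_int[of "int k"] by simp

lemma e2pi_1 [simp]: "e2pi 1 = 1"
  using e2pi_of_int[of 1] by simp

lemma e2pi_add_of_int: "e2pi (z + of_int k) = e2pi z"
  by (simp add: e2pi_add)

lemma e2pi_eq_1_iff: "e2pi z = 1 \<longleftrightarrow> z \<in> \<int>"
proof
  assume z: "e2pi z = 1"
  have "norm (e2pi z) = exp (- 2 * pi * Im z)" by (simp add: e2pi_def)
  then have "Im z = 0" using z by simp
  then have zr: "z = of_real (Re z)" by (simp add: complex_eq_iff)
  have "cis (2 * pi * Re z) = 1" using z e2pi_of_real[of "Re z"] zr by simp
  then have "cos (2 * pi * Re z) = 1" by (metis cis.sel(1) one_complex.sel(1))
  then obtain n :: int where "2 * pi * Re z = of_int n * 2 * pi" by (auto simp: cos_one_2pi_int)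
  then have "Re z = of_int n" by simp
  then have "z = of_int n" using zr by (metis of_real_of_int_eq)
  then show "z \<in> \<int>" by simp
qed (auto elim!: Ints_cases)

lemma norm_e2pi_of_real [simp]: "norm (e2pi (of_real x)) = 1"
  by (simp add: e2pi_of_real)

definition ramanujan_sum :: "nat \<Rightarrow> int \<Rightarrow> complex" where
  "ramanujan_sum N k = (\<Sum>t\<in>units_mod N. e2pi (of_int k * of_nat t / of_nat N))"

lemma sum_e2pi_multiples:
  assumes "p > 0"
  shows "(\<Sum>j<p. e2pi (of_int k * of_nat j / of_nat p)) = (if int p dvd k then of_nat p else 0)"
proof -
  define z where "z = e2pi (of_int k / of_nat p)"
  have z: "e2pi (of_int k * of_nat j / of_nat p) = z ^ j" for j
    unfolding z_def e2pi_of_nat_mult[symmetric] by (simp add: mult.commute)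
  have zp: "z ^ p = 1"
    unfolding z_def e2pi_of_nat_mult[symmetric] using assms by simp
  have z1: "z = 1 \<longleftrightarrow> int p dvd k"
  proof -
    have "z = 1 \<longleftrightarrow> (of_int k / of_int (int p) :: complex) \<in> \<int>" by (simp add: z_def e2pi_eq_1_iff)
    also have "\<dots> \<longleftrightarrow> int p dvd k" using assms by (subst of_int_div_of_int_in_Ints_iff) auto
    finally show ?thesis .
  qed
  show ?thesis
  proof (cases "z = 1")
    case True
    then show ?thesis using z1 by (simp add: z)
  next
    case False
    then show ?thesis using z1 zp by (simp add: z geometric_sum)
  qed
qed

lemma ramanujan_sum_1 [simp]: "ramanujan_sum (Suc 0) k = 1"
  by (simp add: ramanujan_sum_def)

text \<open>
  The residues \<open>t\<close> modulo \<open>pm\<close> that are prime to \<open>m\<close> have the form \<open>s + mj\<close>, and the sum over \<open>j\<close> is a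
  geometric sum. Among them, those divisible by \<open>p\<close> have to be removed; they exist only if \<open>p\<close> does not
  divide \<open>m\<close>. Induction over the prime factors now shows that all Ramanujan sums are integers and that
  those at \<open>1\<close>, which are the values of the Moebius function, lie in \<open>{-1, 0, 1}\<close>.
\<close>

lemma ramanujan_sum_prime_mult:
  assumes p: "prime p" and m: "m > 0"
  shows "ramanujan_sum (p * m) k =
    (if int p dvd k then of_nat p * ramanujan_sum m (k div int p) else 0)
    - (if p dvd m then 0 else ramanujan_sum m k)"
proof -
  have p0: "p > 0" using p prime_gt_0_nat by blast
  define f where "f t = e2pi (of_int k * of_nat t / of_nat (p * m))" for t :: nat
  define T where "T = {t. t < p * m \<and> coprime t m}"
  have "(\<Sum>t\<in>T. f t) = (\<Sum>(s, j)\<in>units_mod m \<times> {..<p}. f (s + m * j))"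
  proof (rule sum.reindex_bij_witness[of _ "\<lambda>(s, j). s + m * j" "\<lambda>t. (t mod m, t div m)"])
    fix t assume "t \<in> T"
    then show "(t mod m, t div m) \<in> units_mod m \<times> {..<p}"
      using m by (auto simp: T_def units_mod_def div_less_iff_less_mult coprime_mod_left_iff)
  next
    fix x assume "x \<in> units_mod m \<times> {..<p}"
    then obtain s j where x: "x = (s, j)" "s < m" "coprime s m" "j < p" by (auto simp: units_mod_def)
    have "s + m * j < m * Suc j" using x by simp
    also have "\<dots> \<le> m * p" using x by (intro mult_le_mono) auto
    finally show "(case x of (s, j) \<Rightarrow> s + m * j) \<in> T"
      using x m coprime_mod_left_iff[of m "s + m * j"] by (simp add: T_def mult.commute)
  qed (auto simp: units_mod_def)
  also have "\<dots> = (\<Sum>s\<in>units_mod m. \<Sum>j<p. f s * e2pi (of_int k * of_nat j / of_nat p))"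
    unfolding sum.cartesian_product[symmetric] f_def e2pi_add[symmetric]
    using m p0 by (intro sum.cong refl arg_cong[of _ _ e2pi]) (simp_all add: field_simps)
  also have "\<dots> = (if int p dvd k then of_nat p * ramanujan_sum m (k div int p) else 0)"
  proof (cases "int p dvd k")
    case True
    then obtain l where k: "k = int p * l" by auto
    have "f s = e2pi (of_int l * of_nat s / of_nat m)" for s
      using p0 unfolding f_def k by simp
    then show ?thesis using True sum_e2pi_multiples[OF p0, of k] p0
      unfolding sum_distrib_left[symmetric] sum_distrib_right[symmetric]
      by (simp add: k ramanujan_sum_def flip: sum_distrib_right)
  next
    case False
    then show ?thesis using sum_e2pi_multiples[OF p0, of k] by (simp flip: sum_distrib_left)
  qed
  finally have 1: "(\<Sum>t\<in>T. f t) = (if int p dvd k then of_nat p * ramanujan_sum m (k div int p) else 0)" .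
  \<comment> \<open>the residues prime to \<open>m\<close> but not to \<open>pm\<close> are the multiples of \<open>p\<close> among them\<close>
  have T: "T = units_mod (p * m) \<union> {t\<in>T. p dvd t}" "units_mod (p * m) \<inter> {t\<in>T. p dvd t} = {}"
    using p prime_imp_coprime[OF p] not_prime_unit[of p]
    by (auto simp: T_def units_mod_def coprime_commute coprime_absorb_left coprime_absorb_right)
  have "finite T" by (simp add: T_def)
  have "(\<Sum>t\<in>T. f t) = (\<Sum>t\<in>units_mod (p * m). f t) + (\<Sum>t | t \<in> T \<and> p dvd t. f t)"
    using \<open>finite T\<close> by (subst T(1), subst sum.union_disjoint[OF _ _ T(2)]) auto
  moreover have "(\<Sum>t | t \<in> T \<and> p dvd t. f t) = (if p dvd m then 0 else ramanujan_sum m k)"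
  proof (cases "p dvd m")
    case True
    have "{t. t \<in> T \<and> p dvd t} = {}"
    proof -
      have False if t: "coprime t m" "p dvd t" for t
        using coprime_common_divisor[OF t True] p not_prime_unit[of p] by simp
      then show ?thesis by (auto simp: T_def)
    qed
    then show ?thesis using True by (simp only: sum.empty if_True)
  next
    case False
    then have "coprime p m" using p prime_imp_coprime by blast
    then have "{t \<in> T. p dvd t} = (\<lambda>s. p * s) ` units_mod m"
      using p0 by (auto simp: T_def units_mod_def)
    then have "(\<Sum>t | t \<in> T \<and> p dvd t. f t) = (\<Sum>s\<in>units_mod m. f (p * s))"
      using p0 by (subst sum.reindex[symmetric, of "\<lambda>s. p * s", unfolded o_def]) (auto simp: inj_on_def)
    also have "\<dots> = ramanujan_sum m k"
      using p0 by (simp add: ramanujan_sum_def f_def)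
    finally show ?thesis using False by simp
  qed
  ultimately show ?thesis using 1 unfolding ramanujan_sum_def f_def by (simp add: eq_diff_eq)
qed

lemma ramanujan_sum_Ints: "N > 0 \<Longrightarrow> ramanujan_sum N k \<in> \<int>"
proof (induction N arbitrary: k rule: prime_divisors_induct)
  case (unit x)
  then show ?case by simp
next
  case (factor p x)
  then have "x > 0" by simp
  then show ?case using factor by (auto simp: ramanujan_sum_prime_mult)
qed simp

lemma ramanujan_sum_at_1:
  "N > 0 \<Longrightarrow> ramanujan_sum N 1 \<in> {-1, 0, 1}"
proof (induction N rule: prime_divisors_induct)
  case (unit x)
  then show ?case by simp
next
  case (factor p x)
  then have "x > 0" by simp
  moreover have "\<not> int p dvd 1" using factor(1) not_prime_unit by auto
  ultimately show ?case using factor by (auto simp: ramanujan_sum_prime_mult)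
qed simp

lemma ramanujan_sum_prime:
  assumes "prime p" shows "ramanujan_sum p 1 = -1"
proof -
  have "\<not> p dvd 1" "\<not> int p dvd 1" using assms not_prime_unit by auto
  then show ?thesis using ramanujan_sum_prime_mult[OF assms, of 1 1] by simp
qed

lemma finite_image_factor:
  assumes "finite (f ` S)" "\<And>x y. x \<in> S \<Longrightarrow> y \<in> S \<Longrightarrow> f x = f y \<Longrightarrow> g x = g y"
  shows "finite (g ` S)"
proof (rule finite_subset)
  show "g ` S \<subseteq> (\<lambda>v. g (SOME x. x \<in> S \<and> f x = v)) ` f ` S"
  proof
    fix y assume "y \<in> g ` S"
    then obtain x where x: "x \<in> S" "y = g x" by blast
    have "(SOME z. z \<in> S \<and> f z = f x) \<in> S \<and> f (SOME z. z \<in> S \<and> f z = f x) = f x"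
      using x(1) by (intro someI[of "\<lambda>z. z \<in> S \<and> f z = f x" x]) simp
    then have "g x = g (SOME z. z \<in> S \<and> f z = f x)" using x(1) by (intro assms(2)) auto
    then show "y \<in> (\<lambda>v. g (SOME x. x \<in> S \<and> f x = v)) ` f ` S"
      using x by (intro image_eqI[OF _ imageI[of x S f]]) auto
  qed
qed (use assms(1) in simp)

text \<open>
  An element \<open>y\<close> of \<open>\<int>[\<zeta>]\<close> is determined by the traces of \<open>y \<zeta>\<^bsup>-j\<^esup>\<close>, \<open>j < N\<close>: if they all vanish, so does the
  trace of \<open>y\<close> times its complex conjugate, a sum of squares of absolute values. These traces are integers, as
  combinations of Ramanujan sums, and a bound for the conjugates bounds them.
\<close>

theorem finite_bounded_conjugates:
  fixes B :: real
  assumes "N > 0"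
  defines "\<zeta> \<equiv> e2pi (1 / of_nat N)"
  shows "finite {int_eval P \<zeta> | P. \<forall>t\<in>units_mod N. norm (int_eval P (\<zeta> ^ t)) \<le> B}"
proof -
  define S where "S = {P. \<forall>t\<in>units_mod N. norm (int_eval P (\<zeta> ^ t)) \<le> B}"
  have z: "\<zeta> ^ t = e2pi (of_real (real t / real N))" for t
    unfolding \<zeta>_def e2pi_of_nat_mult[symmetric] by simp
  have z1: "norm (\<zeta> ^ t) = 1" for t unfolding z by (rule norm_e2pi_of_real)
  have zN: "\<zeta> ^ N = 1" using assms(1) unfolding z by simp
  define \<tau> where "\<tau> P j = (\<Sum>t\<in>units_mod N. int_eval P (\<zeta> ^ t) * cnj (\<zeta> ^ t) ^ j)" for P j
  have tau_int: "\<tau> P j \<in> \<int>" for P j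
  proof -
    have "\<tau> P j = (\<Sum>t\<in>units_mod N. \<Sum>i\<le>degree P. of_int (poly.coeff P i) * ((\<zeta> ^ t) ^ i * cnj (\<zeta> ^ t) ^ j))"
      by (simp only: \<tau>_def int_eval_altdef sum_distrib_right mult.assoc)
    also have "\<dots> = (\<Sum>i\<le>degree P. of_int (poly.coeff P i) * (\<Sum>t\<in>units_mod N. (\<zeta> ^ t) ^ i * cnj (\<zeta> ^ t) ^ j))"
      by (subst sum.swap) (simp add: sum_distrib_left)
    also have "\<dots> = (\<Sum>i\<le>degree P. of_int (poly.coeff P i) * ramanujan_sum N (int i - int j))"
    proof (intro sum.cong refl arg_cong2[of _ _ _ _ "(*)"])
    fix i show "(\<Sum>t\<in>units_mod N. (\<zeta> ^ t) ^ i * cnj (\<zeta> ^ t) ^ j) = ramanujan_sum N (int i - int j)"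
      unfolding ramanujan_sum_def
    proof (rule sum.cong[OF refl])
      fix t
      have "cnj (\<zeta> ^ t) = e2pi (of_real (- real t / real N))"
        unfolding z e2pi_of_real by (simp add: cis_cnj)
      then have "cnj (\<zeta> ^ t) ^ j = e2pi (of_nat j * of_real (- real t / real N))"
        by (simp only: e2pi_of_nat_mult)
      then show "(\<zeta> ^ t) ^ i * cnj (\<zeta> ^ t) ^ j = e2pi (of_int (int i - int j) * of_nat t / of_nat N)"
        unfolding z[of t] e2pi_of_nat_mult[symmetric]
        by (simp add: diff_divide_distrib left_diff_distrib flip: e2pi_add)
    qed
    qed
    finally show ?thesis using ramanujan_sum_Ints[OF assms(1)]
      by (auto intro!: Ints_sum Ints_mult)
  qed
  define K where "K = \<lceil>real (card (units_mod N)) * \<bar>B\<bar>\<rceil>"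
  have tau_bound: "\<tau> P j \<in> of_int ` {- K..K}" if P: "P \<in> S" for P j
  proof -
    obtain k where k: "\<tau> P j = of_int k" using tau_int Ints_cases by blast
    have "norm (\<tau> P j) \<le> (\<Sum>t\<in>units_mod N. \<bar>B\<bar>)"
      unfolding \<tau>_def
    proof (rule sum_norm_le)
      fix t assume "t \<in> units_mod N"
      then have "norm (int_eval P (\<zeta> ^ t)) \<le> \<bar>B\<bar>" using P by (force simp: S_def)
      then show "norm (int_eval P (\<zeta> ^ t) * cnj (\<zeta> ^ t) ^ j) \<le> \<bar>B\<bar>"
        using z1[of t] by (simp add: norm_mult norm_power del: complex_cnj_power)
    qed
    then have "\<bar>real_of_int k\<bar> \<le> real (card (units_mod N)) * \<bar>B\<bar>" by (simp add: k)
    also have "\<dots> \<le> of_int K" unfolding K_def by linarith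
    finally have "\<bar>k\<bar> \<le> K" by linarith
    then show ?thesis unfolding k by (intro imageI) auto
  qed
  have "finite ((\<lambda>P. restrict (\<tau> P) {..<N}) ` S)"
  proof (rule finite_subset)
    show "(\<lambda>P. restrict (\<tau> P) {..<N}) ` S \<subseteq> PiE {..<N} (\<lambda>_. of_int ` {- K..K})"
    proof (intro image_subsetI)
      fix P assume "P \<in> S"
      then show "restrict (\<tau> P) {..<N} \<in> PiE {..<N} (\<lambda>_. of_int ` {- K..K})"
        using tau_bound[of P] unfolding restrict_PiE_iff by blast
    qed
  qed (auto intro!: finite_PiE)
  then have "finite ((\<lambda>P. int_eval P \<zeta>) ` S)"
  proof (rule finite_image_factor)
    fix P P' assume "P \<in> S" "P' \<in> S" and eq: "restrict (\<tau> P) {..<N} = restrict (\<tau> P') {..<N}"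
    define Q where "Q = P - P'"
    have "\<tau> Q j = 0" if "j < N" for j
      using fun_cong[OF eq, of j] that
      by (simp add: \<tau>_def Q_def left_diff_distrib sum_subtractf)
    moreover have "\<tau> Q (j mod N) = \<tau> Q j" for j
    proof -
      have "cnj (\<zeta> ^ t) ^ N = 1" for t
      proof -
        have "(\<zeta> ^ t) ^ N = (\<zeta> ^ N) ^ t" by (simp only: power_mult[symmetric] mult.commute)
        then have "cnj ((\<zeta> ^ t) ^ N) = 1" by (simp only: zN) simp
        then show ?thesis by simp
      qed
      from power_mod_root[OF this] show ?thesis unfolding \<tau>_def by (simp only:)
    qed
    ultimately have tau0: "\<tau> Q j = 0" for j
    proof -
      have "\<tau> Q j = \<tau> Q (j mod N)" by (rule sym) fact
      also have "\<dots> = 0" using assms(1) by (intro \<open>\<And>j. j < N \<Longrightarrow> \<tau> Q j = 0\<close>) simp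
      finally show ?thesis .
    qed
    have "(\<Sum>t\<in>units_mod N. int_eval Q (\<zeta> ^ t) * cnj (int_eval Q (\<zeta> ^ t)))
        = (\<Sum>t\<in>units_mod N. \<Sum>j\<le>degree Q. of_int (poly.coeff Q j) * (int_eval Q (\<zeta> ^ t) * cnj (\<zeta> ^ t) ^ j))"
      by (intro sum.cong refl) (subst (2) int_eval_altdef, simp add: sum_distrib_left mult.left_commute)
    also have "\<dots> = (\<Sum>j\<le>degree Q. of_int (poly.coeff Q j) * \<tau> Q j)"
      by (subst sum.swap) (simp add: \<tau>_def sum_distrib_left)
    also have "\<dots> = 0" using tau0 by simp
    finally have "(\<Sum>t\<in>units_mod N. of_real ((norm (int_eval Q (\<zeta> ^ t)))\<^sup>2)) = (0 :: complex)"
      unfolding complex_norm_square .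
    then have "complex_of_real (\<Sum>t\<in>units_mod N. (norm (int_eval Q (\<zeta> ^ t)))\<^sup>2) = 0"
      by (simp only: of_real_sum)
    then have "(\<Sum>t\<in>units_mod N. (norm (int_eval Q (\<zeta> ^ t)))\<^sup>2) = 0"
      by (simp only: of_real_eq_0_iff)
    then have "\<forall>t\<in>units_mod N. (norm (int_eval Q (\<zeta> ^ t)))\<^sup>2 = 0"
      by (rule sum_nonneg_eq_0_iff[THEN iffD1, rotated 2]) simp_all
    then have Q0: "int_eval Q (\<zeta> ^ t) = 0" if "t \<in> units_mod N" for t
      using that by simp
    have "int_eval Q (\<zeta> ^ (1 mod N)) = 0"
      using assms(1) by (intro Q0 mod_in_units_mod) auto
    then show "int_eval P \<zeta> = int_eval P' \<zeta>"
      unfolding power_mod_root[OF zN] by (simp add: Q_def)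
  qed
  moreover have "{int_eval P \<zeta> | P. \<forall>t\<in>units_mod N. norm (int_eval P (\<zeta> ^ t)) \<le> B} = (\<lambda>P. int_eval P \<zeta>) ` S"
    by (auto simp: S_def)
  ultimately show ?thesis by simp
qed

section \<open>The mean distance to the nearest integer\<close>

definition int_dist :: "real \<Rightarrow> real" where
  "int_dist x = \<bar>x - of_int (round x)\<bar>"

lemma int_dist_add_of_int [simp]: "int_dist (x + of_int k) = int_dist x"
proof -
  have "round (x + of_int k) = round x + k"
  proof -
    have "x + of_int k + 1 / 2 = (x + 1 / 2) + of_int k" by simp
    then show ?thesis by (simp only: round_def floor_add_int)
  qed
  then show ?thesis by (simp add: int_dist_def)
qed

lemma int_dist_eq_abs:
  assumes "\<bar>y\<bar> \<le> 1 / 2" "x - y \<in> \<int>"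
  shows "int_dist x = \<bar>y\<bar>"
proof -
  obtain k where k: "x - y = of_int k" using assms(2) by (auto elim: Ints_cases)
  then have "int_dist x = int_dist (y + of_int k)" by (simp add: algebra_simps)
  also have "\<dots> = int_dist y" by simp
  also have "\<dots> = \<bar>y\<bar>"
  proof (cases "y = 1 / 2")
    case True
    have "round (1 / 2 :: real) = 1" by (simp add: round_def)
    then show ?thesis unfolding int_dist_def True by simp
  next
    case False
    then have "round y = 0" using assms(1) unfolding round_def by (simp add: floor_eq_iff abs_le_iff; argo)
    then show ?thesis by (simp add: int_dist_def)
  qed
  finally show ?thesis .
qed

lemma int_dist_cases:
  obtains y where "\<bar>y\<bar> \<le> 1 / 2" "x - y \<in> \<int>" "int_dist x = \<bar>y\<bar>"
proof -
  have "\<bar>x - of_int (round x)\<bar> \<le> 1 / 2" by (metis of_int_round_abs_le abs_minus_commute)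
  then show ?thesis by (intro that[of "x - of_int (round x)"]) (simp_all add: int_dist_def)
qed

lemma int_dist_cong: "x - y \<in> \<int> \<Longrightarrow> int_dist x = int_dist y"
proof -
  assume "x - y \<in> \<int>"
  then obtain k where "x - y = of_int k" by (rule Ints_cases)
  then have "x = y + of_int k" by simp
  then show ?thesis by simp
qed

lemma int_dist_double_le: "int_dist (2 * x) \<le> 1 - 2 * int_dist x"
proof -
  obtain y where y: "\<bar>y\<bar> \<le> 1 / 2" "x - y \<in> \<int>" "int_dist x = \<bar>y\<bar>" by (rule int_dist_cases)
  have z: "int_dist (2 * x) = int_dist (2 * y)"
    using Ints_mult[OF Ints_numeral y(2), of "num.Bit0 num.One"] by (intro int_dist_cong) (simp add: algebra_simps)
  show ?thesis
  proof (cases "\<bar>2 * y\<bar> \<le> 1 / 2")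
    case True
    then have "int_dist (2 * y) = \<bar>2 * y\<bar>" by (intro int_dist_eq_abs) auto
    then show ?thesis using True y z by auto
  next
    case False
    define s where "s = (if y > 0 then 1 else -1 :: real)"
    have "int_dist (2 * y) = \<bar>2 * y - s\<bar>"
      using False y(1) by (intro int_dist_eq_abs) (auto simp: s_def)
    then show ?thesis using False y z by (auto simp: s_def)
  qed
qed

lemma int_dist_add_half: "int_dist (x + 1 / 2) = 1 / 2 - int_dist x"
proof -
  obtain y where y: "\<bar>y\<bar> \<le> 1 / 2" "x - y \<in> \<int>" "int_dist x = \<bar>y\<bar>" by (rule int_dist_cases)
  have "int_dist (x + 1 / 2) = \<bar>\<bar>y\<bar> - 1 / 2\<bar>"
  proof (cases "y > 0")
    case True
    then have "x + 1 / 2 - (\<bar>y\<bar> - 1 / 2) = (x - y) + 1" by simp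
    then show ?thesis using True y by (intro int_dist_eq_abs) (auto intro: Ints_add)
  next
    case False
    then have "int_dist (x + 1 / 2) = \<bar>1 / 2 - \<bar>y\<bar>\<bar>"
      using y by (intro int_dist_eq_abs) auto
    then show ?thesis by simp
  qed
  then show ?thesis using y by auto
qed

lemma sin_chord:
  fixes p x q :: real
  assumes "0 \<le> p" "p \<le> x" "x \<le> q" "q \<le> pi"
  shows "sin p * (q - x) + sin q * (x - p) \<le> sin x * (q - p)"
proof (cases "p < x \<and> x < q")
  case True
  obtain u where u: "p < u" "u < x" "sin x - sin p = (x - p) * cos u"
    using MVT2[of p x sin cos] True by (auto intro: DERIV_sin)
  obtain v where v: "x < v" "v < q" "sin q - sin x = (q - x) * cos v"
    using MVT2[of x q sin cos] True by (auto intro: DERIV_sin)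
  have "cos v \<le> cos u" using u v assms by (intro cos_monotone_0_pi_le) auto
  then have "(q - x) * (x - p) * cos v \<le> (q - x) * (x - p) * cos u" using True by (intro mult_left_mono) auto
  then have "(sin q - sin x) * (x - p) \<le> (sin x - sin p) * (q - x)" unfolding u(3) v(3) by (simp add: mult_ac)
  then show ?thesis by (simp add: algebra_simps)
next
  case False
  then have "p = x \<or> x = q" using assms by auto
  then show ?thesis by (auto simp: algebra_simps)
qed

text \<open>
  The cosines of the units add up to a Ramanujan sum of absolute value at most \<open>1\<close>. As
  \<open>3/10 + 1/5 \<cdot> 1/6 = 1/3\<close>, the bound limits the mean of the distance to \<open>1/3\<close> as soon as there are at least
  six units. This and sharpness at \<open>x = 1/2\<close> determine the two constants. The proof uses concavity of the sine on the
  intervals between \<open>0\<close>, \<open>\<pi>/6\<close> and \<open>\<pi>/2\<close>.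
\<close>

lemma int_dist_le_cos: "int_dist x \<le> 3 / 10 - cos (2 * pi * x) / 5"
proof -
  have aux: "y \<le> 3 / 10 - cos (2 * pi * y) / 5" if y: "0 \<le> y" "y \<le> 1 / 2" for y :: real
  proof -
    consider "y \<le> 1 / 6" | "1 / 6 \<le> y" "y \<le> 1 / 4" | "1 / 4 \<le> y" by linarith
    then show ?thesis
    proof cases
      case 1
      have "sin 0 * (pi / 6 - pi * y) + sin (pi / 6) * (pi * y - 0) \<le> sin (pi * y) * (pi / 6 - 0)"
        using 1 y by (intro sin_chord) auto
      then have "pi * (3 * y) \<le> pi * sin (pi * y)" by (simp add: sin_30)
      then have "3 * y \<le> sin (pi * y)" by simp
      then have "(3 * y)\<^sup>2 \<le> (sin (pi * y))\<^sup>2" using y by (intro power_mono) auto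
      moreover have "0 \<le> 18 * (y - 5 / 36)\<^sup>2" by simp
      ultimately show ?thesis using cos_double_sin[of "pi * y"]
        by (simp add: power2_eq_square algebra_simps)
    next
      case 2
      have "sin (pi / 6) * (pi / 2 - pi * y) + sin (pi / 2) * (pi * y - pi / 6) \<le> sin (pi * y) * (pi / 2 - pi / 6)"
        using 2 y by (intro sin_chord) auto
      then have "pi * (1 / 4 + 3 / 2 * y) \<le> pi * sin (pi * y)" by (simp add: sin_30 field_simps)
      then have "1 / 4 + 3 / 2 * y \<le> sin (pi * y)" by simp
      then have "(1 / 4 + 3 / 2 * y)\<^sup>2 \<le> (sin (pi * y))\<^sup>2" using y by (intro power_mono) auto
      moreover have "(1 / 4 + 3 / 2 * y)\<^sup>2 = 1 / 16 + 3 / 4 * y + 9 / 4 * y\<^sup>2"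
        by (simp add: power2_eq_square algebra_simps)
      moreover have "0 \<le> (y - 1 / 2) * (y - 5 / 18)" using 2 by (intro mult_nonpos_nonpos) auto
      moreover have "(y - 1 / 2) * (y - 5 / 18) = y\<^sup>2 - 7 / 9 * y + 5 / 36"
        by (simp add: power2_eq_square field_simps)
      moreover have "cos (2 * pi * y) = 1 - 2 * (sin (pi * y))\<^sup>2"
        using cos_double_sin[of "pi * y"] by (simp add: mult.assoc)
      ultimately show ?thesis by linarith
    next
      case 3
      have "sin 0 * (pi / 2 - 2 * pi * (y - 1 / 4)) + sin (pi / 2) * (2 * pi * (y - 1 / 4) - 0)
          \<le> sin (2 * pi * (y - 1 / 4)) * (pi / 2 - 0)"
        using 3 y by (intro sin_chord) auto
      then have "pi * (4 * y - 1) \<le> pi * sin (2 * pi * (y - 1 / 4))" by (simp add: field_simps)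
      then have "4 * y - 1 \<le> sin (2 * pi * (y - 1 / 4))" by simp
      moreover have "cos (2 * pi * y) = - sin (2 * pi * (y - 1 / 4))"
        using sin_cos_eq[of "2 * pi * (1 / 4 - y)"] by (simp add: algebra_simps flip: sin_minus)
      ultimately show ?thesis using y by simp
    qed
  qed
  obtain y where y: "\<bar>y\<bar> \<le> 1 / 2" "x - y \<in> \<int>" "int_dist x = \<bar>y\<bar>" by (rule int_dist_cases)
  obtain k where "x - y = of_int k" using y(2) by (auto elim: Ints_cases)
  then have "2 * pi * x = 2 * pi * y + of_int k * (2 * pi)" by (simp add: algebra_simps)
  then have "cos (2 * pi * x) = cos (2 * pi * y)"
    using cos_integer_2pi[of "of_int k"] sin_integer_2pi[of "of_int k"] by (simp add: cos_add mult_ac)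
  moreover have "cos (2 * pi * y) = cos (2 * pi * \<bar>y\<bar>)" by (simp add: abs_if)
  ultimately show ?thesis using aux[of "\<bar>y\<bar>"] y by simp
qed


text \<open>
  For odd \<open>d\<close> the sum is invariant under doubling, and \<open>int_dist (2 x) \<le> 1 - 2 * int_dist x\<close> gives a mean
  of at most \<open>1/3\<close>; for \<open>d = 3\<close> it is attained. For even \<open>d\<close> doubling is not available, but the cosine bound
  suffices: the Ramanujan sum vanishes if \<open>4\<close> divides \<open>d\<close> and is \<open>1\<close> for \<open>d = 6\<close> and \<open>d = 10\<close>, and
  for \<open>d = 2m\<close> with \<open>m \<ge> 7\<close> odd there are six explicit units.
\<close>

lemma sum_int_dist_units_mod_le:
  assumes "d > 0" "d \<noteq> 2"
  shows "(\<Sum>t\<in>units_mod d. int_dist (real t / real d)) \<le> real (card (units_mod d)) / 3"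
proof (cases "even d")
  case False
  have per: "int_dist (2 * (real (t mod d) / real d)) = int_dist (2 * (real t / real d))"
       "int_dist (real (t mod d) / real d) = int_dist (real t / real d)" for t
  proof -
    have "real t = real (d * (t div d) + t mod d)" by simp
    then have *: "real t = real d * real (t div d) + real (t mod d)" by (simp only: of_nat_add of_nat_mult)
    have 1: "real (t mod d) / real d - real t / real d = of_int (- int (t div d))"
      using assms(1) * by (simp add: field_simps)
    then show "int_dist (real (t mod d) / real d) = int_dist (real t / real d)"
      by (intro int_dist_cong) (simp only: Ints_of_int)
    have "2 * (real (t mod d) / real d) - 2 * (real t / real d) = of_int (2 * (- int (t div d)))"
      unfolding of_int_mult 1[symmetric] by simp
    then show "int_dist (2 * (real (t mod d) / real d)) = int_dist (2 * (real t / real d))"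
      by (intro int_dist_cong) (simp only: Ints_of_int)
  qed
  have "coprime 2 d" using False by simp
  then have "(\<Sum>t\<in>units_mod d. int_dist (real (2 * t) / real d)) = (\<Sum>t\<in>units_mod d. int_dist (real t / real d))"
    using assms(1) per(2) by (rule sum_units_mod_mult)
  then have "(\<Sum>t\<in>units_mod d. int_dist (real t / real d)) = (\<Sum>t\<in>units_mod d. int_dist (real (2 * t) / real d))"
    by simp
  also have "\<dots>
     \<le> (\<Sum>t\<in>units_mod d. 1 - 2 * int_dist (real t / real d))"
    using int_dist_double_le[of "real t / real d" for t] by (intro sum_mono) simp
  finally show ?thesis by (simp add: sum_subtractf flip: sum_distrib_left)
next
  case True
  then obtain m where m: "d = 2 * m" by (elim evenE)
  have m0: "m > 1" using m assms by auto
  have "(\<Sum>t\<in>units_mod d. cos (2 * pi * (real t / real d))) = Re (ramanujan_sum d 1)"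
  proof -
    have "e2pi (of_nat t / of_nat d) = cis (2 * pi * (real t / real d))" for t
      using e2pi_of_real[of "real t / real d"] by simp
    then show ?thesis by (simp add: ramanujan_sum_def)
  qed
  moreover have "- Re (ramanujan_sum d 1) \<le> real (card (units_mod d)) / 6"
  proof -
    have r: "ramanujan_sum d 1 = - (if even m then 0 else ramanujan_sum m 1)"
      using ramanujan_sum_prime_mult[of 2 m 1] m0 by (simp add: m)
    consider "even m" | "m = 3" | "m = 5" | "odd m" "m \<ge> 7"
    proof -
      have "m = 3 \<or> m = 5 \<or> m \<ge> 7" if odd: "odd m"
      proof -
        obtain j where j: "m = 2 * j + 1" using odd by (rule oddE)
        then have "j = 1 \<or> j = 2 \<or> j \<ge> 3" using m0 by linarith
        then show ?thesis unfolding j by auto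
      qed
      then show thesis using that by blast
    qed
    then show ?thesis
    proof cases
      case 4
      define k where "k = m - 7"
      have k: "m = k + 7" using 4(2) by (simp add: k_def)
      define L where "L = [1, k + 3, k + 5, k + 9, k + 11, 2 * k + 13]"
      have "coprime 2 m" using 4(1) by simp
      then have "coprime (2 * 2) m" by (simp only: coprime_mult_left_iff)
      with \<open>coprime 2 m\<close> have c: "gcd 2 m = 1" "gcd 4 m = 1" by (simp_all only: coprime_imp_gcd_eq_1) simp
      have e: "k + 9 = 2 + m" "k + 11 = 4 + m" "k + 5 = m - 2" "k + 3 = m - 4" "2 * k + 13 = 2 * m - 1"
        using k by simp_all
      have le: "2 \<le> m" "4 \<le> m" "1 \<le> 2 * m" using 4(2) by linarith+
      note g = le[THEN gcd_diff2_nat]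
      have "coprime (k + 9) m" "coprime (k + 11) m" "coprime (k + 5) m" "coprime (k + 3) m"
        unfolding e coprime_iff_gcd_eq_1 g gcd_add1 c by simp_all
      moreover have "coprime (2 * k + 13) (2 * m)"
        unfolding e coprime_iff_gcd_eq_1 g by simp
      then have "coprime (2 * k + 13) m" by simp
      ultimately have cop: "coprime (k + 9) m" "coprime (k + 11) m" "coprime (k + 5) m" "coprime (k + 3) m"
        "coprime (2 * k + 13) m" by blast+
      have "coprime x m" "odd x" "x < d" if "x \<in> set L" for x
      proof -
        have *: "x = 1 \<or> x = k + 3 \<or> x = k + 5 \<or> x = k + 9 \<or> x = k + 11 \<or> x = 2 * k + 13"
          using that by (simp add: L_def)
        then consider "x = 1" | "x = k + 3" | "x = k + 5" | "x = k + 9" | "x = k + 11" | "x = 2 * k + 13"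
          by blast
        then show "coprime x m" using cop coprime_1_left by cases blast+
        have "even k" using 4(1) k by presburger
        from * show "odd x" using \<open>even k\<close> by (elim disjE) simp_all
        from * show "x < d" unfolding m k by (elim disjE) simp_all
      qed
      then have "set L \<subseteq> units_mod d" by (auto simp: units_mod_def m)
      then have "card (set L) \<le> card (units_mod d)" by (intro card_mono) simp_all
      moreover have "card (set L) = 6"
        using distinct_card[of L] by (simp add: L_def)
      ultimately have "6 \<le> real (card (units_mod d))" by linarith
      moreover have "- Re (ramanujan_sum d 1) \<le> 1"
        using ramanujan_sum_at_1[of d] assms(1) by auto
      ultimately show ?thesis by linarith
    qed (use ramanujan_sum_prime[of 3] ramanujan_sum_prime[of 5] in \<open>auto simp: r\<close>)
  qed
  moreover have "(\<Sum>t\<in>units_mod d. int_dist (real t / real d))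
      \<le> (\<Sum>t\<in>units_mod d. 3 / 10 - cos (2 * pi * (real t / real d)) / 5)"
    by (intro sum_mono int_dist_le_cos)
  ultimately show ?thesis by (simp add: sum_subtractf flip: sum_divide_distrib)
qed

text \<open>
  Reduced to lowest terms, \<open>z = k / d\<close>. Equidistribution passes from the units modulo \<open>N\<close> to those
  modulo \<open>d\<close>, and \<open>k\<close> is absorbed because it is a unit itself. The excluded case \<open>d = 2\<close> is \<open>z \<equiv> 1/2\<close>, where
  the mean is \<open>1/2\<close>.
\<close>

lemma sum_int_dist_multiples_le:
  assumes "N > 0" "real N * z \<in> \<int>" "z - 1 / 2 \<notin> \<int>"
  shows "(\<Sum>t\<in>units_mod N. int_dist (real t * z)) \<le> real (card (units_mod N)) / 3"
proof -
  obtain A where A: "real N * z = of_int A" using assms(2) by (rule Ints_cases)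
  define k where "k = nat (A mod int N)"
  have kA: "int k = A mod int N" using assms(1) by (simp add: k_def)
  define g where "g = gcd k N"
  have g0: "g > 0" using assms(1) by (simp add: g_def)
  obtain k' d where kd: "k = k' * g" "N = d * g" "coprime k' d"
    using gcd_coprime_exists[of k N] assms(1) unfolding g_def by auto
  have d0: "d > 0" using kd(2) assms(1) by (auto intro: Nat.gr0I)
  have z1: "z - real k' / real d \<in> \<int>"
  proof -
    have "A = int N * (A div int N) + int k" unfolding kA by simp
    then have "real_of_int A = real N * of_int (A div int N) + real k"
      by (metis of_int_add of_int_mult of_int_of_nat_eq)
    then have "real N * z = real N * of_int (A div int N) + real k" using A by simp
    moreover have "real k = real N * (real k' / real d)"
      using kd d0 by (simp add: field_simps)
    ultimately have "real N * (z - real k' / real d) = real N * of_int (A div int N)"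
      by (simp add: algebra_simps)
    then have "z - real k' / real d = of_int (A div int N)" using assms(1) by simp
    then show ?thesis by (simp only: Ints_of_int)
  qed
  have d2: "d \<noteq> 2"
  proof
    assume d: "d = 2"
    then have "odd k'" using kd(3) by simp
    then obtain j where j: "k' = 2 * j + 1" by (rule oddE)
    have "z - 1 / 2 = (z - real k' / real d) + of_int (int j)"
      unfolding d j by (simp add: add_divide_distrib)
    then have "z - 1 / 2 \<in> \<int>" using z1 by (metis Ints_add Ints_of_int)
    then show False using assms(3) by simp
  qed
  define f where "f t = int_dist (real t * z)" for t :: nat
  define h where "h t = int_dist (real t / real d)" for t :: nat
  have per: "h t = h s" if "[t = s] (mod d)" for t s
  proof -
    have "[int t = int s] (mod int d)" using that by (simp add: cong_int_iff)
    then obtain j where j: "int t - int s = int d * j" by (auto simp: cong_iff_dvd_diff)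
    have "real t - real s = real_of_int (int t - int s)" by simp
    also have "\<dots> = real d * of_int j" unfolding j by simp
    finally have "real t / real d - real s / real d = of_int j" using d0 by (simp add: field_simps)
    then show ?thesis unfolding h_def by (intro int_dist_cong) (simp only: Ints_of_int)
  qed
  have fh: "f t = h (k' * t)" for t
  proof -
    have "real t * z - real (k' * t) / real d = real t * (z - real k' / real d)" by (simp add: algebra_simps)
    also have "\<dots> \<in> \<int>" using z1 by (intro Ints_mult) auto
    finally show ?thesis unfolding f_def h_def by (rule int_dist_cong)
  qed
  have "f (t mod d) = f t" for t
    unfolding fh by (intro per cong_mult) (simp_all add: cong_def)
  then have eq: "real (card (units_mod d)) * (\<Sum>t\<in>units_mod N. f t)
       = real (card (units_mod N)) * (\<Sum>t\<in>units_mod d. f t)"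
    using assms(1) kd(2) by (intro sum_units_mod_equidistributed) auto
  have "(\<Sum>t\<in>units_mod d. f t) = (\<Sum>t\<in>units_mod d. h t)"
    unfolding fh using kd(3) d0 by (intro sum_units_mod_mult per) (simp_all add: cong_def)
  also have "\<dots> \<le> real (card (units_mod d)) / 3"
    unfolding h_def by (rule sum_int_dist_units_mod_le[OF d0 d2])
  finally have "real (card (units_mod N)) * (\<Sum>t\<in>units_mod d. f t)
      \<le> real (card (units_mod N)) * (real (card (units_mod d)) / 3)"
    by (rule mult_left_mono) simp
  then have "real (card (units_mod d)) * (\<Sum>t\<in>units_mod N. f t)
     \<le> real (card (units_mod d)) * (real (card (units_mod N)) / 3)"
    unfolding eq by (simp add: mult.commute)
  then show ?thesis using card_units_mod_pos[OF d0] by (simp add: f_def)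
qed

theorem exists_unit_int_dist_sum_le:
  assumes "N > 0"
    and "\<And>z. z \<in> {z1, z2, z3} \<Longrightarrow> real N * z \<in> \<int>"
    and "\<And>z. z \<in> {z1, z2, z3} \<Longrightarrow> z - 1 / 2 \<notin> \<int>"
  shows "\<exists>t. coprime t N \<and> int_dist (real t * z1) + int_dist (real t * z2) + int_dist (real t * z3) \<le> 1"
proof (rule ccontr)
  assume "\<not> ?thesis"
  then have *: "int_dist (real t * z1) + int_dist (real t * z2) + int_dist (real t * z3) > 1" if "coprime t N" for t
    using that by force
  have "real (card (units_mod N)) = (\<Sum>t\<in>units_mod N. 1)" by simp
  also have "\<dots> < (\<Sum>t\<in>units_mod N. int_dist (real t * z1) + int_dist (real t * z2) + int_dist (real t * z3))"
    using * card_gt_0_iff[THEN iffD1, OF card_units_mod_pos[OF assms(1)]]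
    by (intro sum_strict_mono) (auto simp: units_mod_def)
  also have "\<dots> = (\<Sum>t\<in>units_mod N. int_dist (real t * z1)) + (\<Sum>t\<in>units_mod N. int_dist (real t * z2))
     + (\<Sum>t\<in>units_mod N. int_dist (real t * z3))" by (simp add: sum.distrib)
  also have "\<dots> \<le> real (card (units_mod N)) / 3 + real (card (units_mod N)) / 3 + real (card (units_mod N)) / 3"
    using assms by (intro add_mono sum_int_dist_multiples_le) auto
  finally show False by simp
qed

section \<open>The sign condition and the exponents congruent to one half\<close>

definition sin_prod :: "real \<Rightarrow> real \<Rightarrow> real \<Rightarrow> real" where
  "sin_prod a b s = sin (pi * (s - a)) * sin (pi * (s - b))"

text \<open>
  As a function on the circle, \<open>sin_prod a b\<close> is positive on one of the two arcs cut out by \<open>a\<close> and \<open>b\<close> and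
  negative on the other. The condition says that the partial sums of \<open>c\<close> lie in the arc of \<open>0\<close> or in the
  other one according to the parity of the number of summands.
\<close>

definition alternating :: "nat \<Rightarrow> real \<Rightarrow> real \<Rightarrow> (nat \<Rightarrow> real) \<Rightarrow> bool" where
  "alternating n a b c \<longleftrightarrow> (\<forall>S\<subseteq>{1..n}. (-1) ^ card S * sin_prod a b (sum c S) * sin_prod a b 0 > 0)"

lemma sin_prod_eq: "sin_prod a b s = (cos (pi * (b - a)) - cos (pi * (2 * s - a - b))) / 2"
proof -
  have "pi * (s - a) - pi * (s - b) = pi * (b - a)" "pi * (s - a) + pi * (s - b) = pi * (2 * s - a - b)"
    by (simp_all add: algebra_simps)
  then show ?thesis unfolding sin_prod_def sin_times_sin by simp
qed

lemma cos_pi_add_of_int: "cos (pi * (x + of_int k)) = (if even k then 1 else - 1) * cos (pi * x)"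
proof (cases "even k")
  case True
  then obtain j where "k = 2 * j" by (rule evenE)
  then have "pi * (x + of_int k) = pi * x + 2 * pi * of_int j" by (simp add: algebra_simps)
  then show ?thesis using True cos_integer_2pi[of "of_int j"] sin_integer_2pi[of "of_int j"] by (simp add: cos_add)
next
  case False
  then obtain j where "k = 2 * j + 1" by (rule oddE)
  then have "pi * (x + of_int k) = pi * x + 2 * pi * of_int j + pi" by (simp add: algebra_simps)
  then show ?thesis using False cos_integer_2pi[of "of_int j"] sin_integer_2pi[of "of_int j"] by (simp add: cos_add)
qed

lemma sin_pi_add_of_int: "sin (pi * (x + of_int k)) = (if even k then 1 else - 1) * sin (pi * x)"
proof -
  have s: "sin (pi * y) = - cos (pi * (y + 1 / 2))" for y by (simp add: distrib_left cos_add)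
  show ?thesis using cos_pi_add_of_int[of "x + 1 / 2" k] unfolding s by (simp add: algebra_simps)
qed

lemma sin_prod_add_Ints:
  assumes "m \<in> \<int>" shows "sin_prod a b (s + m) = sin_prod a b s"
proof -
  obtain k where m: "m = of_int k" using assms by (rule Ints_cases)
  have "s + m - a = (s - a) + of_int k" "s + m - b = (s - b) + of_int k" using m by auto
  then show ?thesis unfolding sin_prod_def by (simp only: sin_pi_add_of_int) auto
qed

lemma sin_prod_cong: "s - s' \<in> \<int> \<Longrightarrow> sin_prod a b s = sin_prod a b s'"
  using sin_prod_add_Ints[of "s - s'" a b s'] by simp

lemma lt_half_if_cos_pi_pos:
  assumes "cos (pi * x) > 0" "0 \<le> x" "x \<le> 3 / 2"
  shows "x < 1 / 2"
proof (rule ccontr)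
  assume "\<not> x < 1 / 2"
  then have "pi * (-1 / 2) \<le> pi * (x - 1)" "pi * (x - 1) \<le> pi * (1 / 2)"
    using assms by (intro mult_left_mono; simp)+
  then have "cos (pi * (x - 1)) \<ge> 0" by (intro cos_ge_zero) simp_all
  then show False using assms(1) cos_pi_add_of_int[of x "- 1"] by simp
qed

lemma cos_pi_nonneg: "\<bar>y\<bar> \<le> 1 / 2 \<Longrightarrow> cos (pi * y) \<ge> 0"
proof -
  assume "\<bar>y\<bar> \<le> 1 / 2"
  then have "pi * (-1 / 2) \<le> pi * y" "pi * y \<le> pi * (1 / 2)"
    by (intro mult_left_mono; simp)+
  then show ?thesis by (intro cos_ge_zero) simp_all
qed

lemma cos_pi_sum_diff: "cos (pi * (x + y)) + cos (pi * (x - y)) = 2 * (cos (pi * x) * cos (pi * y))"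
  by (simp add: distrib_left right_diff_distrib cos_add cos_diff)

lemma cos_pi_pair_pos:
  assumes "cos (pi * X) + t > 0" "cos (pi * X') + t' > 0" "X = P + Q" "X' = P - Q \<or> X' = - (P - Q)"
  shows "2 * (cos (pi * P) * cos (pi * Q)) + (t + t') > 0"
proof -
  have "cos (pi * X') = cos (pi * (P - Q))"
    using assms(4) by (metis cos_minus mult_minus_right)
  then show ?thesis using assms(1-3) cos_pi_sum_diff[of P Q] by simp
qed

lemma cos_pi_sign_mult: "s = 1 \<or> s = -1 \<Longrightarrow> cos (pi * (s * x)) = cos (pi * x)"
  by auto

lemma sign_times_abs: obtains s :: real where "s = 1 \<or> s = -1" "s * y = \<bar>y\<bar>"
  by (cases "y \<ge> 0") (auto intro: that[of 1] that[of "-1"])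

text \<open>
  The hypothesis is the sign condition on a three-dimensional face, written in the deviations \<open>y\<^sub>1, y\<^sub>2, y\<^sub>3\<close>,
  \<open>y\<^sub>4\<close>, \<open>y\<^sub>5\<close> of \<open>c\<^sub>p, c\<^sub>q, c\<^sub>r\<close>, \<open>b - a\<close>, \<open>c\<^sub>p + c\<^sub>q + c\<^sub>r - a - b\<close> from \<open>1/2\<close>. Adding two instances in
  which one or two deviations have opposite signs factors these out as nonnegative cosines. What is
  left says that the cosine of the sum of three absolute values is positive, which bounds this sum.
  The instances can be chosen such that any three of the five deviations survive.
\<close>

lemma spinor_inequalities:
  fixes y1 y2 y3 y4 y5 \<eta> :: real
  assumes y: "\<bar>y1\<bar> \<le> 1 / 2" "\<bar>y2\<bar> \<le> 1 / 2" "\<bar>y3\<bar> \<le> 1 / 2" "\<bar>y4\<bar> \<le> 1 / 2" "\<bar>y5\<bar> \<le> 1 / 2"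
    and H: "\<And>u v w. u = 1 \<or> u = -1 \<Longrightarrow> v = 1 \<or> v = -1 \<Longrightarrow> w = 1 \<or> w = -1 \<Longrightarrow>
       \<eta> * (cos (pi * (y5 + (u * y1 + v * y2 + w * y3))) + u * v * w * sin (pi * y4)) > 0"
  shows "\<bar>y1\<bar> + \<bar>y2\<bar> + \<bar>y3\<bar> < 1 / 2" (is ?A)
    and "\<bar>y1\<bar> + \<bar>y2\<bar> + \<bar>y5\<bar> < 1 / 2" (is ?B)
    and "\<bar>y1\<bar> + \<bar>y2\<bar> + \<bar>y4\<bar> < 1 / 2" (is ?C)
    and "\<bar>y1\<bar> + \<bar>y5\<bar> + \<bar>y4\<bar> < 1 / 2" (is ?D)
proof -
  have pos3: "\<eta> * cos (pi * (u * y1 + v * y2 + w * y3)) > 0"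
    if u: "u = 1 \<or> u = -1" and v: "v = 1 \<or> v = -1" and w: "w = 1 \<or> w = -1" for u v w
  proof -
    let ?X = "u * y1 + v * y2 + w * y3"
    define p where "p = u * v * w"
    have uvw: "- u = 1 \<or> - u = -1" "- v = 1 \<or> - v = -1" "- w = 1 \<or> - w = -1" using u v w by auto
    have 1: "\<eta> * (cos (pi * (y5 + ?X)) + p * sin (pi * y4)) > 0" using H[OF u v w] by (simp add: p_def)
    have 2: "y5 + (- u * y1 + - v * y2 + - w * y3) = y5 - ?X" "(- u) * (- v) * (- w) = - p"
      by (simp_all add: p_def)
    have "\<eta> * (cos (pi * (y5 - ?X)) - p * sin (pi * y4)) > 0"
      using H[OF uvw, unfolded 2] by simp
    with 1 have "0 < \<eta> * (cos (pi * (y5 + ?X)) + p * sin (pi * y4)) + \<eta> * (cos (pi * (y5 - ?X)) - p * sin (pi * y4))"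
      by (rule add_pos_pos)
    also have "\<dots> = \<eta> * (cos (pi * (y5 + ?X)) + cos (pi * (y5 - ?X)))"
      unfolding distrib_left right_diff_distrib by simp
    also have "\<dots> = 2 * (cos (pi * y5) * (\<eta> * cos (pi * ?X)))"
      unfolding cos_pi_sum_diff by (simp add: mult.left_commute)
    finally have "0 < cos (pi * y5) * (\<eta> * cos (pi * ?X))" by linarith
    then show ?thesis using cos_pi_nonneg[OF y(5)] by (auto simp only: zero_less_mult_iff)
  qed
  have pair: "0 < \<eta> * cos (pi * (u * y1 + v * y2))" if u: "u = 1 \<or> u = -1" and v: "v = 1 \<or> v = -1" for u v
  proof -
    have "0 < \<eta> * cos (pi * ((u * y1 + v * y2) + y3)) + \<eta> * cos (pi * ((u * y1 + v * y2) - y3))"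
      using pos3[OF u v, of 1] pos3[OF u v, of "-1"] by (intro add_pos_pos) auto
    also have "\<dots> = \<eta> * (2 * (cos (pi * (u * y1 + v * y2)) * cos (pi * y3)))"
      unfolding cos_pi_sum_diff[symmetric] by (simp add: algebra_simps)
    finally have "0 < cos (pi * y3) * (\<eta> * cos (pi * (u * y1 + v * y2)))" by (simp add: mult_ac)
    then show ?thesis using cos_pi_nonneg[OF y(3)] by (auto simp only: zero_less_mult_iff)
  qed
  \<comment> \<open>all \<open>\<eta> cos(\<pi>(\<plusminus>y\<^sub>1 \<plusminus> y\<^sub>2))\<close> are positive, but the two cosines add up to a nonnegative number\<close>
  have eta: "\<eta> > 0"
  proof -
    have "0 < \<eta> * cos (pi * (y1 + y2)) + \<eta> * cos (pi * (y1 - y2))"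
      using pair[of 1 1] pair[of 1 "-1"] by (intro add_pos_pos) auto
    also have "\<dots> = \<eta> * (2 * (cos (pi * y1) * cos (pi * y2)))"
      unfolding cos_pi_sum_diff[symmetric] by (simp add: algebra_simps)
    finally have "0 < (cos (pi * y1) * cos (pi * y2)) * \<eta>" by (simp add: mult_ac)
    then show ?thesis using mult_nonneg_nonneg[OF cos_pi_nonneg[OF y(1)] cos_pi_nonneg[OF y(2)]]
      by (auto simp only: zero_less_mult_iff)
  qed
  have H': "cos (pi * (y5 + (u * y1 + v * y2 + w * y3))) + u * v * w * sin (pi * y4) > 0"
    if "u = 1 \<or> u = -1" "v = 1 \<or> v = -1" "w = 1 \<or> w = -1" for u v w
    using H[OF that] eta by (simp add: zero_less_mult_iff)
  obtain s1 where s1: "s1 = 1 \<or> s1 = -1" "s1 * y1 = \<bar>y1\<bar>" by (rule sign_times_abs)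
  obtain s2 where s2: "s2 = 1 \<or> s2 = -1" "s2 * y2 = \<bar>y2\<bar>" by (rule sign_times_abs)
  obtain s3 where s3: "s3 = 1 \<or> s3 = -1" "s3 * y3 = \<bar>y3\<bar>" by (rule sign_times_abs)
  obtain s4 where s4: "s4 = 1 \<or> s4 = -1" "s4 * y4 = \<bar>y4\<bar>" by (rule sign_times_abs)
  obtain s5 where s5: "s5 = 1 \<or> s5 = -1" "s5 * y5 = \<bar>y5\<bar>" by (rule sign_times_abs)
  have sin4: "sin (pi * y4) = s4 * sin (pi * \<bar>y4\<bar>)"
    unfolding s4(2)[symmetric] using s4(1) by auto
  show ?A
  proof (rule lt_half_if_cos_pi_pos)
    show "0 < cos (pi * (\<bar>y1\<bar> + \<bar>y2\<bar> + \<bar>y3\<bar>))"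
      using pos3[OF s1(1) s2(1) s3(1)] eta unfolding s1(2) s2(2) s3(2) by (simp add: zero_less_mult_iff)
  qed (use y in auto)
  show B: ?B
  proof (rule lt_half_if_cos_pi_pos)
    let ?u = "s5 * s1" and ?v = "s5 * s2"
    have uv: "?u = 1 \<or> ?u = -1" "?v = 1 \<or> ?v = -1" using s1 s2 s5 by auto
    have "0 < 2 * (cos (pi * (y5 + (?u * y1 + ?v * y2))) * cos (pi * y3))
        + (?u * ?v * 1 * sin (pi * y4) + ?u * ?v * (-1) * sin (pi * y4))"
      by (rule cos_pi_pair_pos[OF H'[OF uv, of 1] H'[OF uv, of "-1"]]) simp_all
    also have "y5 + (?u * y1 + ?v * y2) = s5 * (\<bar>y1\<bar> + \<bar>y2\<bar> + \<bar>y5\<bar>)"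
      unfolding s5(2)[symmetric] s1(2)[symmetric] s2(2)[symmetric] using s5(1) by auto
    finally have "0 < cos (pi * (\<bar>y1\<bar> + \<bar>y2\<bar> + \<bar>y5\<bar>)) * cos (pi * y3)"
      unfolding cos_pi_sign_mult[OF s5(1)] by (simp add: mult.commute)
    then show "0 < cos (pi * (\<bar>y1\<bar> + \<bar>y2\<bar> + \<bar>y5\<bar>))"
      using cos_pi_nonneg[OF y(3)] by (auto simp only: zero_less_mult_iff)
  qed (use y in auto)
  have key: "B + \<bar>y4\<bar> < 1 / 2" if B: "0 \<le> B" "B < 1 / 2" and cc: "cos (pi * B) * c > sin (pi * \<bar>y4\<bar>)" "c \<le> 1" for B c
  proof -
    have "sin (pi * \<bar>y4\<bar>) < cos (pi * B)"
      using cc mult_left_mono[OF cc(2), of "cos (pi * B)"] cos_pi_nonneg[of B] B by simp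
    also have "cos (pi * B) = sin (pi * (1 / 2 - B))" by (simp add: cos_sin_eq right_diff_distrib)
    finally have lt: "sin (pi * \<bar>y4\<bar>) < sin (pi * (1 / 2 - B))" .
    have "\<bar>y4\<bar> < 1 / 2 - B"
    proof (rule ccontr)
      assume "\<not> \<bar>y4\<bar> < 1 / 2 - B"
      then have "pi * (1 / 2 - B) \<le> pi * \<bar>y4\<bar>" "pi * \<bar>y4\<bar> \<le> pi * (1 / 2)" "pi * (- 1 / 2) \<le> pi * (1 / 2 - B)"
        using y(4) B by (intro mult_left_mono; simp)+
      then have "sin (pi * (1 / 2 - B)) \<le> sin (pi * \<bar>y4\<bar>)" by (intro sin_monotone_2pi_le) simp_all
      then show False using lt by simp
    qed
    then show ?thesis by simp
  qed
  show ?C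
  proof (rule key)
    let ?w = "- (s4 * s1 * s2)"
    have w: "?w = 1 \<or> ?w = -1" using s1 s2 s4 by auto
    have sg: "s1 * s2 * ?w * sin (pi * y4) = - sin (pi * \<bar>y4\<bar>)" unfolding sin4 using s1 s2 s4 by auto
    have m: "- s1 = 1 \<or> - s1 = -1" "- s2 = 1 \<or> - s2 = -1" using s1 s2 by auto
    have "0 < 2 * (cos (pi * (y5 + ?w * y3)) * cos (pi * (s1 * y1 + s2 * y2)))
        + (s1 * s2 * ?w * sin (pi * y4) + (- s1) * (- s2) * ?w * sin (pi * y4))"
      by (rule cos_pi_pair_pos[OF H'[OF s1(1) s2(1) w] H'[OF m w]]) simp_all
    then have "0 < 2 * (cos (pi * (y5 + ?w * y3)) * cos (pi * (s1 * y1 + s2 * y2)))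
        + (s1 * s2 * ?w * sin (pi * y4) + s1 * s2 * ?w * sin (pi * y4))" by simp
    then show "sin (pi * \<bar>y4\<bar>) < cos (pi * (\<bar>y1\<bar> + \<bar>y2\<bar>)) * cos (pi * (y5 + ?w * y3))"
      unfolding sg s1(2) s2(2) by (simp add: mult.commute)
  qed (use B in auto)
  have "\<bar>y1\<bar> + \<bar>y5\<bar> + \<bar>y4\<bar> < 1 / 2"
  proof (rule key)
    let ?u = "s5 * s1" and ?v = "- (s4 * s5 * s1)"
    have uv: "?u = 1 \<or> ?u = -1" "?v = 1 \<or> ?v = -1" using s1 s4 s5 by auto
    have sg: "?u * ?v * 1 * sin (pi * y4) = - sin (pi * \<bar>y4\<bar>)" unfolding sin4 using s1 s4 s5 by auto
    have m: "- ?v = 1 \<or> - ?v = -1" using uv by auto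
    have e: "y5 + ?u * y1 = s5 * (\<bar>y1\<bar> + \<bar>y5\<bar>)"
      unfolding s5(2)[symmetric] s1(2)[symmetric] using s5(1) by auto
    have "0 < 2 * (cos (pi * (y5 + ?u * y1)) * cos (pi * (?v * y2 + y3)))
        + (?u * ?v * 1 * sin (pi * y4) + ?u * (- ?v) * (-1) * sin (pi * y4))"
      by (rule cos_pi_pair_pos[OF H'[OF uv, of 1] H'[OF uv(1) m, of "-1"]]) simp_all
    then have "0 < 2 * (cos (pi * (y5 + ?u * y1)) * cos (pi * (?v * y2 + y3)))
        + (?u * ?v * 1 * sin (pi * y4) + ?u * ?v * 1 * sin (pi * y4))" by simp
    then show "sin (pi * \<bar>y4\<bar>) < cos (pi * (\<bar>y1\<bar> + \<bar>y5\<bar>)) * cos (pi * (?v * y2 + y3))"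
      unfolding sg e cos_pi_sign_mult[OF s5(1)] by simp
  qed (use B in auto)
  then show ?D .
qed

definition half_mod_1 :: "real \<Rightarrow> bool" where
  "half_mod_1 x \<longleftrightarrow> x - 1 / 2 \<in> \<int>"

lemma alternating_face:
  assumes alt: "alternating n a b c" and pqr: "{p, q, r} \<subseteq> {1..n}" "p \<noteq> q" "p \<noteq> r" "q \<noteq> r"
    and u: "u = 1 \<or> u = -1" and v: "v = 1 \<or> v = -1" and w: "w = 1 \<or> w = -1"
  shows "- (u * v * w) * sin_prod a b ((1 + u) / 2 * c p + (1 + v) / 2 * c q + (1 + w) / 2 * c r) * sin_prod a b 0 > 0"
proof -
  have A: "(-1) ^ card S * sin_prod a b (sum c S) * sin_prod a b 0 > 0" if "S \<subseteq> {p, q, r}" for S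
    using alt that pqr(1) unfolding alternating_def by blast
  show ?thesis
    using u v w A[of "{}"] A[of "{p}"] A[of "{q}"] A[of "{r}"] A[of "{p, q}"] A[of "{p, r}"] A[of "{q, r}"]
      A[of "{p, q, r}"] pqr(2-4)
    by (elim disjE) (simp_all add: add.assoc)
qed

text \<open>
  Each of the five numbers is \<open>1/2 + y + k\<close> with an integer \<open>k\<close> and \<open>|y| \<le> 1/2\<close>; its distance to the nearest
  integer is \<open>1/2 - |y|\<close>. The integers change the sine products on the face by signs that are the same at all
  vertices, apart from the sign of \<open>sin \<pi>y\<^sub>4\<close>; this is why \<open>y\<^sub>4\<close> is replaced by \<open>\<plusminus>y\<^sub>4\<close>.
\<close>

lemma alternating_triple:
  assumes alt: "alternating n a b c" and pqr: "{p, q, r} \<subseteq> {1..n}" "p \<noteq> q" "p \<noteq> r" "q \<noteq> r"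
  defines "E \<equiv> c p + c q + c r - a - b"
  shows "int_dist (c p) + int_dist (c q) + int_dist (c r) > 1"
    and "int_dist (c p) + int_dist (c q) + int_dist E > 1"
    and "int_dist (c p) + int_dist (c q) + int_dist (b - a) > 1"
    and "int_dist (c p) + int_dist E + int_dist (b - a) > 1"
proof -
  have dec: "\<exists>y k. \<bar>y\<bar> \<le> 1 / 2 \<and> x = 1 / 2 + y + of_int k \<and> int_dist x = 1 / 2 - \<bar>y\<bar>" for x
  proof -
    obtain y where y: "\<bar>y\<bar> \<le> 1 / 2" "(x - 1 / 2) - y \<in> \<int>" "int_dist (x - 1 / 2) = \<bar>y\<bar>"
      by (rule int_dist_cases)
    obtain k where "(x - 1 / 2) - y = of_int k" using y(2) by (rule Ints_cases)
    moreover have "int_dist x = 1 / 2 - \<bar>y\<bar>" using int_dist_add_half[of "x - 1 / 2"] y(3) by simp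
    ultimately show ?thesis using y(1) by (intro exI[of _ y] exI[of _ k]) auto
  qed
  obtain y1 k1 where y1: "\<bar>y1\<bar> \<le> 1 / 2" "c p = 1 / 2 + y1 + of_int k1" "int_dist (c p) = 1 / 2 - \<bar>y1\<bar>"
    using dec by blast
  obtain y2 k2 where y2: "\<bar>y2\<bar> \<le> 1 / 2" "c q = 1 / 2 + y2 + of_int k2" "int_dist (c q) = 1 / 2 - \<bar>y2\<bar>"
    using dec by blast
  obtain y3 k3 where y3: "\<bar>y3\<bar> \<le> 1 / 2" "c r = 1 / 2 + y3 + of_int k3" "int_dist (c r) = 1 / 2 - \<bar>y3\<bar>"
    using dec by blast
  obtain y4 k4 where y4: "\<bar>y4\<bar> \<le> 1 / 2" "b - a = 1 / 2 + y4 + of_int k4" "int_dist (b - a) = 1 / 2 - \<bar>y4\<bar>"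
    using dec by blast
  obtain y5 k5 where y5: "\<bar>y5\<bar> \<le> 1 / 2" "E = 1 / 2 + y5 + of_int k5" "int_dist E = 1 / 2 - \<bar>y5\<bar>"
    using dec by blast
  define K where "K = k5 + k1 + k2 + k3"
  define \<kappa> where "\<kappa> = (if even K then 1 else -1 :: real)"
  define \<mu> where "\<mu> = (if even k4 then 1 else -1 :: real)"
  define z4 where "z4 = \<kappa> * \<mu> * y4"
  have kl: "\<kappa> = 1 \<or> \<kappa> = -1" "\<mu> = 1 \<or> \<mu> = -1" by (simp_all add: \<kappa>_def \<mu>_def)
  have "cos (pi * (b - a)) = cos (pi * ((1 / 2 + y4) + of_int k4))" by (simp only: y4(2))
  also have "\<dots> = \<mu> * cos (pi * (1 / 2 + y4))" by (simp only: cos_pi_add_of_int \<mu>_def)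
  also have "cos (pi * (1 / 2 + y4)) = - sin (pi * y4)" by (simp add: distrib_left cos_add)
  finally have D: "cos (pi * (b - a)) = - (\<mu> * sin (pi * y4))" by simp
  have z4: "\<mu> * sin (pi * y4) = \<kappa> * sin (pi * z4)"
    unfolding z4_def using kl by (elim disjE) simp_all
  define \<eta> where "\<eta> = \<kappa> * sin_prod a b 0"
  have H: "\<eta> * (cos (pi * (y5 + (u * y1 + v * y2 + w * y3))) + u * v * w * sin (pi * z4)) > 0"
    if u: "u = 1 \<or> u = -1" and v: "v = 1 \<or> v = -1" and w: "w = 1 \<or> w = -1" for u v w
  proof -
    let ?s = "(1 + u) / 2 * c p + (1 + v) / 2 * c q + (1 + w) / 2 * c r"
    let ?X = "y5 + (u * y1 + v * y2 + w * y3)"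
    define l where "l = (1 + u + v + w) / 2"
    have "\<exists>j :: int. l = of_int j \<and> (if even j then 1 else - 1) = u * v * w"
    proof -
      have "l = of_int 2 \<and> u * v * w = 1 \<or> l = of_int 1 \<and> u * v * w = -1 \<or>
          l = of_int 0 \<and> u * v * w = 1 \<or> l = of_int (-1) \<and> u * v * w = -1"
        using u v w unfolding l_def by (elim disjE) simp_all
      then show ?thesis by (metis even_numeral odd_one even_zero even_minus)
    qed
    then obtain j where j: "l = of_int j" "(if even j then 1 else - 1) = u * v * w" by blast
    obtain i where i: "u * of_int k1 + v * of_int k2 + w * of_int k3 = real_of_int i" "even (i - (k1 + k2 + k3))"
    proof -
      obtain u' v' w' where "u = of_int u'" "v = of_int v'" "w = of_int w'" "odd u'" "odd v'" "odd w'"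
        using u v w by (metis of_int_1 of_int_minus odd_one even_minus)
      then show thesis by (intro that[of "u' * k1 + v' * k2 + w' * k3"]) auto
    qed
    have "2 * ?s - a - b = E + (u * c p + v * c q + w * c r)"
      unfolding E_def by (simp add: field_simps)
    also have "\<dots> = ?X + of_int (k5 + i + j)"
      unfolding y5(2) y1(2) y2(2) y3(2) of_int_add j(1)[symmetric] i(1)[symmetric] l_def
      by (simp add: field_simps)
    finally have "cos (pi * (2 * ?s - a - b)) = (if even (k5 + i + j) then 1 else - 1) * cos (pi * ?X)"
      by (simp only: cos_pi_add_of_int)
    also have "(if even (k5 + i + j) then 1 else - 1) = \<kappa> * (u * v * w)"
      using i(2) unfolding j(2)[symmetric] \<kappa>_def K_def by auto
    finally have "sin_prod a b ?s = - (\<kappa> * (u * v * w * cos (pi * ?X) + sin (pi * z4))) / 2"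
      unfolding sin_prod_eq D z4 by (simp add: algebra_simps)
    then have "0 < - (u * v * w) * (- (\<kappa> * (u * v * w * cos (pi * ?X) + sin (pi * z4))) / 2) * sin_prod a b 0"
      using alternating_face[OF alt pqr u v w] by simp
    also have "\<dots> = \<eta> * (((u * v * w) * (u * v * w)) * cos (pi * ?X) + u * v * w * sin (pi * z4)) / 2"
      by (simp add: \<eta>_def algebra_simps)
    also have "(u * v * w) * (u * v * w) = 1" using u v w by auto
    finally show ?thesis by simp
  qed
  have z4b: "\<bar>z4\<bar> = \<bar>y4\<bar>" using kl by (auto simp: z4_def abs_mult)
  then have "\<bar>z4\<bar> \<le> 1 / 2" using y4(1) by simp
  note S = spinor_inequalities[OF y1(1) y2(1) y3(1) this y5(1) H]
  show "int_dist (c p) + int_dist (c q) + int_dist (c r) > 1" using S(1) y1 y2 y3 by simp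
  show "int_dist (c p) + int_dist (c q) + int_dist E > 1" using S(2) y1 y2 y5 by simp
  show "int_dist (c p) + int_dist (c q) + int_dist (b - a) > 1" using S(3) y1 y2 y4 z4b by simp
  show "int_dist (c p) + int_dist E + int_dist (b - a) > 1" using S(4) y1 y5 y4 z4b by simp
qed

text \<open>
  The Galois conjugates of \<open>e(a)\<close>, with \<open>N a\<close> an integer, are the \<open>e(t a)\<close> with \<open>t\<close> prime to \<open>N\<close>. So this is
  the sign condition for all conjugates of the parameters.
\<close>

definition rationally_alternating :: "nat \<Rightarrow> real \<Rightarrow> real \<Rightarrow> (nat \<Rightarrow> real) \<Rightarrow> nat \<Rightarrow> bool" where
  "rationally_alternating n a b c N \<longleftrightarrow> N > 0 \<and> real N * a \<in> \<int> \<and> real N * b \<in> \<int> \<and> (\<forall>k\<in>{1..n}. real N * c k \<in> \<int>) \<and>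
     (\<forall>t. coprime t N \<longrightarrow> alternating n (real t * a) (real t * b) (\<lambda>k. real t * c k))"

text \<open>
  Otherwise some conjugate would violate \<open>alternating_triple\<close>, because the mean of the sum of the three
  distances over all conjugates is at most \<open>1\<close>.
\<close>

lemma half_among_triples:
  assumes R: "rationally_alternating n a b c N" and pqr: "{p, q, r} \<subseteq> {1..n}" "p \<noteq> q" "p \<noteq> r" "q \<noteq> r"
  defines "E \<equiv> c p + c q + c r - a - b"
  shows "half_mod_1 (c p) \<or> half_mod_1 (c q) \<or> half_mod_1 (c r)"
    and "half_mod_1 (c p) \<or> half_mod_1 (c q) \<or> half_mod_1 E"
    and "half_mod_1 (c p) \<or> half_mod_1 (c q) \<or> half_mod_1 (b - a)"
    and "half_mod_1 (c p) \<or> half_mod_1 E \<or> half_mod_1 (b - a)"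
proof -
  have N: "N > 0" "real N * a \<in> \<int>" "real N * b \<in> \<int>" "real N * c p \<in> \<int>" "real N * c q \<in> \<int>" "real N * c r \<in> \<int>"
    and alt: "\<And>t. coprime t N \<Longrightarrow> alternating n (real t * a) (real t * b) (\<lambda>k. real t * c k)"
    using R pqr(1) by (auto simp: rationally_alternating_def)
  have NE: "real N * E \<in> \<int>" "real N * (b - a) \<in> \<int>"
    unfolding E_def distrib_left right_diff_distrib using N by (auto intro!: Ints_diff Ints_add)
  have tE: "real t * c p + real t * c q + real t * c r - real t * a - real t * b = real t * E"
    "real t * b - real t * a = real t * (b - a)" for t
    by (simp_all add: E_def algebra_simps)
  note T = alternating_triple[OF alt pqr, unfolded tE]
  have gen: "half_mod_1 z1 \<or> half_mod_1 z2 \<or> half_mod_1 z3"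
    if z: "real N * z1 \<in> \<int>" "real N * z2 \<in> \<int>" "real N * z3 \<in> \<int>"
      and gt: "\<And>t. coprime t N \<Longrightarrow> int_dist (real t * z1) + int_dist (real t * z2) + int_dist (real t * z3) > 1" for z1 z2 z3
  proof (rule ccontr)
    assume "\<not> ?thesis"
    then obtain t where "coprime t N" "int_dist (real t * z1) + int_dist (real t * z2) + int_dist (real t * z3) \<le> 1"
      using exists_unit_int_dist_sum_le[OF N(1), of z1 z2 z3] z unfolding half_mod_1_def by blast
    then show False using gt[of t] by simp
  qed
  show "half_mod_1 (c p) \<or> half_mod_1 (c q) \<or> half_mod_1 (c r)" by (intro gen N T(1))
  show "half_mod_1 (c p) \<or> half_mod_1 (c q) \<or> half_mod_1 E" by (intro gen N NE T(2))
  show "half_mod_1 (c p) \<or> half_mod_1 (c q) \<or> half_mod_1 (b - a)" by (intro gen N NE T(3))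
  show "half_mod_1 (c p) \<or> half_mod_1 E \<or> half_mod_1 (b - a)" by (intro gen N NE T(4))
qed


lemma half_sum_Ints:
  assumes "finite S" "\<And>k. k \<in> S \<Longrightarrow> half_mod_1 (c k)"
  shows "sum c S - real (card S) / 2 \<in> \<int>"
proof -
  have "sum c S - real (card S) / 2 = (\<Sum>k\<in>S. c k - 1 / 2)" by (simp add: sum_subtractf)
  also have "\<dots> \<in> \<int>" using assms(2) by (intro Ints_sum) (simp add: half_mod_1_def)
  finally show ?thesis .
qed

definition count_half :: "nat \<Rightarrow> real \<Rightarrow> real \<Rightarrow> (nat \<Rightarrow> real) \<Rightarrow> nat" where
  "count_half n a b c = card {k\<in>{1..n}. half_mod_1 (c k)} + of_bool (half_mod_1 (b - a))
     + of_bool (half_mod_1 ((\<Sum>k=1..n. c k) - a - b - (real n - 1) / 2))"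

text \<open>
  Let \<open>T\<close> be the set of the directions \<open>k\<close> with \<open>c\<^sub>k\<close> not \<open>1/2\<close>. Any three of the \<open>c\<^sub>k\<close> include a half, so
  \<open>T\<close> has at most two elements and is contained in a three-dimensional face \<open>{p, q, r}\<close>. The other triples on
  this face show that at least \<open>card T\<close> of the two numbers \<open>b - a\<close> and \<open>e\<close> are halves.
\<close>

lemma count_half_ge_if_rationally_alternating:
  assumes n: "n \<ge> 3" and R: "rationally_alternating n a b c N"
  shows "count_half n a b c \<ge> n"
proof -
  define T where "T = {k\<in>{1..n}. \<not> half_mod_1 (c k)}"
  define H where "H = {k\<in>{1..n}. half_mod_1 (c k)}"
  have HT: "H \<union> T = {1..n}" "H \<inter> T = {}" "finite H" "finite T" by (auto simp: H_def T_def)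
  then have cHT: "card H + card T = n" by (metis card_Un_disjoint card_atLeastAtMost diff_Suc_1)
  define e where "e = (\<Sum>k=1..n. c k) - a - b - (real n - 1) / 2"
  have cT: "card T \<le> 2"
  proof (rule ccontr)
    assume "\<not> card T \<le> 2"
    then have "3 \<le> card T" by simp
    then obtain U where U: "U \<subseteq> T" "card U = 3" by (meson obtain_subset_with_card_n)
    then obtain p q r where "U = {p, q, r}" "p \<noteq> q" "q \<noteq> r" "p \<noteq> r" by (auto simp: card_3_iff)
    then show False using half_among_triples(1)[OF R, of p q r] U(1) by (auto simp: T_def)
  qed
  \<comment> \<open>the directions outside the face contribute halves, so the last exponent may be computed on the face\<close>
  have E: "half_mod_1 e" if P: "{p, q, r} \<subseteq> {1..n}" "p \<noteq> q" "p \<noteq> r" "q \<noteq> r" "T \<subseteq> {p, q, r}"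
     and h: "half_mod_1 (c p + c q + c r - a - b)" for p q r
  proof -
    let ?R = "{1..n} - {p, q, r}"
    have "sum c ?R - real (card ?R) / 2 \<in> \<int>"
      using P(5) by (intro half_sum_Ints) (auto simp: T_def)
    moreover have "card ?R = n - 3" using P by (subst card_Diff_subset) auto
    moreover have "sum c {1..n} = sum c ?R + (c p + c q + c r)"
      using P by (subst sum.subset_diff[of "{p, q, r}"]) (auto simp: add.assoc)
    ultimately have "e - (c p + c q + c r - a - b) + 1 \<in> \<int>"
      using n by (simp add: e_def of_nat_diff diff_divide_distrib algebra_simps)
    from Ints_diff[OF Ints_add[OF this h[unfolded half_mod_1_def]], of 1]
    show ?thesis unfolding half_mod_1_def by (simp add: algebra_simps)
  qed
  obtain p q r where pqr: "{p, q, r} \<subseteq> {1..n}" "p \<noteq> q" "p \<noteq> r" "q \<noteq> r" "T \<subseteq> {p, q, r}"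
    and pq: "card T = 2 \<Longrightarrow> \<not> half_mod_1 (c p) \<and> \<not> half_mod_1 (c q)"
    and p1: "card T = 1 \<Longrightarrow> \<not> half_mod_1 (c p)"
  proof -
    obtain U where U: "T \<subseteq> U" "U \<subseteq> {1..n}" "card U = 3"
      using exists_subset_between[of T 3 "{1..n}"] cT n HT by auto
    consider "card T = 0" | "card T = 1" | "card T = 2" using cT by linarith
    then show thesis
    proof cases
      case 1
      obtain p q r where "U = {p, q, r}" "p \<noteq> q" "q \<noteq> r" "p \<noteq> r" using U(3) by (auto simp: card_3_iff)
      then show thesis using 1 U by (intro that[of p q r]) auto
    next
      case 2
      then obtain p where p: "T = {p}" by (auto simp: card_1_singleton_iff)
      have "card (U - {p}) = 2" using U p by simp
      then obtain q r where "U - {p} = {q, r}" "q \<noteq> r" by (auto simp: card_2_iff)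
      then have "U = {p, q, r}" "p \<noteq> q" "p \<noteq> r" using U p by auto
      then show thesis using 2 U p \<open>q \<noteq> r\<close> by (intro that[of p q r]) (auto simp: T_def)
    next
      case 3
      then obtain p q where p: "T = {p, q}" "p \<noteq> q" by (auto simp: card_2_iff)
      have "card (U - {p, q}) = 1" using U p by (subst card_Diff_subset) auto
      then obtain r where "U - {p, q} = {r}" by (auto simp: card_1_singleton_iff)
      then have "U = {p, q, r}" "p \<noteq> r" "q \<noteq> r" using U p by auto
      then show thesis using 3 U p by (intro that[of p q r]) (auto simp: T_def)
    qed
  qed
  note G = half_among_triples[OF R pqr(1-4)]
  have "card T \<le> of_bool (half_mod_1 (b - a)) + of_bool (half_mod_1 e)"
  proof -
    consider "card T = 0" | "card T = 1" | "card T = 2" using cT by linarith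
    then show ?thesis
    proof cases
      case 2
      then have "half_mod_1 e \<or> half_mod_1 (b - a)" using G(4) p1 E[OF pqr] by blast
      then show ?thesis using 2 by auto
    next
      case 3
      then have "half_mod_1 e" "half_mod_1 (b - a)" using G(2,3) pq E[OF pqr] by blast+
      then show ?thesis using 3 by simp
    qed simp
  qed
  then show ?thesis using cHT unfolding count_half_def e_def H_def by linarith
qed

text \<open>
  Halves among the \<open>c\<^sub>k\<close> shift the argument of \<open>\<phi> = sin_prod a b\<close> by \<open>1/2\<close>. Let \<open>T\<close> consist of the at most two
  other directions. If \<open>b - a\<close> is a half, then \<open>\<phi>(s + 1/2) = - \<phi>(s)\<close>. If \<open>T = {p}\<close> and the last
  exponent is a half, then \<open>c\<^sub>p \<equiv> a + b + 1/2\<close> and \<open>\<phi>(s + c\<^sub>p) = \<phi>(1/2 - s)\<close>. If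
  \<open>T = {p, q}\<close>, both exponents are halves, \<open>c\<^sub>p + c\<^sub>q \<equiv> a + b\<close> and \<open>\<phi>(a + b) = \<phi>(0)\<close>. In all cases the values
  of \<open>\<phi>\<close> that occur are, up to sign, \<open>\<phi>(0)\<close>, \<open>\<phi>(1/2)\<close>, \<open>\<phi>(c\<^sub>p)\<close> and \<open>\<phi>(c\<^sub>q)\<close>, which are known on the
  edges.
\<close>

lemma alternating_if_count_half_ge:
  assumes n: "n \<ge> 3" and C: "count_half n a b c \<ge> n"
    and G: "\<And>k. k \<in> {1..n} \<Longrightarrow> alternating 1 a b (\<lambda>_. c k)"
  shows "alternating n a b c"
proof -
  define \<phi> where "\<phi> = sin_prod a b"
  define T where "T = {k\<in>{1..n}. \<not> half_mod_1 (c k)}"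
  define H where "H = {k\<in>{1..n}. half_mod_1 (c k)}"
  have HT: "H \<union> T = {1..n}" "H \<inter> T = {}" "finite H" "finite T" by (auto simp: H_def T_def)
  then have cHT: "card H + card T = n" by (metis card_Un_disjoint card_atLeastAtMost diff_Suc_1)
  define e where "e = (\<Sum>k=1..n. c k) - a - b - (real n - 1) / 2"
  have cT: "card T \<le> of_bool (half_mod_1 (b - a)) + of_bool (half_mod_1 e)"
    using C cHT unfolding count_half_def e_def H_def by linarith
  have g: "\<phi> (c k) * \<phi> 0 < 0" "\<phi> 0 * \<phi> 0 > 0" if "k \<in> {1..n}" for k
  proof -
    have *: "S \<subseteq> {1..1} \<Longrightarrow> (-1) ^ card S * sin_prod a b (sum (\<lambda>_. c k) S) * sin_prod a b 0 > 0" for S :: "nat set"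
      using G[OF that] unfolding alternating_def by blast
    show "\<phi> (c k) * \<phi> 0 < 0" "\<phi> 0 * \<phi> 0 > 0"
      using *[of "{1}"] *[of "{}"] by (simp_all add: \<phi>_def)
  qed
  have g0: "\<phi> 0 * \<phi> 0 > 0" using g(2)[of 1] n by simp
  have "H \<noteq> {}"
  proof
    assume "H = {}"
    then have "card T = n" using cHT by simp
    then show False using cT n by (auto simp: of_bool_def split: if_splits)
  qed
  then obtain h where h: "h \<in> {1..n}" "half_mod_1 (c h)" by (auto simp: H_def)
  have g12: "\<phi> (1 / 2) * \<phi> 0 < 0"
    using g(1)[OF h(1)] sin_prod_cong[of "c h" "1 / 2" a b] h(2) by (simp add: half_mod_1_def \<phi>_def)
  have cong: "\<phi> s = \<phi> s'" if "s - s' \<in> \<int>" for s s'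
    unfolding \<phi>_def using that by (rule sin_prod_cong)
  have halves: "\<phi> (real j / 2 + s) = (if even j then \<phi> s else \<phi> (1 / 2 + s))" for j :: nat and s
  proof (cases "even j")
    case True
    then obtain i where "j = 2 * i" by (rule evenE)
    then show ?thesis using True cong[of "real j / 2 + s" s] by simp
  next
    case False
    then obtain i where "j = 2 * i + 1" by (rule oddE)
    then have "real j / 2 + s - (1 / 2 + s) = real i" by (simp add: add_divide_distrib)
    then show ?thesis using False cong[of "real j / 2 + s" "1 / 2 + s"] by simp
  qed
  have anti: "\<phi> (1 / 2 + s) = - \<phi> s" if hba: "half_mod_1 (b - a)" for s
  proof -
    obtain k where k: "b - a - 1 / 2 = of_int k" using hba unfolding half_mod_1_def by (rule Ints_cases)
    have "cos (pi * (b - a)) = cos (pi * (1 / 2 + of_int k))"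
      by (simp add: k[symmetric])
    then have "cos (pi * (b - a)) = 0" unfolding cos_pi_add_of_int by simp
    moreover have "2 * (1 / 2 + s) - a - b = (2 * s - a - b) + of_int 1" by simp
    then have "cos (pi * (2 * (1 / 2 + s) - a - b)) = - cos (pi * (2 * s - a - b))"
      by (simp only: cos_pi_add_of_int) simp
    ultimately show ?thesis unfolding \<phi>_def sin_prod_eq by simp
  qed
  have sumS: "\<phi> (sum c S) = (if even (card (S - T)) then \<phi> (sum c (S \<inter> T)) else \<phi> (1 / 2 + sum c (S \<inter> T)))"
    if S: "S \<subseteq> {1..n}" for S
  proof -
    have fS: "finite S" using S finite_subset by blast
    have "sum c (S - T) - real (card (S - T)) / 2 \<in> \<int>"
      using S fS by (intro half_sum_Ints) (auto simp: T_def)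
    moreover have "sum c S = sum c (S \<inter> T) + sum c (S - T)" by (rule sum.Int_Diff[OF fS])
    ultimately have "\<phi> (sum c S) = \<phi> (real (card (S - T)) / 2 + sum c (S \<inter> T))"
      by (intro cong) (simp add: algebra_simps)
    then show ?thesis unfolding halves .
  qed
  have sumT: "e - (sum c T - a - b) - (real (card H) - real n + 1) / 2 \<in> \<int>"
  proof -
    have "sum c H - real (card H) / 2 \<in> \<int>" by (intro half_sum_Ints) (auto simp: H_def)
    moreover have "e - (sum c T - a - b) - (real (card H) - real n + 1) / 2 = sum c H - real (card H) / 2"
    proof -
      have "sum c {1..n} = sum c H + sum c T"
        using HT by (metis sum.union_disjoint)
      then show ?thesis unfolding e_def by (simp add: field_simps)
    qed
    ultimately show ?thesis by simp
  qed
  have key: "(-1) ^ card (S - T) * (-1) ^ card (S \<inter> T) * (\<phi> (sum c S) * \<phi> 0) > 0" if S: "S \<subseteq> {1..n}" for S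
  proof -
    consider "card T = 0" | p where "T = {p}" | p q where "T = {p, q}" "p \<noteq> q"
    proof -
      have "card T \<le> 2" using cT by (auto simp: of_bool_def split: if_splits)
      then have "card T = 0 \<or> card T = 1 \<or> card T = 2" by linarith
      then show thesis using that by (auto simp: card_1_singleton_iff card_2_iff)
    qed
    then show ?thesis
    proof cases
      case 1
      then have "T = {}" using HT by simp
      then show ?thesis using sumS[OF S] g0 g12 by simp
    next
      case (2 p)
      then have p: "p \<in> {1..n}" by (auto simp: T_def)
      have "half_mod_1 (b - a) \<or> half_mod_1 e" using cT 2 by (cases "half_mod_1 e"; cases "half_mod_1 (b - a)") simp_all
      then show ?thesis
      proof
        assume "half_mod_1 (b - a)"
        then show ?thesis using sumS[OF S] anti g(1)[OF p] g0 g12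
          by (cases "p \<in> S") (simp_all add: 2)
      next
        assume he: "half_mod_1 e"
        have "card H + 1 = n" using cHT 2 by simp
        then have "real (card H) - real n + 1 = 0" by linarith
        with sumT have "e - (c p - a - b) \<in> \<int>" by (simp add: 2)
        with he have "(e - 1 / 2) - (e - (c p - a - b)) \<in> \<int>" unfolding half_mod_1_def by (rule Ints_diff)
        moreover have "(e - 1 / 2) - (e - (c p - a - b)) = c p - a - b - 1 / 2" by simp
        ultimately have cp: "c p - a - b - 1 / 2 \<in> \<int>" by (simp only:)
        obtain k where k: "c p - a - b - 1 / 2 = of_int k" using cp by (rule Ints_cases)
        have refl: "\<phi> (s + c p) = \<phi> (1 / 2 - s)" for s
        proof -
          have "2 * (s + c p) - a - b = - (2 * (1 / 2 - s) - a - b) + of_int (2 * k + 2)"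
            using k by simp
          then have "cos (pi * (2 * (s + c p) - a - b)) = cos (pi * (2 * (1 / 2 - s) - a - b))"
            by (simp only: cos_pi_add_of_int mult_minus_right cos_minus) simp
          then show ?thesis by (simp only: \<phi>_def sin_prod_eq)
        qed
        have "\<phi> (c p) = \<phi> (1 / 2)" "\<phi> (1 / 2 + c p) = \<phi> 0"
          using refl[of 0] refl[of "1 / 2"] by simp_all
        then show ?thesis using sumS[OF S] g0 g12
          by (cases "p \<in> S") (simp_all add: 2)
      qed
    next
      case (3 p q)
      have pq: "p \<in> {1..n}" "q \<in> {1..n}" using 3 by (auto simp: T_def)
      have h: "half_mod_1 (b - a)" "half_mod_1 e" using cT 3 by (cases "half_mod_1 e"; cases "half_mod_1 (b - a)"; simp)+
      have "card H + 2 = n" using cHT 3 by simp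
      then have "real (card H) - real n + 1 = -1" by linarith
      with sumT have "e - (c p + c q - a - b) - (-1) / 2 \<in> \<int>" by (simp only: 3) (use 3(2) in simp)
      with h(2) have "(e - 1 / 2) - (e - (c p + c q - a - b) - (-1) / 2) \<in> \<int>"
        unfolding half_mod_1_def by (rule Ints_diff)
      then have "(e - 1 / 2) - (e - (c p + c q - a - b) - (-1) / 2) + 1 \<in> \<int>" by (rule Ints_add) (rule Ints_1)
      moreover have "(e - 1 / 2) - (e - (c p + c q - a - b) - (-1) / 2) + 1 = (c p + c q) - (a + b)" by simp
      ultimately have "(c p + c q) - (a + b) \<in> \<int>" by (simp only:)
      then have "\<phi> (c p + c q) = \<phi> (a + b)" by (rule cong)
      also have "\<dots> = \<phi> 0" by (simp add: \<phi>_def sin_prod_def)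
      finally have "\<phi> (c p + c q) = \<phi> 0" .
      then show ?thesis using sumS[OF S] anti[OF h(1)] g(1)[OF pq(1)] g(1)[OF pq(2)] g0 g12
        by (cases "p \<in> S"; cases "q \<in> S") (simp_all add: 3)
    qed
  qed
  show ?thesis unfolding alternating_def
  proof (intro allI impI)
    fix S assume S: "S \<subseteq> {1..n}"
    then have "finite S" using finite_subset by blast
    then have "card S = card (S - T) + card (S \<inter> T)"
      by (metis card_Diff_subset_Int Int_lower1 card_mono finite_Int le_add_diff_inverse2)
    then show "(-1) ^ card S * sin_prod a b (sum c S) * sin_prod a b 0 > 0"
      using key[OF S] by (simp add: power_add \<phi>_def mult.assoc)
  qed
qed

section \<open>The common eigenvectors of the circuit matrices\<close>

lemma sum_Pow_prod_if:
  fixes p q :: "'a \<Rightarrow> 'b :: comm_semiring_1"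
  assumes "finite A"
  shows "(\<Sum>S\<in>Pow A. \<Prod>k\<in>A. if k \<in> S then p k else q k) = (\<Prod>k\<in>A. p k + q k)"
proof -
  have "(\<Prod>k\<in>A. if k \<in> S then p k else q k) = (\<Prod>k\<in>S. p k) * (\<Prod>k\<in>A - S. q k)" if "S \<in> Pow A" for S
  proof -
    have "A \<inter> {k. k \<in> S} = S" "A \<inter> - {k. k \<in> S} = A - S" using that by auto
    then show ?thesis using assms by (simp add: prod.If_cases)
  qed
  then show ?thesis using prod_add[OF assms, of p q] by simp
qed

lemma prod_if_delta:
  fixes A :: "'a set"
  assumes "finite A" "S \<subseteq> A" "T \<subseteq> A"
  shows "(\<Prod>k\<in>A. if (k \<in> S) = (k \<in> T) then 1 else 0 :: 'b :: comm_semiring_1) = (if S = T then 1 else 0)"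
proof (cases "S = T")
  case False
  then obtain k where "k \<in> A" "(k \<in> S) \<noteq> (k \<in> T)" using assms by blast
  then show ?thesis using False assms(1) by (auto intro!: prod_zero)
qed simp

text \<open>
  The multi-index with support \<open>S \<subseteq> {1..n}\<close>. Coordinates indexed by subsets make products over \<open>{1..n}\<close>,
  and with them the tensor product structure of the circuit matrices, accessible to \<open>sum_Pow_prod_if\<close>.
\<close>

definition set_index :: "nat set \<Rightarrow> nat" where
  "set_index S = set_encode ((\<lambda>k. k - 1) ` S)"

lemma bit_set_index:
  assumes "S \<subseteq> {1..n}"
  shows "bit (set_index S) j \<longleftrightarrow> Suc j \<in> S"
proof -
  have "finite S" using assms finite_subset by blast
  then have "set_decode (set_index S) = (\<lambda>k. k - 1) ` S"
    unfolding set_index_def by (intro set_encode_inverse) simp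
  then have "bit (set_index S) j \<longleftrightarrow> j \<in> (\<lambda>k. k - 1) ` S"
    by (auto simp: set_decode_def bit_iff_odd)
  also have "\<dots> \<longleftrightarrow> Suc j \<in> S" using assms by (force simp: image_iff)
  finally show ?thesis .
qed

lemma set_index_less:
  assumes "S \<subseteq> {1..n}"
  shows "set_index S < 2 ^ n"
proof -
  have "take_bit n (set_index S) = set_index S"
    using assms by (intro bit_eqI) (auto simp: bit_take_bit_iff bit_set_index[OF assms])
  then show ?thesis by (metis take_bit_nat_less_exp)
qed

lemma bij_betw_set_index: "bij_betw set_index (Pow {1..n}) {..<2 ^ n}"
proof (rule bij_betw_byWitness[where f' = "\<lambda>I. {k\<in>{1..n}. bit I (k - 1)}"])
  show "\<forall>S\<in>Pow {1..n}. {k \<in> {1..n}. bit (set_index S) (k - 1)} = S"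
  proof
    fix S assume "S \<in> Pow {1..n}"
    then have S: "S \<subseteq> {1..n}" by simp
    have "k \<in> {k \<in> {1..n}. bit (set_index S) (k - 1)} \<longleftrightarrow> k \<in> S" for k
      using bit_set_index[OF S, of "k - 1"] S by (cases k) auto
    then show "{k \<in> {1..n}. bit (set_index S) (k - 1)} = S" by blast
  qed
  have "set_index {k \<in> {1..n}. bit I (k - 1)} = I" if "I < 2 ^ n" for I
  proof (rule bit_eqI)
    fix j
    have "bit I j \<longleftrightarrow> bit (take_bit n I) j" using that by (simp add: take_bit_nat_eq_self)
    then show "bit (set_index {k \<in> {1..n}. bit I (k - 1)}) j = bit I j"
      by (subst bit_set_index[of _ n]) (auto simp: bit_take_bit_iff)
  qed
  then show "\<forall>I\<in>{..<2 ^ n}. set_index {k \<in> {1..n}. bit I (k - 1)} = I" by simp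
  show "set_index ` Pow {1..n} \<subseteq> {..<2 ^ n}" using set_index_less by auto
qed auto

lemma set_index_eq_iff: "S \<subseteq> {1..n} \<Longrightarrow> T \<subseteq> {1..n} \<Longrightarrow> set_index S = set_index T \<longleftrightarrow> S = T"
  using bij_betw_imp_inj_on[OF bij_betw_set_index[of n]] by (auto dest: inj_onD)

lemma sum_set_index: "(\<Sum>i<2 ^ n. f i) = (\<Sum>S\<in>Pow {1..n}. f (set_index S))"
  by (rule sum.reindex_bij_betw[OF bij_betw_set_index, symmetric])

lemma digit_set_index: "S \<subseteq> {1..n} \<Longrightarrow> k \<in> {1..n} \<Longrightarrow> digit (set_index S) k = of_bool (k \<in> S)"
  by (simp add: digit_def bit_set_index)

lemma weight_set_index: "S \<subseteq> {1..n} \<Longrightarrow> weight n (set_index S) = card S"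
  by (simp add: weight_def digit_set_index Int_absorb1 flip: sum.inter_filter Int_def)

lemma set_index_empty [simp]: "set_index {} = 0"
  by (simp add: set_index_def)

lemma set_index_full: "set_index {1..n} = 2 ^ n - 1"
proof (rule bit_eqI)
  fix j show "bit (set_index {1..n}) j = bit (2 ^ n - 1 :: nat) j"
    using bit_mask_iff[where 'a = nat, of n j] by (auto simp: bit_set_index[of _ n] mask_eq_exp_minus_1)
qed

lemma set_index_Diff_singleton:
  assumes "S \<subseteq> {1..n}" "k \<in> {1..n}"
  shows "unset_bit (k - 1) (set_index S) = set_index (S - {k})"
proof (rule bit_eqI)
  fix j
  have "S - {k} \<subseteq> {1..n}" using assms by auto
  then show "bit (unset_bit (k - 1) (set_index S)) j = bit (set_index (S - {k})) j"
    using assms by (auto simp: bit_unset_bit_iff bit_set_index[of _ n])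
qed

text \<open>
  The value is \<open>0\<close> outside the power set of \<open>{1..n}\<close>, so that equations between images are equations of functions.
\<close>

definition act :: "nat \<Rightarrow> complex mat \<Rightarrow> (nat set \<Rightarrow> complex) \<Rightarrow> nat set \<Rightarrow> complex" where
  "act n A x S = (if S \<subseteq> {1..n} then \<Sum>T\<in>Pow {1..n}. A $$ (set_index S, set_index T) * x T else 0)"

lemma act_mult:
  assumes "A \<in> carrier_mat (2 ^ n) (2 ^ n)" "B \<in> carrier_mat (2 ^ n) (2 ^ n)"
  shows "act n (A * B) x = act n A (act n B x)"
proof
  fix S
  show "act n (A * B) x S = act n A (act n B x) S"
  proof (cases "S \<subseteq> {1..n}")
    case True
    have "(A * B) $$ (set_index S, set_index T) = (\<Sum>U\<in>Pow {1..n}. A $$ (set_index S, set_index U) * B $$ (set_index U, set_index T))"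
      if "T \<subseteq> {1..n}" for T
    proof -
      have "(A * B) $$ (set_index S, set_index T) = (\<Sum>i<2 ^ n. A $$ (set_index S, i) * B $$ (i, set_index T))"
        using assms set_index_less[OF True] set_index_less[OF that]
        by (simp add: scalar_prod_def lessThan_atLeast0)
      then show ?thesis unfolding sum_set_index .
    qed
    then have "act n (A * B) x S =
        (\<Sum>T\<in>Pow {1..n}. \<Sum>U\<in>Pow {1..n}. A $$ (set_index S, set_index U) * B $$ (set_index U, set_index T) * x T)"
      using True by (simp add: act_def sum_distrib_right)
    also have "\<dots> = (\<Sum>U\<in>Pow {1..n}. \<Sum>T\<in>Pow {1..n}. A $$ (set_index S, set_index U) * (B $$ (set_index U, set_index T) * x T))"
      by (subst sum.swap) (simp add: mult.assoc)
    also have "\<dots> = act n A (act n B x) S"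
      using True by (simp add: act_def sum_distrib_left)
    finally show ?thesis .
  qed (simp add: act_def)
qed

lemma act_one: "act n (1\<^sub>m (2 ^ n)) x S = (if S \<subseteq> {1..n} then x S else 0)"
proof (cases "S \<subseteq> {1..n}")
  case True
  have "(1\<^sub>m (2 ^ n) :: complex mat) $$ (set_index S, set_index T) = (if T = S then 1 else 0)" if "T \<subseteq> {1..n}" for T
    using set_index_less[OF True] set_index_less[OF that] set_index_eq_iff[OF True that] by auto
  then have "act n (1\<^sub>m (2 ^ n)) x S = (\<Sum>T\<in>Pow {1..n}. if T = S then x T else 0)"
    unfolding act_def if_P[OF True] by (intro sum.cong refl) simp
  also have "\<dots> = x S" using True by simp
  finally show ?thesis using True by simp
qed (simp add: act_def)

lemma act_circuit_mat:
  assumes "S \<subseteq> {1..n}" "k \<in> {1..n}"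
  shows "act n (circuit_mat n \<gamma> k) x S =
    (if k \<in> S then inverse (\<gamma> k) * x S else x S - inverse (\<gamma> k) * x (insert k S))"
proof -
  have "circuit_mat n \<gamma> k $$ (set_index S, set_index T) * x T =
      (if T = S then (if k \<in> S then inverse (\<gamma> k) else 1) * x S else 0)
      + (if T = insert k S then (if k \<in> S then 0 else - inverse (\<gamma> k)) * x (insert k S) else 0)"
    if T: "T \<subseteq> {1..n}" for T
  proof -
    have "T - {k} \<subseteq> {1..n}" using T by auto
    then show ?thesis
      unfolding circuit_mat_index[OF set_index_less[OF assms(1)] set_index_less[OF T]]
        digit_set_index[OF T assms(2)] set_index_Diff_singleton[OF T assms(2)]
        set_index_eq_iff[OF assms(1) T] set_index_eq_iff[OF assms(1) \<open>T - {k} \<subseteq> {1..n}\<close>]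
      by (cases "k \<in> T"; cases "k \<in> S") (auto simp: insert_absorb)
  qed
  then have "act n (circuit_mat n \<gamma> k) x S =
      (\<Sum>T\<in>Pow {1..n}. (if T = S then (if k \<in> S then inverse (\<gamma> k) else 1) * x S else 0)
      + (if T = insert k S then (if k \<in> S then 0 else - inverse (\<gamma> k)) * x (insert k S) else 0))"
    using assms by (auto simp: act_def intro!: sum.cong)
  also have "\<dots> = (if k \<in> S then inverse (\<gamma> k) else 1) * x S
      + (if k \<in> S then 0 else - inverse (\<gamma> k)) * x (insert k S)"
    unfolding sum.distrib using assms by (subst (1 2) sum.delta) auto
  finally show ?thesis by simp
qed

text \<open>
  Up to a correction at the empty set, the coefficients of the reflection are a sum of two products over
  \<open>{1..n}\<close>, which are evaluated on the eigenvectors factor by factor.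
\<close>

lemma refl_coeff_set_index:
  assumes "S \<subseteq> {1..n}" and nz: "\<alpha> \<noteq> 0" "\<beta> \<noteq> 0"
  shows "refl_coeff n \<alpha> \<beta> \<gamma> (set_index S) =
    (\<Prod>k=1..n. if k \<in> S then 1 else - \<gamma> k)
    + (-1) ^ n * (\<Prod>k=1..n. \<gamma> k) / (\<alpha> * \<beta>)
    - (if S = {} then (-1) ^ n * (\<Prod>k=1..n. \<gamma> k) * (\<alpha> + \<beta>) / (\<alpha> * \<beta>) else 0)"
proof -
  have fS: "finite S" using assms(1) finite_subset by blast
  have le: "card S \<le> n" using assms(1) card_mono[of "{1..n}" S] by simp
  have P: "(\<Prod>k=1..n. if k \<in> S then f k else g k) = prod f S * prod g ({1..n} - S)" for f g :: "nat \<Rightarrow> complex"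
  proof -
    have "{1..n} \<inter> {k. k \<in> S} = S" "{1..n} \<inter> - {k. k \<in> S} = {1..n} - S" using assms(1) by auto
    then show ?thesis by (simp add: prod.If_cases)
  qed
  have full: "(\<Prod>k=1..n. \<gamma> k) = prod \<gamma> S * prod \<gamma> ({1..n} - S)"
    using assms(1) by (simp add: prod.subset_diff mult.commute)
  have sgn: "prod (\<lambda>k. - \<gamma> k) ({1..n} - S) = (-1) ^ (n + card S) * prod \<gamma> ({1..n} - S)"
  proof -
    have "prod (\<lambda>k. - \<gamma> k) ({1..n} - S) = (\<Prod>k\<in>{1..n} - S. (-1) * \<gamma> k)" by simp
    also have "\<dots> = (-1) ^ card ({1..n} - S) * prod \<gamma> ({1..n} - S)" by (simp only: prod.distrib prod_constant)
    also have "card ({1..n} - S) = n - card S" using assms(1) fS by (simp add: card_Diff_subset)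
    also have "(-1 :: complex) ^ (n - card S) = (-1) ^ (n + card S)"
      using le by (auto simp: minus_one_power_iff)
    finally show ?thesis .
  qed
  have d1: "(\<Prod>k=1..n. \<gamma> k ^ digit (set_index S) k) = prod \<gamma> S"
  proof -
    have "(\<Prod>k=1..n. \<gamma> k ^ digit (set_index S) k) = (\<Prod>k=1..n. if k \<in> S then \<gamma> k else 1)"
      using assms(1) by (intro prod.cong) (simp_all add: digit_set_index[OF assms(1)])
    then show ?thesis unfolding P by simp
  qed
  have d2: "(\<Prod>k=1..n. \<gamma> k ^ (1 - digit (set_index S) k)) = prod \<gamma> ({1..n} - S)"
  proof -
    have "(\<Prod>k=1..n. \<gamma> k ^ (1 - digit (set_index S) k)) = (\<Prod>k=1..n. if k \<in> S then 1 else \<gamma> k)"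
      using assms(1) by (intro prod.cong) (simp_all add: digit_set_index[OF assms(1)])
    then show ?thesis unfolding P by simp
  qed
  have sq: "(-1 :: complex) ^ (n + card S) * (-1) ^ card S = (-1) ^ n"
    by (simp add: power_add flip: power_mult_distrib)
  show ?thesis
  proof (cases "S = {}")
    case True
    then show ?thesis using nz P[of "\<lambda>_. 1" "\<lambda>k. - \<gamma> k"] sgn
      by (simp add: refl_coeff_def field_simps)
  next
    case False
    then have "set_index S \<noteq> 0" using set_index_eq_iff[OF assms(1), of "{}"] by simp
    then have "refl_coeff n \<alpha> \<beta> \<gamma> (set_index S) =
       (-1) ^ (n + card S) * ((\<alpha> * \<beta> + (-1) ^ card S * prod \<gamma> S) * prod \<gamma> ({1..n} - S)) / (\<alpha> * \<beta>)"
      unfolding refl_coeff_def d1 d2 weight_set_index[OF assms(1)] by simp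
    also have "\<dots> = (-1) ^ (n + card S) * prod \<gamma> ({1..n} - S)
        + ((-1) ^ (n + card S) * (-1) ^ card S) * (prod \<gamma> S * prod \<gamma> ({1..n} - S)) / (\<alpha> * \<beta>)"
      using nz by (simp add: field_simps)
    finally show ?thesis using False unfolding sq full[symmetric] P sgn by simp
  qed
qed

lemma act_refl_mat:
  assumes "S \<subseteq> {1..n}"
  shows "act n (refl_mat n \<alpha> \<beta> \<gamma>) x S =
    x S - (if S = {1..n} then \<Sum>T\<in>Pow {1..n}. refl_coeff n \<alpha> \<beta> \<gamma> (set_index T) * x T else 0)"
proof -
  have "refl_mat n \<alpha> \<beta> \<gamma> $$ (set_index S, set_index T) * x T =
      (if T = S then x T else 0) - (if S = {1..n} then refl_coeff n \<alpha> \<beta> \<gamma> (set_index T) * x T else 0)"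
    if T: "T \<subseteq> {1..n}" for T
    unfolding refl_mat_index[OF set_index_less[OF assms] set_index_less[OF T]] set_index_eq_iff[OF assms T]
      set_index_full[symmetric] set_index_eq_iff[OF assms order.refl[of "{1..n}"]]
    by (auto simp: algebra_simps)
  then have "act n (refl_mat n \<alpha> \<beta> \<gamma>) x S =
     (\<Sum>T\<in>Pow {1..n}. (if T = S then x T else 0) - (if S = {1..n} then refl_coeff n \<alpha> \<beta> \<gamma> (set_index T) * x T else 0))"
    using assms by (auto simp: act_def intro!: sum.cong)
  also have "\<dots> = x S - (if S = {1..n} then \<Sum>T\<in>Pow {1..n}. refl_coeff n \<alpha> \<beta> \<gamma> (set_index T) * x T else 0)"
    unfolding sum_subtractf using assms by simp
  finally show ?thesis .
qed


text \<open>
  The coordinate at \<open>S\<close> of the eigenvector \<open>f\<^sub>I\<close>. In the tensor factor \<open>k\<close> the two eigenvectors are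
  \<open>- e\<^sub>0 / (\<gamma>\<^sub>k - 1)\<close> and \<open>e\<^sub>1 + e\<^sub>0 / (\<gamma>\<^sub>k - 1)\<close>; they are scaled such that their sum is \<open>e\<^sub>1\<close>.
\<close>

definition eigvec :: "nat \<Rightarrow> (nat \<Rightarrow> complex) \<Rightarrow> nat set \<Rightarrow> nat set \<Rightarrow> complex" where
  "eigvec n \<gamma> I S = (\<Prod>k=1..n. if k \<in> S then (if k \<in> I then 1 else 0)
     else (if k \<in> I then 1 else - 1) / (\<gamma> k - 1))"

text \<open>
  The matrix inverse to \<open>eigvec\<close>: \<open>e\<^sub>1\<close> is the sum of the two eigenvectors of a factor and \<open>e\<^sub>0\<close> is
  \<open>1 - \<gamma>\<^sub>k\<close> times the first one.
\<close>

definition coord :: "nat \<Rightarrow> (nat \<Rightarrow> complex) \<Rightarrow> nat set \<Rightarrow> nat set \<Rightarrow> complex" where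
  "coord n \<gamma> I S = (\<Prod>k=1..n. if k \<in> S then 1 else if k \<in> I then 0 else 1 - \<gamma> k)"

lemma coord_eigvec:
  assumes "I \<subseteq> {1..n}" "J \<subseteq> {1..n}" "\<And>k. k \<in> {1..n} \<Longrightarrow> \<gamma> k \<noteq> 1"
  shows "(\<Sum>S\<in>Pow {1..n}. coord n \<gamma> I S * eigvec n \<gamma> J S) = (if I = J then 1 else 0)"
proof -
  have "(\<Sum>S\<in>Pow {1..n}. coord n \<gamma> I S * eigvec n \<gamma> J S) =
    (\<Sum>S\<in>Pow {1..n}. \<Prod>k\<in>{1..n}. if k \<in> S then (if k \<in> J then 1 else 0)
      else (if k \<in> I then 0 else 1 - \<gamma> k) * ((if k \<in> J then 1 else - 1) / (\<gamma> k - 1)))"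
    unfolding coord_def eigvec_def prod.distrib[symmetric] by (intro sum.cong prod.cong refl) simp
  also have "\<dots> = (\<Prod>k\<in>{1..n}. (if k \<in> J then 1 else 0)
      + (if k \<in> I then 0 else 1 - \<gamma> k) * ((if k \<in> J then 1 else - 1) / (\<gamma> k - 1)))"
    by (rule sum_Pow_prod_if) simp
  also have "\<dots> = (\<Prod>k\<in>{1..n}. if (k \<in> I) = (k \<in> J) then 1 else 0)"
    using assms(3) by (intro prod.cong refl) (auto simp: field_simps)
  also have "\<dots> = (if I = J then 1 else 0)" using assms by (intro prod_if_delta) auto
  finally show ?thesis .
qed

lemma eigvec_coord:
  assumes "S \<subseteq> {1..n}" "T \<subseteq> {1..n}" "\<And>k. k \<in> {1..n} \<Longrightarrow> \<gamma> k \<noteq> 1"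
  shows "(\<Sum>I\<in>Pow {1..n}. eigvec n \<gamma> I S * coord n \<gamma> I T) = (if S = T then 1 else 0)"
proof -
  have "(\<Sum>I\<in>Pow {1..n}. eigvec n \<gamma> I S * coord n \<gamma> I T) =
    (\<Sum>I\<in>Pow {1..n}. \<Prod>k\<in>{1..n}. if k \<in> I then (if k \<in> S then 1 else 1 / (\<gamma> k - 1)) * (if k \<in> T then 1 else 0)
      else (if k \<in> S then 0 else - 1 / (\<gamma> k - 1)) * (if k \<in> T then 1 else 1 - \<gamma> k))"
    unfolding coord_def eigvec_def prod.distrib[symmetric] by (intro sum.cong prod.cong refl) simp
  also have "\<dots> = (\<Prod>k\<in>{1..n}. (if k \<in> S then 1 else 1 / (\<gamma> k - 1)) * (if k \<in> T then 1 else 0)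
      + (if k \<in> S then 0 else - 1 / (\<gamma> k - 1)) * (if k \<in> T then 1 else 1 - \<gamma> k))"
    by (rule sum_Pow_prod_if) simp
  also have "\<dots> = (\<Prod>k\<in>{1..n}. if (k \<in> S) = (k \<in> T) then 1 else 0)"
    using assms(3) by (intro prod.cong refl) (auto simp: field_simps)
  also have "\<dots> = (if S = T then 1 else 0)" using assms by (intro prod_if_delta) auto
  finally show ?thesis .
qed

lemma coord_full [simp]: "coord n \<gamma> I {1..n} = 1"
  by (simp add: coord_def)

text \<open>
  The vector whose coordinates in the eigenbasis are \<open>y\<close>; \<open>coords\<close> recovers them.
\<close>

definition embed :: "nat \<Rightarrow> (nat \<Rightarrow> complex) \<Rightarrow> (nat set \<Rightarrow> complex) \<Rightarrow> nat set \<Rightarrow> complex" where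
  "embed n \<gamma> y S = (if S \<subseteq> {1..n} then \<Sum>I\<in>Pow {1..n}. y I * eigvec n \<gamma> I S else 0)"

definition coords :: "nat \<Rightarrow> (nat \<Rightarrow> complex) \<Rightarrow> (nat set \<Rightarrow> complex) \<Rightarrow> nat set \<Rightarrow> complex" where
  "coords n \<gamma> x I = (\<Sum>S\<in>Pow {1..n}. coord n \<gamma> I S * x S)"

lemma coords_embed:
  assumes "I \<subseteq> {1..n}" "\<And>k. k \<in> {1..n} \<Longrightarrow> \<gamma> k \<noteq> 1"
  shows "coords n \<gamma> (embed n \<gamma> y) I = y I"
proof -
  have "coords n \<gamma> (embed n \<gamma> y) I =
      (\<Sum>S\<in>Pow {1..n}. \<Sum>J\<in>Pow {1..n}. y J * (coord n \<gamma> I S * eigvec n \<gamma> J S))"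
    unfolding coords_def embed_def by (intro sum.cong refl) (simp add: sum_distrib_left mult.left_commute)
  also have "\<dots> = (\<Sum>J\<in>Pow {1..n}. y J * (\<Sum>S\<in>Pow {1..n}. coord n \<gamma> I S * eigvec n \<gamma> J S))"
    by (subst sum.swap) (simp add: sum_distrib_left)
  also have "\<dots> = (\<Sum>J\<in>Pow {1..n}. if J = I then y J else 0)"
    using assms by (intro sum.cong refl) (subst coord_eigvec, auto)
  also have "\<dots> = y I" using assms(1) by simp
  finally show ?thesis .
qed

lemma embed_coords:
  assumes "\<And>k. k \<in> {1..n} \<Longrightarrow> \<gamma> k \<noteq> 1"
  shows "embed n \<gamma> (coords n \<gamma> x) S = (if S \<subseteq> {1..n} then x S else 0)"
proof (cases "S \<subseteq> {1..n}")
  case True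
  have "embed n \<gamma> (coords n \<gamma> x) S =
      (\<Sum>I\<in>Pow {1..n}. \<Sum>T\<in>Pow {1..n}. x T * (eigvec n \<gamma> I S * coord n \<gamma> I T))"
    unfolding coords_def embed_def if_P[OF True]
    by (intro sum.cong refl) (simp add: sum_distrib_left sum_distrib_right mult_ac)
  also have "\<dots> = (\<Sum>T\<in>Pow {1..n}. x T * (\<Sum>I\<in>Pow {1..n}. eigvec n \<gamma> I S * coord n \<gamma> I T))"
    by (subst sum.swap) (simp add: sum_distrib_left)
  also have "\<dots> = (\<Sum>T\<in>Pow {1..n}. if T = S then x T else 0)"
    using assms True by (intro sum.cong refl) (subst eigvec_coord, auto)
  also have "\<dots> = x S" using True by simp
  finally show ?thesis using True by simp
qed (simp add: embed_def)

lemma circuit_eigvec: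
  assumes "S \<subseteq> {1..n}" "k \<in> {1..n}" "\<gamma> k \<noteq> 1" "\<gamma> k \<noteq> 0"
  shows "(if k \<in> S then inverse (\<gamma> k) * eigvec n \<gamma> I S
      else eigvec n \<gamma> I S - inverse (\<gamma> k) * eigvec n \<gamma> I (insert k S))
    = (if k \<in> I then inverse (\<gamma> k) else 1) * eigvec n \<gamma> I S"
proof -
  define f where "f S j = (if j \<in> S then (if j \<in> I then 1 else 0)
     else (if j \<in> I then 1 else - 1) / (\<gamma> j - 1))" for S j
  have split: "eigvec n \<gamma> I S = f S k * (\<Prod>j\<in>{1..n} - {k}. f S j)" for S
    unfolding eigvec_def f_def using assms(2) by (subst prod.remove[of _ k]) auto
  have same: "(\<Prod>j\<in>{1..n} - {k}. f (insert k S) j) = (\<Prod>j\<in>{1..n} - {k}. f S j)"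
    by (intro prod.cong refl) (auto simp: f_def)
  have "f S k - inverse (\<gamma> k) * f (insert k S) k = (if k \<in> I then inverse (\<gamma> k) else 1) * f S k" if "k \<notin> S"
    using that assms(3,4) by (auto simp: f_def field_simps)
  then have "f S k * P - inverse (\<gamma> k) * (f (insert k S) k * P) = (if k \<in> I then inverse (\<gamma> k) else 1) * (f S k * P)"
    if "k \<notin> S" for P using that by (metis left_diff_distrib mult.assoc)
  moreover have "f S k = (if k \<in> I then 1 else 0)" if "k \<in> S" using that by (simp add: f_def)
  ultimately show ?thesis unfolding split same by auto
qed

lemma act_circuit_embed:
  assumes "k \<in> {1..n}" "\<gamma> k \<noteq> 1" "\<gamma> k \<noteq> 0"
  shows "act n (circuit_mat n \<gamma> k) (embed n \<gamma> y) = embed n \<gamma> (\<lambda>I. (if k \<in> I then inverse (\<gamma> k) else 1) * y I)"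
proof
  fix S show "act n (circuit_mat n \<gamma> k) (embed n \<gamma> y) S = embed n \<gamma> (\<lambda>I. (if k \<in> I then inverse (\<gamma> k) else 1) * y I) S"
  proof (cases "S \<subseteq> {1..n}")
    case True
    have ins: "insert k S \<subseteq> {1..n}" using True assms(1) by auto
    have "act n (circuit_mat n \<gamma> k) (embed n \<gamma> y) S = (\<Sum>I\<in>Pow {1..n}. y I *
       (if k \<in> S then inverse (\<gamma> k) * eigvec n \<gamma> I S
      else eigvec n \<gamma> I S - inverse (\<gamma> k) * eigvec n \<gamma> I (insert k S)))"
      unfolding act_circuit_mat[OF True assms(1)] embed_def if_P[OF True] if_P[OF ins]
      by (cases "k \<in> S") (simp_all add: sum_distrib_left sum_subtractf right_diff_distrib mult.left_commute)
    also have "\<dots> = embed n \<gamma> (\<lambda>I. (if k \<in> I then inverse (\<gamma> k) else 1) * y I) S"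
      unfolding circuit_eigvec[of S n k \<gamma>, OF True assms] embed_def if_P[OF True]
      by (intro sum.cong refl) (simp only: mult_ac)
    finally show ?thesis .
  qed (simp add: act_def embed_def)
qed

text \<open>
  The numbers \<open>w\<^sub>I\<close>: in the eigenbasis, \<open>M\<^sub>0\<close> subtracts \<open>\<Sum>\<^sub>I w\<^sub>I y\<^sub>I\<close> from all coordinates. The group is irreducible
  exactly if none of them vanishes.
\<close>

definition refl_weight :: "nat \<Rightarrow> complex \<Rightarrow> complex \<Rightarrow> (nat \<Rightarrow> complex) \<Rightarrow> nat set \<Rightarrow> complex" where
  "refl_weight n \<alpha> \<beta> \<gamma> I = (-1) ^ card I * (\<Prod>k=1..n. \<gamma> k / (\<gamma> k - 1)) / (\<alpha> * \<beta>)
     * ((prod \<gamma> I - \<alpha>) * (prod \<gamma> I - \<beta>) / prod \<gamma> I)"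

lemma sum_refl_coeff_eigvec:
  assumes I: "I \<subseteq> {1..n}" and g: "\<And>k. k \<in> {1..n} \<Longrightarrow> \<gamma> k \<noteq> 1" "\<And>k. k \<in> {1..n} \<Longrightarrow> \<gamma> k \<noteq> 0"
    and nz: "\<alpha> \<noteq> 0" "\<beta> \<noteq> 0"
  shows "(\<Sum>S\<in>Pow {1..n}. refl_coeff n \<alpha> \<beta> \<gamma> (set_index S) * eigvec n \<gamma> I S) = refl_weight n \<alpha> \<beta> \<gamma> I"
proof -
  define \<Gamma> where "\<Gamma> = (\<Prod>k=1..n. \<gamma> k)"
  define C where "C = (\<Prod>k=1..n. 1 / (\<gamma> k - 1))"
  define e where "e k S = (if k \<in> S then (if k \<in> I then 1 else 0)
     else (if k \<in> I then 1 else - 1) / (\<gamma> k - 1))" for k S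
  have P: "(\<Prod>k=1..n. (if k \<in> I then f k else h k)) = prod f I * prod h ({1..n} - I)" for f h :: "nat \<Rightarrow> complex"
  proof -
    have "{1..n} \<inter> {k. k \<in> I} = I" "{1..n} \<inter> - {k. k \<in> I} = {1..n} - I" using I by auto
    then show ?thesis by (simp add: prod.If_cases)
  qed
  have sp: "prod f {1..n} = prod f I * prod f ({1..n} - I)" for f :: "nat \<Rightarrow> complex"
    using P[of f f] by simp
  have fI: "finite I" using I finite_subset by blast
  have gI: "prod \<gamma> I \<noteq> 0" using g(2) I fI by (auto simp: prod_zero_iff)
  have cd: "(-1 :: complex) ^ card ({1..n} - I) = (-1) ^ n * (-1) ^ card I"
  proof -
    have "card ({1..n} - I) + card I = n" using I fI card_mono[of "{1..n}" I] by (simp add: card_Diff_subset)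
    then have "(-1 :: complex) ^ n * (-1) ^ card I = (-1) ^ card ({1..n} - I) * ((-1) ^ card I * (-1) ^ card I)"
      by (metis power_add mult.assoc)
    then show ?thesis by (simp flip: power_mult_distrib)
  qed
  \<comment> \<open>the two rank-one products in the coefficients of the reflection: the first has factors \<open>(- \<gamma>\<^sub>k, 1)\<close>\<close>
  have "(\<Sum>S\<in>Pow {1..n}. (\<Prod>k=1..n. if k \<in> S then 1 else - \<gamma> k) * eigvec n \<gamma> I S)
      = (\<Sum>S\<in>Pow {1..n}. \<Prod>k\<in>{1..n}. if k \<in> S then (if k \<in> I then 1 else 0)
         else - \<gamma> k * ((if k \<in> I then 1 else - 1) / (\<gamma> k - 1)))"
    unfolding eigvec_def prod.distrib[symmetric] by (intro sum.cong prod.cong refl) simp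
  also have "\<dots> = (\<Prod>k\<in>{1..n}. (if k \<in> I then 1 else 0) + - \<gamma> k * ((if k \<in> I then 1 else - 1) / (\<gamma> k - 1)))"
    by (rule sum_Pow_prod_if) simp
  also have "\<dots> = (\<Prod>k\<in>{1..n}. (1 / (\<gamma> k - 1)) * (if k \<in> I then - 1 else \<gamma> k))"
    using g by (intro prod.cong refl) (auto simp: field_simps)
  also have "\<dots> = C * ((-1) ^ card I * prod \<gamma> ({1..n} - I))"
    unfolding prod.distrib P C_def by simp
  also have "prod \<gamma> ({1..n} - I) = \<Gamma> / prod \<gamma> I"
    using gI unfolding \<Gamma>_def sp[of \<gamma>] by simp
  finally have 1: "(\<Sum>S\<in>Pow {1..n}. (\<Prod>k=1..n. if k \<in> S then 1 else - \<gamma> k) * eigvec n \<gamma> I S)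
      = C * ((-1) ^ card I * (\<Gamma> / prod \<gamma> I))" .
  \<comment> \<open>the second has equal factors, so only the sum of the eigenvector is needed\<close>
  have "(\<Sum>S\<in>Pow {1..n}. eigvec n \<gamma> I S)
      = (\<Prod>k\<in>{1..n}. (if k \<in> I then 1 else 0) + (if k \<in> I then 1 else - 1) / (\<gamma> k - 1))"
    unfolding eigvec_def by (rule sum_Pow_prod_if) simp
  also have "\<dots> = (\<Prod>k\<in>{1..n}. (1 / (\<gamma> k - 1)) * (if k \<in> I then \<gamma> k else - 1))"
    using g by (intro prod.cong refl) (auto simp: field_simps)
  also have "\<dots> = C * (prod \<gamma> I * (-1) ^ card ({1..n} - I))"
    unfolding prod.distrib P C_def by simp
  finally have 2: "(\<Sum>S\<in>Pow {1..n}. eigvec n \<gamma> I S) = C * (prod \<gamma> I * ((-1) ^ n * (-1) ^ card I))"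
    unfolding cd .
  \<comment> \<open>the correction at the empty set\<close>
  have "eigvec n \<gamma> I {} = (\<Prod>k\<in>{1..n}. (1 / (\<gamma> k - 1)) * (if k \<in> I then 1 else - 1))"
    unfolding eigvec_def by (intro prod.cong refl) auto
  also have "\<dots> = C * (-1) ^ card ({1..n} - I)"
    unfolding prod.distrib P C_def by simp
  finally have 3: "eigvec n \<gamma> I {} = C * ((-1) ^ n * (-1) ^ card I)" unfolding cd .
  have "(\<Sum>S\<in>Pow {1..n}. refl_coeff n \<alpha> \<beta> \<gamma> (set_index S) * eigvec n \<gamma> I S)
     = (\<Sum>S\<in>Pow {1..n}. (\<Prod>k=1..n. if k \<in> S then 1 else - \<gamma> k) * eigvec n \<gamma> I S
         + (-1) ^ n * \<Gamma> / (\<alpha> * \<beta>) * eigvec n \<gamma> I S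
         - (if S = {} then (-1) ^ n * \<Gamma> * (\<alpha> + \<beta>) / (\<alpha> * \<beta>) * eigvec n \<gamma> I S else 0))"
  proof (rule sum.cong[OF refl])
    fix S assume "S \<in> Pow {1..n}"
    then have "S \<subseteq> {1..n}" by simp
    show "refl_coeff n \<alpha> \<beta> \<gamma> (set_index S) * eigvec n \<gamma> I S = (\<Prod>k=1..n. if k \<in> S then 1 else - \<gamma> k) * eigvec n \<gamma> I S
         + (-1) ^ n * \<Gamma> / (\<alpha> * \<beta>) * eigvec n \<gamma> I S
         - (if S = {} then (-1) ^ n * \<Gamma> * (\<alpha> + \<beta>) / (\<alpha> * \<beta>) * eigvec n \<gamma> I S else 0)"
      unfolding refl_coeff_set_index[OF \<open>S \<subseteq> {1..n}\<close> nz] \<Gamma>_def by (simp only: distrib_right left_diff_distrib if_distrib[of "\<lambda>u. u * _"] mult_zero_left)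
  qed
  also have "\<dots> = C * ((-1) ^ card I * (\<Gamma> / prod \<gamma> I))
      + (-1) ^ n * \<Gamma> / (\<alpha> * \<beta>) * (C * (prod \<gamma> I * ((-1) ^ n * (-1) ^ card I)))
      - (-1) ^ n * \<Gamma> * (\<alpha> + \<beta>) / (\<alpha> * \<beta>) * (C * ((-1) ^ n * (-1) ^ card I))"
    unfolding sum.distrib sum_subtractf 1 sum_distrib_left[symmetric] 2 3[symmetric] by (subst sum.delta) auto
  also have "\<dots> = (-1) ^ card I * (C * \<Gamma>) * (1 / prod \<gamma> I
      + ((-1) ^ n * (-1) ^ n) * (prod \<gamma> I / (\<alpha> * \<beta>) - (\<alpha> + \<beta>) / (\<alpha> * \<beta>)))"
    using nz gI by (simp add: field_simps)
  also have "(-1 :: complex) ^ n * (-1) ^ n = 1" by (simp flip: power_mult_distrib)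
  also have "(-1) ^ card I * (C * \<Gamma>) * (1 / prod \<gamma> I + 1 * (prod \<gamma> I / (\<alpha> * \<beta>) - (\<alpha> + \<beta>) / (\<alpha> * \<beta>)))
     = (-1) ^ card I * (C * \<Gamma>) / (\<alpha> * \<beta>) * ((prod \<gamma> I - \<alpha>) * (prod \<gamma> I - \<beta>) / prod \<gamma> I)"
    using nz gI by (simp add: field_simps)
  also have "C * \<Gamma> = (\<Prod>k=1..n. \<gamma> k / (\<gamma> k - 1))"
    unfolding C_def \<Gamma>_def prod.distrib[symmetric] by simp
  finally show ?thesis unfolding refl_weight_def .
qed

text \<open>
  All coordinates of \<open>e\<^sub>(\<^sub>1\<^sub>,\<^sub>\<dots>\<^sub>,\<^sub>1\<^sub>)\<close> in the eigenbasis are \<open>1\<close>, by \<open>coord_full\<close>.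
\<close>

lemma act_refl_embed:
  assumes g: "\<And>k. k \<in> {1..n} \<Longrightarrow> \<gamma> k \<noteq> 1" "\<And>k. k \<in> {1..n} \<Longrightarrow> \<gamma> k \<noteq> 0"
    and nz: "\<alpha> \<noteq> 0" "\<beta> \<noteq> 0"
  shows "act n (refl_mat n \<alpha> \<beta> \<gamma>) (embed n \<gamma> y) =
    embed n \<gamma> (\<lambda>I. y I - (\<Sum>J\<in>Pow {1..n}. refl_weight n \<alpha> \<beta> \<gamma> J * y J))"
proof
  fix S
  let ?s = "\<Sum>J\<in>Pow {1..n}. refl_weight n \<alpha> \<beta> \<gamma> J * y J"
  show "act n (refl_mat n \<alpha> \<beta> \<gamma>) (embed n \<gamma> y) S = embed n \<gamma> (\<lambda>I. y I - ?s) S"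
  proof (cases "S \<subseteq> {1..n}")
    case True
    have "(\<Sum>T\<in>Pow {1..n}. refl_coeff n \<alpha> \<beta> \<gamma> (set_index T) * embed n \<gamma> y T)
        = (\<Sum>T\<in>Pow {1..n}. \<Sum>J\<in>Pow {1..n}. y J * (refl_coeff n \<alpha> \<beta> \<gamma> (set_index T) * eigvec n \<gamma> J T))"
      unfolding embed_def by (intro sum.cong refl) (simp add: sum_distrib_left mult.left_commute)
    also have "\<dots> = (\<Sum>J\<in>Pow {1..n}. y J * (\<Sum>T\<in>Pow {1..n}. refl_coeff n \<alpha> \<beta> \<gamma> (set_index T) * eigvec n \<gamma> J T))"
      by (subst sum.swap) (simp add: sum_distrib_left)
    also have "\<dots> = ?s"
      using sum_refl_coeff_eigvec[OF _ g nz] by (intro sum.cong refl) (simp add: mult.commute)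
    finally have 1: "(\<Sum>T\<in>Pow {1..n}. refl_coeff n \<alpha> \<beta> \<gamma> (set_index T) * embed n \<gamma> y T) = ?s" .
    have "(\<Sum>I\<in>Pow {1..n}. eigvec n \<gamma> I S * coord n \<gamma> I {1..n}) = (if S = {1..n} then 1 else 0)"
      using True g by (intro eigvec_coord) auto
    then have 2: "(\<Sum>I\<in>Pow {1..n}. eigvec n \<gamma> I S) = (if S = {1..n} then 1 else 0)" by (simp only: coord_full mult_1_right)
    have "embed n \<gamma> (\<lambda>I. y I - ?s) S = embed n \<gamma> y S - ?s * (\<Sum>I\<in>Pow {1..n}. eigvec n \<gamma> I S)"
      unfolding embed_def if_P[OF True] left_diff_distrib sum_subtractf sum_distrib_left ..
    then show ?thesis unfolding act_refl_mat[OF True] 1 2 by simp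
  qed (simp add: act_def embed_def)
qed

section \<open>Words in the generators and the orders of the eigenvalues\<close>

lemma GL_simps:
  "x \<otimes>\<^bsub>GL N\<^esub> y = x * y" "\<one>\<^bsub>GL N\<^esub> = 1\<^sub>m N"
  by (simp_all add: GL_def units_of_def ring_mat_def)

lemma GL_carrier: "x \<in> carrier (GL N) \<Longrightarrow> x \<in> carrier_mat N N"
  by (simp add: GL_def units_of_carrier Units_def ring_mat_def)

definition generator :: "nat \<Rightarrow> complex \<Rightarrow> complex \<Rightarrow> (nat \<Rightarrow> complex) \<Rightarrow> nat \<Rightarrow> complex mat" where
  "generator n \<alpha> \<beta> \<gamma> k = (if k = 0 then refl_mat n \<alpha> \<beta> \<gamma> else circuit_mat n \<gamma> k)"

text \<open>
  Unlike a group element, a word can be evaluated at different parameters. Words without inverses suffice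
  by \<open>Mon_eq_words\<close>.
\<close>

primrec word_mat :: "nat \<Rightarrow> complex \<Rightarrow> complex \<Rightarrow> (nat \<Rightarrow> complex) \<Rightarrow> nat list \<Rightarrow> complex mat" where
  "word_mat n \<alpha> \<beta> \<gamma> [] = 1\<^sub>m (2 ^ n)"
| "word_mat n \<alpha> \<beta> \<gamma> (k # ks) = generator n \<alpha> \<beta> \<gamma> k * word_mat n \<alpha> \<beta> \<gamma> ks"

definition word_mats :: "nat \<Rightarrow> complex \<Rightarrow> complex \<Rightarrow> (nat \<Rightarrow> complex) \<Rightarrow> complex mat set" where
  "word_mats n \<alpha> \<beta> \<gamma> = word_mat n \<alpha> \<beta> \<gamma> ` {ks. set ks \<subseteq> {0..n}}"

lemma generator_carrier [simp]: "generator n \<alpha> \<beta> \<gamma> k \<in> carrier_mat (2 ^ n) (2 ^ n)"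
  by (simp add: generator_def)

lemma word_mat_carrier [simp]: "word_mat n \<alpha> \<beta> \<gamma> ks \<in> carrier_mat (2 ^ n) (2 ^ n)"
  by (induction ks) (auto intro: mult_carrier_mat[OF generator_carrier])

lemma word_mat_append:
  "word_mat n \<alpha> \<beta> \<gamma> (ks @ ls) = word_mat n \<alpha> \<beta> \<gamma> ks * word_mat n \<alpha> \<beta> \<gamma> ls"
proof (induction ks)
  case Nil
  then show ?case using left_mult_one_mat[OF word_mat_carrier[of n \<alpha> \<beta> \<gamma> ls]] by simp
next
  case (Cons k ks)
  then show ?case
    by (simp add: assoc_mult_mat[OF generator_carrier word_mat_carrier word_mat_carrier])
qed

lemma generator_in_Mon: "k \<le> n \<Longrightarrow> generator n \<alpha> \<beta> \<gamma> k \<in> Mon n \<alpha> \<beta> \<gamma>"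
  unfolding Mon_def generator_def by (intro generate.incl) auto

lemma Mon_mult: "g \<in> Mon n \<alpha> \<beta> \<gamma> \<Longrightarrow> h \<in> Mon n \<alpha> \<beta> \<gamma> \<Longrightarrow> g * h \<in> Mon n \<alpha> \<beta> \<gamma>"
  unfolding Mon_def using generate.eng[of g "GL (2 ^ n)" _ h] by (simp add: GL_simps)

lemma Mon_one: "1\<^sub>m (2 ^ n) \<in> Mon n \<alpha> \<beta> \<gamma>"
  unfolding Mon_def using generate.one[of "GL (2 ^ n)"] by (simp add: GL_simps)

lemma word_mat_in_Mon: "set ks \<subseteq> {0..n} \<Longrightarrow> word_mat n \<alpha> \<beta> \<gamma> ks \<in> Mon n \<alpha> \<beta> \<gamma>"
  by (induction ks) (auto intro: Mon_mult Mon_one generator_in_Mon)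

locale nonzero_params =
  fixes n :: nat and \<alpha> \<beta> :: complex and \<gamma> :: "nat \<Rightarrow> complex"
  assumes n: "n > 0" and nz: "\<alpha> \<noteq> 0" "\<beta> \<noteq> 0" and gnz: "\<And>k. k \<in> {1..n} \<Longrightarrow> \<gamma> k \<noteq> 0"
begin

abbreviation "G \<equiv> Mon n \<alpha> \<beta> \<gamma>"

lemma subgroup_G: "subgroup G (GL (2 ^ n))"
  using Mon_subgroup[of \<alpha> \<beta> n \<gamma>] n nz gnz by auto

lemma G_GL: "g \<in> G \<Longrightarrow> g \<in> carrier (GL (2 ^ n))"
  using subgroup.subset[OF subgroup_G] by blast

lemma G_carrier: "g \<in> G \<Longrightarrow> g \<in> carrier_mat (2 ^ n) (2 ^ n)"
  using G_GL GL_carrier by blast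

text \<open>
  A finite set of invertible matrices that is closed under multiplication contains the inverses:
  multiplication by one of its elements permutes it.
\<close>

lemma Mon_eq_words:
  assumes fin: "finite (word_mats n \<alpha> \<beta> \<gamma>)"
  shows "G = word_mats n \<alpha> \<beta> \<gamma>"
proof -
  interpret grp: Group.group "GL (2 ^ n)" by (rule GL_group)
  let ?W = "word_mats n \<alpha> \<beta> \<gamma>"
  have WG: "?W \<subseteq> G" unfolding word_mats_def using word_mat_in_Mon by auto
  have W1: "1\<^sub>m (2 ^ n) \<in> ?W" unfolding word_mats_def by (intro image_eqI[of _ _ "[]"]) auto
  have Wm: "g * h \<in> ?W" if gh: "g \<in> ?W" "h \<in> ?W" for g h
  proof -
    obtain ks ls where "set ks \<subseteq> {0..n}" "set ls \<subseteq> {0..n}" "g = word_mat n \<alpha> \<beta> \<gamma> ks" "h = word_mat n \<alpha> \<beta> \<gamma> ls"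
      using gh unfolding word_mats_def by blast
    then show ?thesis unfolding word_mats_def
      by (intro image_eqI[of _ _ "ks @ ls"]) (auto simp: word_mat_append)
  qed
  have Winv: "inv\<^bsub>GL (2 ^ n)\<^esub> g \<in> ?W" if g: "g \<in> ?W" for g
  proof -
    have gc: "g \<in> carrier (GL (2 ^ n))" using g WG G_GL by blast
    have "inj_on (\<lambda>h. g * h) ?W"
    proof (rule inj_onI)
      fix x y assume xy: "x \<in> ?W" "y \<in> ?W" "g * x = g * y"
      then have c: "x \<in> carrier (GL (2 ^ n))" "y \<in> carrier (GL (2 ^ n))" using WG G_GL by auto
      have "z = inv\<^bsub>GL (2 ^ n)\<^esub> g \<otimes>\<^bsub>GL (2 ^ n)\<^esub> (g \<otimes>\<^bsub>GL (2 ^ n)\<^esub> z)" if "z \<in> carrier (GL (2 ^ n))" for z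
        using that gc by (simp flip: grp.m_assoc)
      then show "x = y" using c xy(3) by (metis GL_simps(1))
    qed
    then have "(\<lambda>h. g * h) ` ?W = ?W" using fin Wm[OF g] by (intro endo_inj_surj) auto
    then obtain h where h: "h \<in> ?W" "g * h = 1\<^sub>m (2 ^ n)" using W1 by (metis imageE)
    have "inv\<^bsub>GL (2 ^ n)\<^esub> g = h"
      using grp.inv_equality[of h g] grp.inv_comm[of g h] h gc WG G_GL by (auto simp: GL_simps)
    then show ?thesis using h(1) by simp
  qed
  have gen: "generator n \<alpha> \<beta> \<gamma> k \<in> ?W" if "k \<le> n" for k
    unfolding word_mats_def using that right_mult_one_mat[OF generator_carrier[of n \<alpha> \<beta> \<gamma> k]]
    by (intro image_eqI[of _ _ "[k]"]) auto
  have gens: "g \<in> ?W" if "g \<in> insert (refl_mat n \<alpha> \<beta> \<gamma>) (circuit_mat n \<gamma> ` {1..n})" for g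
  proof -
    have "circuit_mat n \<gamma> k \<in> ?W" if "k \<in> {1..n}" for k
      using gen[of k] that by (simp add: generator_def)
    moreover have "refl_mat n \<alpha> \<beta> \<gamma> \<in> ?W" using gen[of 0] by (simp add: generator_def)
    ultimately show ?thesis using that by blast
  qed
  have "G \<subseteq> ?W"
  proof
    fix g assume "g \<in> G"
    then show "g \<in> ?W" unfolding Mon_def
    proof induction
      case one
      then show ?case using W1 by (simp add: GL_simps)
    next
      case (incl h)
      then show ?case by (rule gens)
    next
      case (inv h)
      then show ?case using gens Winv by blast
    next
      case (eng h1 h2)
      then show ?case using Wm by (simp add: GL_simps)
    qed
  qed
  then show ?thesis using WG by blast
qed

lemma finite_words_if_finite_Mon: "finite G \<Longrightarrow> finite (word_mats n \<alpha> \<beta> \<gamma>)"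
  by (rule finite_subset[of _ G]) (auto simp: word_mats_def intro!: word_mat_in_Mon)

lemma refl_mat_in_G: "refl_mat n \<alpha> \<beta> \<gamma> \<in> G"
  using generator_in_Mon[of 0 n \<alpha> \<beta> \<gamma>] by (simp add: generator_def)

lemma circuit_mat_in_G: "k \<in> {1..n} \<Longrightarrow> circuit_mat n \<gamma> k \<in> G"
  using generator_in_Mon[of k n \<alpha> \<beta> \<gamma>] by (simp add: generator_def)

lemma act_G_mult: "g \<in> G \<Longrightarrow> h \<in> G \<Longrightarrow> act n (g * h) x = act n g (act n h x)"
  using act_mult G_carrier by blast

lemma finite_orbit:
  assumes "finite G"
  shows "finite ((\<lambda>g. act n g x) ` G)"
  using assms by simp

text \<open>
  For \<open>\<gamma>\<^sub>k = 1\<close> the matrix \<open>M\<^sub>k\<close> is unipotent and different from the identity, so the orbit of \<open>e\<^sub>{\<^sub>k\<^sub>}\<close> is infinite.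
\<close>

lemma gamma_neq_1_if_finite:
  assumes fin: "finite G" and k: "k \<in> {1..n}"
  shows "\<gamma> k \<noteq> 1"
proof
  assume g1: "\<gamma> k = 1"
  define v where "v m S = (if S = {k} then 1 else if S = {} then - of_nat m else 0 :: complex)" for m :: nat and S :: "nat set"
  have v0: "act n (1\<^sub>m (2 ^ n)) (v 0) = v 0"
  proof
    fix S show "act n (1\<^sub>m (2 ^ n)) (v 0) S = v 0 S" using k by (auto simp: act_one v_def)
  qed
  have step: "act n (circuit_mat n \<gamma> k) (v m) = v (Suc m)" for m
  proof
    fix S show "act n (circuit_mat n \<gamma> k) (v m) S = v (Suc m) S"
    proof (cases "S \<subseteq> {1..n}")
      case True
      then show ?thesis using k by (auto simp: act_circuit_mat g1 v_def)
    next
      case False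
      then show ?thesis using k by (auto simp: act_def v_def)
    qed
  qed
  have "v m \<in> (\<lambda>g. act n g (v 0)) ` G" for m
  proof (induction m)
    case 0
    then show ?case using v0 Mon_one by (intro image_eqI[of _ _ "1\<^sub>m (2 ^ n)"]) auto
  next
    case (Suc m)
    then obtain g where g: "g \<in> G" "v m = act n g (v 0)" by blast
    then have "v (Suc m) = act n (circuit_mat n \<gamma> k * g) (v 0)"
      using step[of m] act_G_mult[OF circuit_mat_in_G[OF k] g(1)] by simp
    then show ?case using Mon_mult[OF circuit_mat_in_G[OF k] g(1)] by blast
  qed
  then have "finite (range v)" by (intro finite_subset[OF _ finite_orbit[OF fin, of "v 0"]]) auto
  moreover have "inj v"
  proof (rule injI)
    fix i j assume "v i = v j"
    then have "v i {} = v j {}" by simp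
    then show "i = j" by (simp add: v_def)
  qed
  ultimately show False using finite_imageD by blast
qed

lemma eigenvalue_root_of_unity:
  assumes fin: "finite G" and g: "g \<in> G" and ev: "act n g v = (\<lambda>S. l * v S)" "v S \<noteq> 0" and l: "l \<noteq> 0"
  shows "\<exists>m>0. l ^ m = 1"
proof -
  have supp: "v S = 0" if "\<not> S \<subseteq> {1..n}" for S
    using fun_cong[OF ev(1), of S] that l by (simp add: act_def)
  have lin: "act n g (\<lambda>S. c * v S) = (\<lambda>S. c * (l * v S))" for c
  proof
    fix S have "act n g (\<lambda>S. c * v S) S = c * act n g v S"
      by (simp add: act_def sum_distrib_left mult.left_commute)
    then show "act n g (\<lambda>S. c * v S) S = c * (l * v S)" by (simp add: ev(1))
  qed
  have "(\<lambda>S. l ^ m * v S) \<in> (\<lambda>g. act n g v) ` G" for m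
  proof (induction m)
    case 0
    have "act n (1\<^sub>m (2 ^ n)) v = v" using supp by (auto simp: act_one)
    then show ?case using Mon_one by (intro image_eqI[of _ _ "1\<^sub>m (2 ^ n)"]) auto
  next
    case (Suc m)
    then obtain h where h: "h \<in> G" "(\<lambda>S. l ^ m * v S) = act n h v" by blast
    have "act n (g * h) v = (\<lambda>S. l ^ Suc m * v S)"
      unfolding act_G_mult[OF g h(1)] h(2)[symmetric] lin by (simp add: mult_ac)
    then show ?case using Mon_mult[OF g h(1)] by (intro image_eqI[of _ _ "g * h"]) auto
  qed
  then have "finite (range (\<lambda>m S. l ^ m * v S))"
    by (intro finite_subset[OF _ finite_orbit[OF fin, of v]]) auto
  then have "\<not> inj (\<lambda>m S. l ^ m * v S)" using finite_imageD by blast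
  then obtain i j where ij: "i \<noteq> j" "(\<lambda>S. l ^ i * v S) = (\<lambda>S. l ^ j * v S)" by (auto simp: inj_def)
  from fun_cong[OF ij(2), of S] ev(2) have e: "l ^ i = l ^ j" by simp
  define p q where "p = min i j" and "q = max i j"
  have pq: "p < q" "l ^ p = l ^ q" using ij(1) e by (auto simp: p_def q_def min_def max_def)
  have "l ^ (q - p) = 1" using pq l by (simp add: power_diff)
  then show ?thesis using pq(1) by (intro exI[of _ "q - p"]) simp
qed

lemma gamma_root_of_unity:
  assumes fin: "finite G" and k: "k \<in> {1..n}"
  shows "\<exists>m>0. \<gamma> k ^ m = 1"
proof -
  let ?y = "\<lambda>I. if I = {k} then 1 else 0 :: complex"
  have "act n (circuit_mat n \<gamma> k) (embed n \<gamma> ?y) = embed n \<gamma> (\<lambda>I. inverse (\<gamma> k) * ?y I)"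
    unfolding act_circuit_embed[of k n \<gamma>, OF k gamma_neq_1_if_finite[OF fin k] gnz[OF k]]
    by (intro arg_cong[of _ _ "embed n \<gamma>"] ext) auto
  also have "\<dots> = (\<lambda>S. inverse (\<gamma> k) * embed n \<gamma> ?y S)"
    by (auto simp: embed_def sum_distrib_left mult.assoc)
  finally have ev: "act n (circuit_mat n \<gamma> k) (embed n \<gamma> ?y) = (\<lambda>S. inverse (\<gamma> k) * embed n \<gamma> ?y S)" .
  have "\<exists>S. embed n \<gamma> ?y S \<noteq> 0"
  proof (rule ccontr)
    assume "\<nexists>S. embed n \<gamma> ?y S \<noteq> 0"
    then have "coords n \<gamma> (embed n \<gamma> ?y) {k} = 0" by (simp add: coords_def)
    then show False using coords_embed[of "{k}" n \<gamma> ?y] k gamma_neq_1_if_finite[OF fin] by simp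
  qed
  then obtain S where "embed n \<gamma> ?y S \<noteq> 0" by blast
  from eigenvalue_root_of_unity[OF fin circuit_mat_in_G[OF k] ev this] gnz[OF k]
  obtain m where "m > 0" "inverse (\<gamma> k) ^ m = 1" by auto
  then show ?thesis by (intro exI[of _ m]) (simp add: power_inverse)
qed


section \<open>The invariant Hermitian form of a finite monodromy group\<close>

definition delta_fun :: "nat set \<Rightarrow> nat set \<Rightarrow> complex" where
  "delta_fun I J = (if J = I then 1 else 0)"

text \<open>
  The standard Hermitian form averaged over the group, in coordinates of the eigenbasis.
\<close>

definition herm :: "(nat set \<Rightarrow> complex) \<Rightarrow> (nat set \<Rightarrow> complex) \<Rightarrow> complex" where
  "herm y z = (\<Sum>g\<in>G. \<Sum>S\<in>Pow {1..n}. act n g (embed n \<gamma> y) S * cnj (act n g (embed n \<gamma> z) S))"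

lemma herm_invariant:
  assumes fin: "finite G" and h: "h \<in> G"
    and y: "act n h (embed n \<gamma> y) = embed n \<gamma> y'" and z: "act n h (embed n \<gamma> z) = embed n \<gamma> z'"
  shows "herm y' z' = herm y z"
proof -
  interpret grp: Group.group "GL (2 ^ n)" by (rule GL_group)
  have hc: "h \<in> carrier (GL (2 ^ n))" using h G_GL by blast
  have "inj_on (\<lambda>g. g * h) G"
  proof (rule inj_onI)
    fix a b assume ab: "a \<in> G" "b \<in> G" "a * h = b * h"
    then have c: "a \<in> carrier (GL (2 ^ n))" "b \<in> carrier (GL (2 ^ n))" using G_GL by auto
    have "u = (u \<otimes>\<^bsub>GL (2 ^ n)\<^esub> h) \<otimes>\<^bsub>GL (2 ^ n)\<^esub> inv\<^bsub>GL (2 ^ n)\<^esub> h" if "u \<in> carrier (GL (2 ^ n))" for u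
      using that hc by (simp add: grp.m_assoc)
    then show "a = b" using c ab(3) by (metis GL_simps(1))
  qed
  moreover have "(\<lambda>g. g * h) ` G \<subseteq> G" using Mon_mult h by blast
  ultimately have bij: "bij_betw (\<lambda>g. g * h) G G" using fin by (simp add: bij_betw_def endo_inj_surj)
  have "herm y' z' = (\<Sum>g\<in>G. \<Sum>S\<in>Pow {1..n}. act n (g * h) (embed n \<gamma> y) S * cnj (act n (g * h) (embed n \<gamma> z) S))"
    unfolding herm_def y[symmetric] z[symmetric] using act_G_mult[OF _ h] by simp
  also have "\<dots> = herm y z"
    unfolding herm_def
    by (rule sum.reindex_bij_betw[OF bij, of "\<lambda>g. \<Sum>S\<in>Pow {1..n}. act n g (embed n \<gamma> y) S * cnj (act n g (embed n \<gamma> z) S)"])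
  finally show ?thesis .
qed

lemma act_embed_expand:
  "act n g (embed n \<gamma> y) S = (\<Sum>I\<in>Pow {1..n}. y I * act n g (embed n \<gamma> (delta_fun I)) S)"
proof (cases "S \<subseteq> {1..n}")
  case True
  have e: "embed n \<gamma> y T = (\<Sum>I\<in>Pow {1..n}. y I * embed n \<gamma> (delta_fun I) T)" for y T
  proof -
    have "embed n \<gamma> (delta_fun I) T = (if T \<subseteq> {1..n} then eigvec n \<gamma> I T else 0)" if "I \<subseteq> {1..n}" for I
      using that by (simp add: embed_def delta_fun_def if_distrib[of "\<lambda>u. u * _"] cong: if_cong)
    then show ?thesis by (simp add: embed_def)
  qed
  have "act n g (embed n \<gamma> y) S = (\<Sum>T\<in>Pow {1..n}. \<Sum>I\<in>Pow {1..n}. y I * (g $$ (set_index S, set_index T) * embed n \<gamma> (delta_fun I) T))"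
    unfolding act_def if_P[OF True] by (subst e) (simp add: sum_distrib_left mult.left_commute)
  also have "\<dots> = (\<Sum>I\<in>Pow {1..n}. y I * act n g (embed n \<gamma> (delta_fun I)) S)"
    unfolding act_def if_P[OF True] by (subst sum.swap) (simp add: sum_distrib_left)
  finally show ?thesis .
qed (simp add: act_def)

lemma herm_expand:
  "herm y z = (\<Sum>I\<in>Pow {1..n}. \<Sum>J\<in>Pow {1..n}. y I * cnj (z J) * herm (delta_fun I) (delta_fun J))"
proof -
  let ?F = "\<lambda>g I S. act n g (embed n \<gamma> (delta_fun I)) S"
  have "act n g (embed n \<gamma> y) S * cnj (act n g (embed n \<gamma> z) S)
      = (\<Sum>I\<in>Pow {1..n}. \<Sum>J\<in>Pow {1..n}. (y I * cnj (z J)) * (?F g I S * cnj (?F g J S)))" for g S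
    unfolding act_embed_expand[of g y] act_embed_expand[of g z] cnj_sum sum_product
    by (intro sum.cong refl) simp
  then have "herm y z = (\<Sum>g\<in>G. \<Sum>S\<in>Pow {1..n}. \<Sum>I\<in>Pow {1..n}. \<Sum>J\<in>Pow {1..n}. (y I * cnj (z J)) * (?F g I S * cnj (?F g J S)))"
    unfolding herm_def by simp
  also have "\<dots> = (\<Sum>g\<in>G. \<Sum>I\<in>Pow {1..n}. \<Sum>S\<in>Pow {1..n}. \<Sum>J\<in>Pow {1..n}. (y I * cnj (z J)) * (?F g I S * cnj (?F g J S)))"
    by (rule sum.cong[OF refl], rule sum.swap)
  also have "\<dots> = (\<Sum>g\<in>G. \<Sum>I\<in>Pow {1..n}. \<Sum>J\<in>Pow {1..n}. \<Sum>S\<in>Pow {1..n}. (y I * cnj (z J)) * (?F g I S * cnj (?F g J S)))"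
    by (rule sum.cong[OF refl], rule sum.cong[OF refl], rule sum.swap)
  also have "\<dots> = (\<Sum>I\<in>Pow {1..n}. \<Sum>g\<in>G. \<Sum>J\<in>Pow {1..n}. \<Sum>S\<in>Pow {1..n}. (y I * cnj (z J)) * (?F g I S * cnj (?F g J S)))"
    by (rule sum.swap)
  also have "\<dots> = (\<Sum>I\<in>Pow {1..n}. \<Sum>J\<in>Pow {1..n}. \<Sum>g\<in>G. \<Sum>S\<in>Pow {1..n}. (y I * cnj (z J)) * (?F g I S * cnj (?F g J S)))"
    by (rule sum.cong[OF refl], rule sum.swap)
  also have "\<dots> = (\<Sum>I\<in>Pow {1..n}. \<Sum>J\<in>Pow {1..n}. y I * cnj (z J) * herm (delta_fun I) (delta_fun J))"
    unfolding herm_def sum_distrib_left ..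
  finally show ?thesis .
qed

lemma herm_delta_pos:
  assumes fin: "finite G" and I: "I \<subseteq> {1..n}"
  shows "\<exists>r>0. herm (delta_fun I) (delta_fun I) = of_real r"
proof -
  let ?x = "embed n \<gamma> (delta_fun I)"
  let ?r = "\<Sum>g\<in>G. \<Sum>S\<in>Pow {1..n}. (norm (act n g ?x S))\<^sup>2"
  have "herm (delta_fun I) (delta_fun I) = of_real ?r"
    by (simp add: herm_def flip: complex_norm_square)
  moreover have "?r > 0"
  proof -
    obtain S where S: "S \<subseteq> {1..n}" "?x S \<noteq> 0"
    proof (rule ccontr)
      assume "\<not> thesis"
      then have "?x S = 0" if "S \<subseteq> {1..n}" for S using that \<open>\<And>S. S \<subseteq> {1..n} \<Longrightarrow> ?x S \<noteq> 0 \<Longrightarrow> thesis\<close> by blast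
      then have "coords n \<gamma> ?x I = 0" by (simp add: coords_def)
      then show False using coords_embed[OF I, of \<gamma> "delta_fun I"] gamma_neq_1_if_finite[OF fin] by (simp add: delta_fun_def)
    qed
    have "(0 :: real) < (norm (?x S))\<^sup>2" using S(2) by simp
    also have "\<dots> = (norm (act n (1\<^sub>m (2 ^ n)) ?x S))\<^sup>2" using S(1) by (simp add: act_one)
    also have "\<dots> \<le> (\<Sum>S\<in>Pow {1..n}. (norm (act n (1\<^sub>m (2 ^ n)) ?x S))\<^sup>2)"
      using S(1) by (intro member_le_sum) auto
    also have "\<dots> \<le> ?r"
      using fin Mon_one by (intro member_le_sum[where f = "\<lambda>g. \<Sum>S\<in>Pow {1..n}. (norm (act n g ?x S))\<^sup>2"] sum_nonneg) auto
    finally show ?thesis .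
  qed
  ultimately show ?thesis by blast
qed

text \<open>
  Different subsets \<open>I\<close> and \<open>J\<close> are separated by some \<open>M\<^sub>k\<close>, so \<open>f\<^sub>I\<close> and \<open>f\<^sub>J\<close> are orthogonal. The special vector
  \<open>u = \<Sum>\<^sub>I f\<^sub>I\<close> is an eigenvector of \<open>M\<^sub>0\<close> with eigenvalue \<open>\<delta> = 1 - \<Sum>\<^sub>I w\<^sub>I\<close>, and \<open>\<delta>\<close> has absolute value \<open>1\<close>. With \<open>h\<^sub>I\<close> the
  norm of \<open>f\<^sub>I\<close> and \<open>s\<close> that of \<open>u\<close>, invariance of the product of \<open>f\<^sub>I\<close> and \<open>u\<close> under \<open>M\<^sub>0\<close> reads \<open>(1 - \<delta>) h\<^sub>I = w\<^sub>I s\<close>.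
  Comparing with \<open>I = {}\<close> eliminates \<open>\<delta>\<close> and \<open>s\<close>.
\<close>

theorem refl_weight_ratio_pos:
  assumes fin: "finite G" and w0: "refl_weight n \<alpha> \<beta> \<gamma> {} \<noteq> 0" and I: "I \<subseteq> {1..n}"
  shows "\<exists>r>0. refl_weight n \<alpha> \<beta> \<gamma> I = of_real r * refl_weight n \<alpha> \<beta> \<gamma> {}"
proof -
  note g1 = gamma_neq_1_if_finite[OF fin]
  define w where "w = refl_weight n \<alpha> \<beta> \<gamma>"
  define h where "h I J = herm (delta_fun I) (delta_fun J)" for I J
  define d where "d k I = (if k \<in> I then inverse (\<gamma> k) else 1)" for k I
  have circ: "herm (\<lambda>I. d k I * y I) (\<lambda>I. d k I * z I) = herm y z" if k: "k \<in> {1..n}" for k y z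
    unfolding d_def using circuit_mat_in_G[OF k] act_circuit_embed[of k n \<gamma>, OF k g1[OF k] gnz[OF k]]
    by (intro herm_invariant[OF fin]) auto
  have hd: "d k I * cnj (d k J) * h I J = h I J" if k: "k \<in> {1..n}" and IJ: "I \<subseteq> {1..n}" "J \<subseteq> {1..n}" for k I J
  proof -
    have "herm (\<lambda>S. d k S * delta_fun I S) (\<lambda>S. d k S * delta_fun J S) = d k I * cnj (d k J) * h I J"
    proof -
      have e: "(\<lambda>S. d k S * delta_fun U S) = (\<lambda>S. d k U * delta_fun U S)" for U by (auto simp: delta_fun_def)
      have "(\<Sum>U\<in>Pow {1..n}. \<Sum>V\<in>Pow {1..n}. d k I * delta_fun I U * cnj (d k J * delta_fun J V) * h U V)
         = (\<Sum>U\<in>Pow {1..n}. \<Sum>V\<in>Pow {1..n}. if U = I then if V = J then d k I * cnj (d k J) * h I J else 0 else 0)"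
        by (intro sum.cong refl) (auto simp: delta_fun_def)
      also have "\<dots> = d k I * cnj (d k J) * h I J" using IJ by (subst sum.swap) (simp add: if_distrib[of "sum _"] sum.delta)
      finally show ?thesis unfolding e herm_expand[of "\<lambda>S. d k I * _ S"] h_def[symmetric] .
    qed
    then show ?thesis using circ[OF k, of "delta_fun I" "delta_fun J"] by (simp add: h_def)
  qed
  have pos: "\<exists>r>0. h I I = of_real r" if "I \<subseteq> {1..n}" for I
    unfolding h_def using herm_delta_pos[OF fin that] .
  have gn: "\<gamma> k * cnj (\<gamma> k) = 1" if k: "k \<in> {1..n}" for k
  proof -
    have "inverse (\<gamma> k) * cnj (inverse (\<gamma> k)) * h {k} {k} = h {k} {k}"
      using hd[OF k, of "{k}" "{k}"] k by (simp add: d_def)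
    moreover have "h {k} {k} \<noteq> 0" using pos[of "{k}"] k by auto
    ultimately have "inverse (\<gamma> k) * cnj (inverse (\<gamma> k)) = 1" by simp
    then show ?thesis using gnz[OF k] by (simp add: field_simps)
  qed
  have orth: "h I J = 0" if IJ: "I \<subseteq> {1..n}" "J \<subseteq> {1..n}" "I \<noteq> J" for I J
  proof -
    obtain k where k: "(k \<in> I) \<noteq> (k \<in> J)" using IJ(3) by blast
    then have kn: "k \<in> {1..n}" using IJ by auto
    have "d k I * cnj (d k J) \<noteq> 1"
    proof (cases "k \<in> I")
      case True
      then show ?thesis using k g1[OF kn] by (auto simp: d_def)
    next
      case False
      then show ?thesis using k g1[OF kn] by (simp add: d_def)
    qed
    then show ?thesis using hd[OF kn IJ(1,2)] by (metis mult_cancel_right1)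
  qed
  define s where "s = (\<Sum>I\<in>Pow {1..n}. h I I)"
  define \<delta> where "\<delta> = 1 - (\<Sum>I\<in>Pow {1..n}. w I)"
  have diag: "herm y z = (\<Sum>I\<in>Pow {1..n}. y I * cnj (z I) * h I I)" for y z
  proof -
    have "herm y z = (\<Sum>I\<in>Pow {1..n}. \<Sum>J\<in>Pow {1..n}. y I * cnj (z J) * h I J)"
      unfolding h_def by (rule herm_expand)
    also have "\<dots> = (\<Sum>I\<in>Pow {1..n}. \<Sum>J\<in>Pow {1..n}. if J = I then y I * cnj (z I) * h I I else 0)"
      using orth by (intro sum.cong refl) auto
    finally show ?thesis by simp
  qed
  have refl: "herm (\<lambda>I. y I - (\<Sum>J\<in>Pow {1..n}. w J * y J)) (\<lambda>I. z I - (\<Sum>J\<in>Pow {1..n}. w J * z J)) = herm y z" for y z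
    unfolding w_def using refl_mat_in_G act_refl_embed[OF g1 gnz nz]
    by (intro herm_invariant[OF fin]) auto
  have s_pos: "\<exists>r>0. s = of_real r"
  proof -
    obtain r where r: "\<And>I. I \<subseteq> {1..n} \<Longrightarrow> r I > 0 \<and> h I I = of_real (r I)" using pos by metis
    then have "s = of_real (\<Sum>I\<in>Pow {1..n}. r I)" by (simp add: s_def)
    moreover have "(\<Sum>I\<in>Pow {1..n}. r I) > 0" using r by (intro sum_pos) auto
    ultimately show ?thesis by blast
  qed
  have s0: "s \<noteq> 0" using s_pos by auto
  have one: "(\<lambda>I. 1 - (\<Sum>J\<in>Pow {1..n}. w J * 1)) = (\<lambda>I. \<delta>)" by (simp add: \<delta>_def)
  have "herm (\<lambda>_. \<delta>) (\<lambda>_. \<delta>) = herm (\<lambda>_. 1) (\<lambda>_. 1)" using refl[of "\<lambda>_. 1" "\<lambda>_. 1"] unfolding one .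
  then have "\<delta> * cnj \<delta> * s = s" unfolding diag s_def by (simp add: sum_distrib_left)
  then have dn: "\<delta> * cnj \<delta> = 1" using s0 by simp
  have rel: "(1 - \<delta>) * h I I = w I * s" if I: "I \<subseteq> {1..n}" for I
  proof -
    have wI: "(\<Sum>J\<in>Pow {1..n}. w J * delta_fun I J) = w I"
      using I by (simp add: delta_fun_def if_distrib[of "\<lambda>u. _ * u"] cong: if_cong)
    have "herm (\<lambda>J. delta_fun I J - w I) (\<lambda>_. \<delta>) = herm (delta_fun I) (\<lambda>_. 1)"
      using refl[of "delta_fun I" "\<lambda>_. 1"] unfolding one wI .
    moreover have "herm (delta_fun I) (\<lambda>_. 1) = h I I"
      unfolding diag using I by (simp add: delta_fun_def if_distrib[of "\<lambda>u. u * _"] cong: if_cong)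
    moreover have "herm (\<lambda>J. delta_fun I J - w I) (\<lambda>_. \<delta>) = cnj \<delta> * (herm (delta_fun I) (\<lambda>_. 1) - w I * s)"
      unfolding diag s_def by (simp add: left_diff_distrib right_diff_distrib sum_subtractf sum_distrib_left mult_ac)
    ultimately have "cnj \<delta> * (h I I - w I * s) = h I I" by simp
    then have "\<delta> * cnj \<delta> * (h I I - w I * s) = \<delta> * h I I" by (simp add: mult.assoc)
    then show ?thesis unfolding dn by (simp add: algebra_simps)
  qed
  obtain r r0 where r: "r > 0" "h I I = of_real r" and r0: "r0 > 0" "h {} {} = of_real r0"
    using pos[OF I] pos[of "{}"] by auto
  have "w I * s * of_real r0 = w {} * s * of_real r"
    using rel[OF I] rel[of "{}"] r(2) r0(2) by (metis empty_subsetI mult.assoc mult.commute)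
  then have "w I * of_real r0 = w {} * of_real r" using s0 by (simp add: mult_ac)
  then have "w I = of_real (r / r0) * w {}" using r0(1) by (simp add: field_simps)
  then show ?thesis unfolding w_def using r(1) r0(1) by (intro exI[of _ "r / r0"]) simp
qed

end

section \<open>Irreducibility\<close>

lemma subspace_vec_iff:
  "VectorSpace.subspace class_ring W (module_vec TYPE(complex) N) \<longleftrightarrow>
    W \<subseteq> carrier_vec N \<and> 0\<^sub>v N \<in> W \<and> (\<forall>v\<in>W. \<forall>w\<in>W. v + w \<in> W) \<and> (\<forall>c. \<forall>v\<in>W. c \<cdot>\<^sub>v v \<in> W)"
proof -
  have m: "Module.module (class_ring :: complex ring) (module_vec TYPE(complex) N)"
    using vec_vs[where 'a = complex, of N] by (simp add: vectorspace_def)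
  show ?thesis
    unfolding VectorSpace.subspace_def LinearCombinations.submodule_def module_vec_simps class_ring_simps
    using vec_vs[where 'a = complex, of N] m by auto
qed

definition vec_of_fun :: "nat \<Rightarrow> (nat set \<Rightarrow> complex) \<Rightarrow> complex vec" where
  "vec_of_fun n x = vec (2 ^ n) (\<lambda>i. x {k\<in>{1..n}. bit i (k - 1)})"

lemma vec_of_fun_carrier [simp]: "vec_of_fun n x \<in> carrier_vec (2 ^ n)"
  by (simp add: vec_of_fun_def)

lemma vec_of_fun_index:
  assumes "S \<subseteq> {1..n}"
  shows "vec_of_fun n x $ set_index S = x S"
proof -
  have "k \<in> {k \<in> {1..n}. bit (set_index S) (k - 1)} \<longleftrightarrow> k \<in> S" for k
    using bit_set_index[OF assms, of "k - 1"] assms by (cases k) auto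
  then have "{k \<in> {1..n}. bit (set_index S) (k - 1)} = S" by blast
  then show ?thesis using set_index_less[OF assms] by (simp add: vec_of_fun_def)
qed

lemma vec_eq_if_set_index:
  assumes "v \<in> carrier_vec (2 ^ n)" "w \<in> carrier_vec (2 ^ n)"
    "\<And>S. S \<subseteq> {1..n} \<Longrightarrow> v $ set_index S = w $ set_index S"
  shows "v = w"
proof (rule eq_vecI)
  fix i assume "i < dim_vec w"
  then have "i \<in> {..<2 ^ n}" using assms(2) by simp
  then obtain S where "S \<subseteq> {1..n}" "i = set_index S"
    using bij_betw_imp_surj_on[OF bij_betw_set_index[of n]] by (metis PowD imageE)
  then show "v $ i = w $ i" using assms(3) by simp
qed (use assms in simp)

lemma vec_of_fun_eq: "(\<And>S. S \<subseteq> {1..n} \<Longrightarrow> x S = y S) \<Longrightarrow> vec_of_fun n x = vec_of_fun n y"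
  by (rule vec_eq_if_set_index[of _ n]) (simp_all add: vec_of_fun_index)

lemma vec_of_fun_add: "vec_of_fun n (\<lambda>S. x S + y S) = vec_of_fun n x + vec_of_fun n y"
  by (simp add: vec_of_fun_def) (auto intro!: eq_vecI)

lemma vec_of_fun_smult: "vec_of_fun n (\<lambda>S. c * x S) = c \<cdot>\<^sub>v vec_of_fun n x"
  by (simp add: vec_of_fun_def) (auto intro!: eq_vecI)

lemma mult_vec_of_fun:
  assumes "A \<in> carrier_mat (2 ^ n) (2 ^ n)"
  shows "A *\<^sub>v vec_of_fun n x = vec_of_fun n (act n A x)"
proof (rule vec_eq_if_set_index)
  fix S assume S: "S \<subseteq> {1..n}"
  have "(A *\<^sub>v vec_of_fun n x) $ set_index S = (\<Sum>i<2 ^ n. A $$ (set_index S, i) * vec_of_fun n x $ i)"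
    using assms set_index_less[OF S] by (simp add: scalar_prod_def lessThan_atLeast0 vec_of_fun_def)
  also have "\<dots> = act n A x S"
    unfolding sum_set_index act_def if_P[OF S] by (intro sum.cong refl) (simp add: vec_of_fun_index)
  finally show "(A *\<^sub>v vec_of_fun n x) $ set_index S = vec_of_fun n (act n A x) $ set_index S"
    by (simp add: vec_of_fun_index[OF S])
qed (use assms in auto)

context nonzero_params
begin

text \<open>
  If \<open>\<alpha> = 1\<close> or \<open>\<beta> = 1\<close>, then the first coefficient of the reflection vanishes and all generators fix
  \<open>e\<^sub>(\<^sub>0\<^sub>,\<^sub>\<dots>\<^sub>,\<^sub>0\<^sub>)\<close>, so they preserve the line that it spans.
\<close>

lemma irreducible_imp_neq_1:
  assumes fin: "finite G" and irr: "irreducible_on (2 ^ n) G"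
  shows "\<alpha> \<noteq> 1 \<and> \<beta> \<noteq> 1"
proof (rule ccontr)
  assume "\<not> ?thesis"
  then have v0: "refl_coeff n \<alpha> \<beta> \<gamma> 0 = 0" by (auto simp: refl_coeff_def)
  define x where "x S = (if S = {} then 1 else 0 :: complex)" for S :: "nat set"
  define W where "W = {c \<cdot>\<^sub>v vec_of_fun n x | c. True}"
  have gen: "generator n \<alpha> \<beta> \<gamma> k *\<^sub>v vec_of_fun n x = vec_of_fun n x" if "k \<le> n" for k
    unfolding mult_vec_of_fun[OF generator_carrier]
  proof (rule vec_of_fun_eq)
    fix S assume S: "S \<subseteq> {1..n}"
    show "act n (generator n \<alpha> \<beta> \<gamma> k) x S = x S"
    proof (cases "k = 0")
      case True
      have "refl_coeff n \<alpha> \<beta> \<gamma> (set_index T) * x T = 0" for T using v0 by (simp add: x_def)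
      then show ?thesis using True by (simp add: generator_def act_refl_mat[OF S])
    next
      case False
      then show ?thesis using that act_circuit_mat[OF S, of k \<gamma> x] by (auto simp: generator_def x_def)
    qed
  qed
  have "word_mat n \<alpha> \<beta> \<gamma> ks *\<^sub>v vec_of_fun n x = vec_of_fun n x" if "set ks \<subseteq> {0..n}" for ks
    using that
  proof (induction ks)
    case (Cons k ks)
    then show ?case
      by (simp add: assoc_mult_mat_vec[OF generator_carrier word_mat_carrier vec_of_fun_carrier] gen)
  qed simp
  then have fixed: "g *\<^sub>v vec_of_fun n x = vec_of_fun n x" if "g \<in> G" for g
    using that Mon_eq_words[OF finite_words_if_finite_Mon[OF fin]] unfolding word_mats_def by auto
  have sub: "VectorSpace.subspace class_ring W (module_vec TYPE(complex) (2 ^ n))"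
    unfolding subspace_vec_iff W_def
  proof (intro conjI ballI allI)
    show "0\<^sub>v (2 ^ n) \<in> {c \<cdot>\<^sub>v vec_of_fun n x | c. True}"
      by (auto intro!: exI[of _ 0] eq_vecI simp: vec_of_fun_def)
    fix v w assume "v \<in> {c \<cdot>\<^sub>v vec_of_fun n x | c. True}" "w \<in> {c \<cdot>\<^sub>v vec_of_fun n x | c. True}"
    then show "v + w \<in> {c \<cdot>\<^sub>v vec_of_fun n x | c. True}"
      by (auto simp flip: add_smult_distrib_vec)
  next
    fix c v assume "v \<in> {c \<cdot>\<^sub>v vec_of_fun n x | c. True}"
    then show "c \<cdot>\<^sub>v v \<in> {c \<cdot>\<^sub>v vec_of_fun n x | c. True}" by (auto simp: smult_smult_assoc)
  qed auto
  have inv: "\<forall>g\<in>G. \<forall>w\<in>W. g *\<^sub>v w \<in> W"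
    unfolding W_def using fixed by (auto simp: mult_mat_vec[OF G_carrier vec_of_fun_carrier])
  have "W = {0\<^sub>v (2 ^ n)} \<or> W = carrier_vec (2 ^ n)"
    using irr sub inv unfolding irreducible_on_def by blast
  then show False
  proof
    assume "W = {0\<^sub>v (2 ^ n)}"
    moreover have "vec_of_fun n x \<in> W" unfolding W_def by (auto intro!: exI[of _ 1])
    ultimately have "vec_of_fun n x $ set_index {} = 0" by simp
    then show False using vec_of_fun_index[of "{}" n x] by (simp add: x_def)
  next
    assume "W = carrier_vec (2 ^ n)"
    then have "vec_of_fun n (\<lambda>_. 1) \<in> W" by simp
    then obtain c where c: "vec_of_fun n (\<lambda>_. 1) = c \<cdot>\<^sub>v vec_of_fun n x" unfolding W_def by auto
    have "vec_of_fun n (\<lambda>_. 1) $ set_index {1..n} = c * vec_of_fun n x $ set_index {1..n}"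
      unfolding c using set_index_less[of "{1..n}" n] by (simp add: vec_of_fun_def)
    then show False using n by (simp add: vec_of_fun_index x_def)
  qed
qed

text \<open>
  The projections to the eigenspaces of \<open>M\<^sub>k\<close> are polynomials in \<open>M\<^sub>k\<close>, so an invariant subspace contains with
  a vector also its components along the \<open>f\<^sub>I\<close>. If \<open>f\<^sub>I\<close> belongs to it, then so does \<open>f\<^sub>I - M\<^sub>0 f\<^sub>I = w\<^sub>I \<Sum>\<^sub>J f\<^sub>J\<close>, and
  hence every \<open>f\<^sub>J\<close>.
\<close>

lemma irreducible_if_refl_weight_nonzero:
  assumes g1: "\<And>k. k \<in> {1..n} \<Longrightarrow> \<gamma> k \<noteq> 1"
    and w: "\<And>I. I \<subseteq> {1..n} \<Longrightarrow> refl_weight n \<alpha> \<beta> \<gamma> I \<noteq> 0"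
  shows "irreducible_on (2 ^ n) G"
  unfolding irreducible_on_def
proof (intro conjI allI impI)
  fix W assume "VectorSpace.subspace class_ring W (module_vec TYPE(complex) (2 ^ n)) \<and> (\<forall>g\<in>G. \<forall>w\<in>W. g *\<^sub>v w \<in> W)"
  then have W: "W \<subseteq> carrier_vec (2 ^ n)" "0\<^sub>v (2 ^ n) \<in> W"
    "\<And>v w. v \<in> W \<Longrightarrow> w \<in> W \<Longrightarrow> v + w \<in> W" "\<And>c v. v \<in> W \<Longrightarrow> c \<cdot>\<^sub>v v \<in> W"
    and inv: "\<And>g w. g \<in> G \<Longrightarrow> w \<in> W \<Longrightarrow> g *\<^sub>v w \<in> W"
    unfolding subspace_vec_iff by auto
  define Y where "Y = {y. vec_of_fun n (embed n \<gamma> y) \<in> W}"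
  have emb_lin: "embed n \<gamma> (\<lambda>I. y I + z I) = (\<lambda>S. embed n \<gamma> y S + embed n \<gamma> z S)"
    "embed n \<gamma> (\<lambda>I. c * y I) = (\<lambda>S. c * embed n \<gamma> y S)" for y z c
    by (auto simp: embed_def distrib_right sum.distrib sum_distrib_left mult.assoc)
  have Yadd: "(\<lambda>I. y I + z I) \<in> Y" if "y \<in> Y" "z \<in> Y" for y z
    using that W(3) by (simp add: Y_def emb_lin vec_of_fun_add)
  have Ysm: "(\<lambda>I. c * y I) \<in> Y" if "y \<in> Y" for y c
    using that W(4) by (simp add: Y_def emb_lin vec_of_fun_smult)
  have Yact: "y' \<in> Y" if "y \<in> Y" "g \<in> G" "act n g (embed n \<gamma> y) = embed n \<gamma> y'" for y y' g
    using that inv[OF that(2), of "vec_of_fun n (embed n \<gamma> y)"] by (simp add: Y_def mult_vec_of_fun G_carrier)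
  have Ycong: "y \<in> Y" if "z \<in> Y" "\<And>I. I \<subseteq> {1..n} \<Longrightarrow> y I = z I" for y z
  proof -
    have "embed n \<gamma> y = embed n \<gamma> z" using that(2) by (auto simp: embed_def)
    then show ?thesis using that(1) by (simp add: Y_def)
  qed
  have proj: "(\<lambda>I. if (k \<in> I) = (k \<in> J) then y I else 0) \<in> Y" if k: "k \<in> {1..n}" and y: "y \<in> Y" for k J y
  proof -
    define p q where "p = (if k \<in> J then inverse (\<gamma> k) else 1)" and "q = (if k \<in> J then 1 else inverse (\<gamma> k))"
    have pq: "p \<noteq> q" using g1[OF k] by (auto simp: p_def q_def)
    have "(\<lambda>I. (if k \<in> I then inverse (\<gamma> k) else 1) * y I) \<in> Y"
      using Yact[OF y circuit_mat_in_G[OF k] act_circuit_embed[of k n \<gamma>, OF k g1[OF k] gnz[OF k]]] .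
    then have "(\<lambda>I. (1 / (p - q)) * ((if k \<in> I then inverse (\<gamma> k) else 1) * y I + (- q) * y I)) \<in> Y"
      by (intro Ysm Yadd y)
    moreover have "(1 / (p - q)) * ((if k \<in> I then inverse (\<gamma> k) else 1) * y I + (- q) * y I)
        = (if (k \<in> I) = (k \<in> J) then y I else 0)" for I
    proof -
      have "(if k \<in> I then inverse (\<gamma> k) else 1) = (if (k \<in> I) = (k \<in> J) then p else q)" by (auto simp: p_def q_def)
      then have "(if k \<in> I then inverse (\<gamma> k) else 1) * y I + (- q) * y I
         = (if (k \<in> I) = (k \<in> J) then (p - q) * y I else 0)" by (simp add: left_diff_distrib)
      then show ?thesis using pq by simp
    qed
    ultimately show ?thesis by simp
  qed
  have proj_all: "(\<lambda>I. if I = J then y J else 0) \<in> Y" if J: "J \<subseteq> {1..n}" and y: "y \<in> Y" for J y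
  proof -
    have "(\<lambda>I. if \<forall>k\<in>K. (k \<in> I) = (k \<in> J) then y I else 0) \<in> Y" if "finite K" "K \<subseteq> {1..n}" for K
      using that
    proof (induction K)
      case empty
      then show ?case using y by simp
    next
      case (insert k K)
      then have "(\<lambda>I. if (k \<in> I) = (k \<in> J) then (if \<forall>k\<in>K. (k \<in> I) = (k \<in> J) then y I else 0) else 0) \<in> Y"
        by (intro proj) auto
      then show ?case by (rule Ycong) auto
    qed
    from this[of "{1..n}"] have "(\<lambda>I. if \<forall>k\<in>{1..n}. (k \<in> I) = (k \<in> J) then y I else 0) \<in> Y" by simp
    moreover have "(if I = J then y J else 0) = (if \<forall>k\<in>{1..n}. (k \<in> I) = (k \<in> J) then y I else 0)"
      if "I \<subseteq> {1..n}" for I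
      using that J by auto
    ultimately show ?thesis by (rule Ycong)
  qed
  have surj: "\<exists>y. v = vec_of_fun n (embed n \<gamma> y)" if v: "v \<in> carrier_vec (2 ^ n)" for v
  proof (intro exI vec_eq_if_set_index)
    fix S assume S: "S \<subseteq> {1..n}"
    show "v $ set_index S = vec_of_fun n (embed n \<gamma> (coords n \<gamma> (\<lambda>S. v $ set_index S))) $ set_index S"
      using S embed_coords[OF g1, where x = "\<lambda>S. v $ set_index S" and S = S] by (simp add: vec_of_fun_index)
  qed (use v in auto)
  show "W = {0\<^sub>v (2 ^ n)} \<or> W = carrier_vec (2 ^ n)"
  proof (cases "W = {0\<^sub>v (2 ^ n)}")
    case False
    then obtain v where v: "v \<in> W" "v \<noteq> 0\<^sub>v (2 ^ n)" using W(2) by blast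
    then obtain y where y: "v = vec_of_fun n (embed n \<gamma> y)" using surj W(1) by blast
    then have yY: "y \<in> Y" using v by (simp add: Y_def)
    obtain I where I: "I \<subseteq> {1..n}" "y I \<noteq> 0"
    proof (rule ccontr)
      assume "\<not> thesis"
      then have "y I = 0" if "I \<subseteq> {1..n}" for I using that \<open>\<And>I. I \<subseteq> {1..n} \<Longrightarrow> y I \<noteq> 0 \<Longrightarrow> thesis\<close> by blast
      then have "embed n \<gamma> y = (\<lambda>_. 0)" by (auto simp: embed_def)
      then have "v = 0\<^sub>v (2 ^ n)" unfolding y by (auto simp: vec_of_fun_def)
      then show False using v(2) by simp
    qed
    define z where "z J = (if J = I then y I else 0)" for J
    have zY: "z \<in> Y" using proj_all[OF I(1) yY] by (simp add: z_def[abs_def])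
    define s where "s = (\<Sum>J\<in>Pow {1..n}. refl_weight n \<alpha> \<beta> \<gamma> J * z J)"
    have s: "s = refl_weight n \<alpha> \<beta> \<gamma> I * y I"
      using I(1) by (simp add: s_def z_def if_distrib[of "\<lambda>u. _ * u"] cong: if_cong)
    have s0: "s \<noteq> 0" unfolding s using w[OF I(1)] I(2) by simp
    have "(\<lambda>J. z J - s) \<in> Y"
      using Yact[OF zY refl_mat_in_G act_refl_embed[OF g1 gnz nz]] by (simp add: s_def)
    then have "(\<lambda>J. (- 1 / s) * ((z J - s) + (- 1) * z J)) \<in> Y"
      by (intro Ysm[of "\<lambda>J. (z J - s) + (- 1) * z J"] Yadd[of _ "\<lambda>J. (- 1) * z J"] Ysm[of z "- 1", OF zY])
    then have one: "(\<lambda>J. 1) \<in> Y" using s0 by simp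
    have all: "x \<in> Y" for x
    proof -
      have "(\<lambda>I. if I \<in> A then x I else 0) \<in> Y" if "finite A" "A \<subseteq> Pow {1..n}" for A
        using that
      proof (induction A)
        case empty
        then show ?case using Ysm[OF one, of 0] by simp
      next
        case (insert J A)
        then have J: "J \<subseteq> {1..n}" and IH: "(\<lambda>I. if I \<in> A then x I else 0) \<in> Y" by auto
        have "(\<lambda>I. x J * (if I = J then 1 else 0) + (if I \<in> A then x I else 0)) \<in> Y"
          by (intro Yadd[of "\<lambda>I. x J * (if I = J then 1 else 0)"] Ysm[of "\<lambda>I. if I = J then 1 else 0"] IH proj_all[OF J one])
        then show ?case by (rule Ycong) (use insert(2) in auto)
      qed
      from this[of "Pow {1..n}"] have "(\<lambda>I. if I \<in> Pow {1..n} then x I else 0) \<in> Y" by simp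
      then show ?thesis by (rule Ycong) simp
    qed
    have "carrier_vec (2 ^ n) \<subseteq> W"
    proof
      fix u :: "complex vec" assume "u \<in> carrier_vec (2 ^ n)"
      then obtain x where "u = vec_of_fun n (embed n \<gamma> x)" using surj by blast
      then show "u \<in> W" using all[of x] by (simp add: Y_def)
    qed
    then show ?thesis using W(1) by blast
  qed simp
qed simp


lemma refl_weight_empty_nonzero:
  assumes "\<And>k. k \<in> {1..n} \<Longrightarrow> \<gamma> k \<noteq> 1" "\<alpha> \<noteq> 1" "\<beta> \<noteq> 1"
  shows "refl_weight n \<alpha> \<beta> \<gamma> {} \<noteq> 0"
  using assms nz gnz by (auto simp: refl_weight_def prod_zero_iff)

end

section \<open>Restriction to faces of the cube\<close>

lemma sum_sign_prod:
  fixes f :: "nat \<Rightarrow> complex"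
  assumes "finite A"
  shows "(\<Sum>S\<in>Pow A. (-1) ^ card S * prod f S) = (\<Prod>k\<in>A. 1 - f k)"
proof -
  have "(\<Prod>k\<in>A. 1 - f k) = (\<Prod>k\<in>A. (- 1) * f k + 1)" by simp
  also have "\<dots> = (\<Sum>S\<in>Pow A. prod (\<lambda>k. (- 1) * f k) S * prod (\<lambda>_. 1) (A - S))"
    by (rule prod_add[OF assms])
  also have "\<dots> = (\<Sum>S\<in>Pow A. (-1) ^ card S * prod f S)"
    unfolding prod.distrib by simp
  finally show ?thesis ..
qed

text \<open>
  Let \<open>p\<close> and \<open>q\<close> be the sums of the \<open>f\<^sub>I\<close>, \<open>I \<subseteq> {1..m+1}\<close>, with \<open>m + 1 \<notin> I\<close> and \<open>m + 1 \<in> I\<close>. The plane that they span is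
  mapped to itself by \<open>M\<^bsub>m+1\<^esub>\<close> and by the reflection of the system in \<open>m + 1\<close> variables. The identity says that the
  product of these two has trace \<open>0\<close> on the plane, so that its square is a scalar there.
\<close>

lemma refl_weight_trace:
  assumes m: "m > 0" and g: "\<And>k. k \<in> {1..Suc m} \<Longrightarrow> \<gamma> k \<noteq> 1" "\<And>k. k \<in> {1..Suc m} \<Longrightarrow> \<gamma> k \<noteq> 0"
    and nz: "\<alpha> \<noteq> 0" "\<beta> \<noteq> 0"
  shows "(\<Sum>S\<in>Pow {1..m}. refl_weight (Suc m) \<alpha> \<beta> \<gamma> S
       + inverse (\<gamma> (Suc m)) * refl_weight (Suc m) \<alpha> \<beta> \<gamma> (insert (Suc m) S)) = 1 + inverse (\<gamma> (Suc m))"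
proof -
  define c where "c = \<gamma> (Suc m)"
  define K where "K = (\<Prod>k=1..m. \<gamma> k / (\<gamma> k - 1))"
  have c: "c \<noteq> 0" "c \<noteq> 1" using g[of "Suc m"] by (simp_all add: c_def)
  have Kc: "(\<Prod>k=1..Suc m. \<gamma> k / (\<gamma> k - 1)) = K * (c / (c - 1))" by (simp add: K_def c_def)
  have K1: "K * (\<Prod>k=1..m. 1 - inverse (\<gamma> k)) = 1"
  proof -
    have "K * (\<Prod>k=1..m. 1 - inverse (\<gamma> k)) = (\<Prod>k=1..m. \<gamma> k / (\<gamma> k - 1) * (1 - inverse (\<gamma> k)))"
      unfolding K_def prod.distrib ..
    also have "\<dots> = (\<Prod>k=1..m. 1)" using g by (intro prod.cong refl) (auto simp: field_simps)
    finally show ?thesis by simp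
  qed
  have "refl_weight (Suc m) \<alpha> \<beta> \<gamma> S + inverse c * refl_weight (Suc m) \<alpha> \<beta> \<gamma> (insert (Suc m) S)
      = K * (c / (c - 1)) * ((1 - inverse c ^ 2) * ((-1) ^ card S * prod (\<lambda>k. inverse (\<gamma> k)) S)
          - (1 - inverse c) * (\<alpha> + \<beta>) / (\<alpha> * \<beta>) * ((-1) ^ card S * prod (\<lambda>k. 1) S))"
    if S: "S \<subseteq> {1..m}" for S
  proof -
    have fS: "finite S" "Suc m \<notin> S" using S finite_subset by auto
    define p where "p = prod \<gamma> S"
    have p: "p \<noteq> 0" using g(2) S fS by (force simp: p_def prod_zero_iff)
    have e: "card (insert (Suc m) S) = Suc (card S)" "prod \<gamma> (insert (Suc m) S) = c * p"
      "prod (\<lambda>k. inverse (\<gamma> k)) S = inverse p"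
      using fS prod_inversef[of \<gamma> S] by (simp_all add: p_def c_def o_def)
    have id: "(p - \<alpha>) * (p - \<beta>) / p + inverse c * - ((c * p - \<alpha>) * (c * p - \<beta>) / (c * p))
        = \<alpha> * \<beta> * ((1 - inverse c ^ 2) * inverse p) - (1 - inverse c) * (\<alpha> + \<beta>)"
      using p c by (simp add: field_simps power2_eq_square)
    have "refl_weight (Suc m) \<alpha> \<beta> \<gamma> S + inverse c * refl_weight (Suc m) \<alpha> \<beta> \<gamma> (insert (Suc m) S)
       = (-1) ^ card S * (K * (c / (c - 1))) / (\<alpha> * \<beta>) *
         ((p - \<alpha>) * (p - \<beta>) / p + inverse c * - ((c * p - \<alpha>) * (c * p - \<beta>) / (c * p)))"
    proof -
      have gen: "u * X / d * w1 + i * ((- 1 * u) * X / d * w2) = u * X / d * (w1 + i * - w2)"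
        for u X d w1 i w2 :: complex
        by (simp add: distrib_left right_diff_distrib diff_divide_distrib mult_ac)
      show ?thesis unfolding refl_weight_def e Kc p_def[symmetric] power_Suc by (rule gen)
    qed
    also have "\<dots> = K * (c / (c - 1)) * ((1 - inverse c ^ 2) * ((-1) ^ card S * inverse p)
          - (1 - inverse c) * (\<alpha> + \<beta>) / (\<alpha> * \<beta>) * ((-1) ^ card S * 1))"
      unfolding id using nz by (simp add: field_simps)
    finally show ?thesis unfolding e by simp
  qed
  then have "(\<Sum>S\<in>Pow {1..m}. refl_weight (Suc m) \<alpha> \<beta> \<gamma> S + inverse c * refl_weight (Suc m) \<alpha> \<beta> \<gamma> (insert (Suc m) S))
     = (\<Sum>S\<in>Pow {1..m}. K * (c / (c - 1)) * ((1 - inverse c ^ 2) * ((-1) ^ card S * prod (\<lambda>k. inverse (\<gamma> k)) S)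
          - (1 - inverse c) * (\<alpha> + \<beta>) / (\<alpha> * \<beta>) * ((-1) ^ card S * prod (\<lambda>k. 1) S)))"
    by (intro sum.cong refl) simp
  also have "\<dots> = K * (c / (c - 1)) * ((1 - inverse c ^ 2) * (\<Prod>k=1..m. 1 - inverse (\<gamma> k))
          - (1 - inverse c) * (\<alpha> + \<beta>) / (\<alpha> * \<beta>) * (\<Prod>k=1..m. 1 - 1))"
    unfolding sum_distrib_left[symmetric] sum_subtractf sum_sign_prod[OF finite_atLeastAtMost] ..
  also have "(\<Prod>k=1..m. 1 - 1 :: complex) = 0" using m by simp
  also have "K * (c / (c - 1)) * ((1 - inverse c ^ 2) * (\<Prod>k=1..m. 1 - inverse (\<gamma> k))
          - (1 - inverse c) * (\<alpha> + \<beta>) / (\<alpha> * \<beta>) * 0)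
      = (K * (\<Prod>k=1..m. 1 - inverse (\<gamma> k))) * ((c / (c - 1)) * (1 - inverse c ^ 2))" by (simp add: mult_ac)
  also have "\<dots> = 1 + inverse c" unfolding K1 using c by (simp add: field_simps power2_eq_square)
  finally show ?thesis unfolding c_def .
qed

lemma refl_weight_Suc:
  assumes "\<gamma> (Suc m) \<noteq> 0" "\<gamma> (Suc m) \<noteq> 1"
  shows "refl_weight m \<alpha> \<beta> \<gamma> S = (1 - inverse (\<gamma> (Suc m))) * refl_weight (Suc m) \<alpha> \<beta> \<gamma> S"
proof -
  have "(1 - inverse (\<gamma> (Suc m))) * (\<gamma> (Suc m) / (\<gamma> (Suc m) - 1)) = 1" using assms by (simp add: field_simps)
  moreover have "refl_weight (Suc m) \<alpha> \<beta> \<gamma> S = (\<gamma> (Suc m) / (\<gamma> (Suc m) - 1)) * refl_weight m \<alpha> \<beta> \<gamma> S"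
  proof -
    have gen: "u * (P * q) / d * x = q * (u * P / d * x)" for u P q d x :: complex by (simp add: mult_ac)
    have e: "(\<Prod>k=1..Suc m. \<gamma> k / (\<gamma> k - 1)) = (\<Prod>k=1..m. \<gamma> k / (\<gamma> k - 1)) * (\<gamma> (Suc m) / (\<gamma> (Suc m) - 1))" by simp
    show ?thesis unfolding refl_weight_def e by (rule gen)
  qed
  ultimately show ?thesis by (simp add: mult.assoc[symmetric])
qed

lemma sum_Pow_Suc: "(\<Sum>S\<in>Pow {1..Suc m}. f S) = (\<Sum>S\<in>Pow {1..m}. f S + f (insert (Suc m) S))"
proof -
  have "Pow {1..Suc m} = Pow {1..m} \<union> insert (Suc m) ` Pow {1..m}"
    using Pow_insert[of "Suc m" "{1..m}"] by (simp add: atLeastAtMostSuc_conv)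
  moreover have "Pow {1..m} \<inter> insert (Suc m) ` Pow {1..m} = {}" by auto
  moreover have "inj_on (insert (Suc m)) (Pow {1..m})"
  proof (rule inj_onI)
    fix S T assume "S \<in> Pow {1..m}" "T \<in> Pow {1..m}" "insert (Suc m) S = insert (Suc m) T"
    moreover from this have "Suc m \<notin> S" "Suc m \<notin> T" by auto
    ultimately show "S = T" by (metis insert_ident)
  qed
  ultimately show ?thesis by (simp add: sum.union_disjoint sum.reindex sum.distrib)
qed

context nonzero_params
begin

text \<open>
  On the span of the \<open>f\<^sub>I\<close> with \<open>I \<subseteq> {1..m}\<close>, some group element acts as the reflection of the system with
  parameters \<open>\<alpha>, \<beta>, \<gamma>\<^sub>1, \<dots>, \<gamma>\<^sub>m\<close>. If \<open>g\<close> has this property for \<open>m + 1\<close>, then \<open>(g M\<^bsub>m+1\<^esub>)\<^sup>2\<close> has it for \<open>m\<close>, by the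
  trace identity. This is the relation \<open>(M\<^sub>0 M\<^sub>k)\<^sup>2 = (M\<^sub>k M\<^sub>0)\<^sup>2\<close> of the fundamental group at work.
\<close>

lemma exists_restricted_reflection:
  assumes fin: "finite G" and m: "0 < m" "m \<le> n"
  shows "\<exists>g\<in>G. \<forall>y. (\<forall>I. \<not> I \<subseteq> {1..m} \<longrightarrow> y I = 0) \<longrightarrow>
    act n g (embed n \<gamma> y) = embed n \<gamma> (\<lambda>I. y I - (if I \<subseteq> {1..m} then \<Sum>J\<in>Pow {1..m}. refl_weight m \<alpha> \<beta> \<gamma> J * y J else 0))"
  using m(2) m(1)
proof (induction m rule: inc_induct)
  case base
  show ?case
  proof (intro bexI[OF _ refl_mat_in_G] allI impI)
    fix y :: "nat set \<Rightarrow> complex"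
    show "act n (refl_mat n \<alpha> \<beta> \<gamma>) (embed n \<gamma> y) = embed n \<gamma> (\<lambda>I. y I - (if I \<subseteq> {1..n} then \<Sum>J\<in>Pow {1..n}. refl_weight n \<alpha> \<beta> \<gamma> J * y J else 0))"
    proof -
      have "act n (refl_mat n \<alpha> \<beta> \<gamma>) (embed n \<gamma> y) = embed n \<gamma> (\<lambda>I. y I - (\<Sum>J\<in>Pow {1..n}. refl_weight n \<alpha> \<beta> \<gamma> J * y J))"
        by (rule act_refl_embed) (use gamma_neq_1_if_finite[OF fin] gnz nz in auto)
      also have "\<dots> = embed n \<gamma> (\<lambda>I. y I - (if I \<subseteq> {1..n} then \<Sum>J\<in>Pow {1..n}. refl_weight n \<alpha> \<beta> \<gamma> J * y J else 0))"
        by (auto simp: embed_def intro!: sum.cong)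
      finally show ?thesis .
    qed
  qed
next
  case (step m)
  then obtain g where g: "g \<in> G" and gact: "\<And>y. (\<And>I. \<not> I \<subseteq> {1..Suc m} \<Longrightarrow> y I = 0) \<Longrightarrow>
    act n g (embed n \<gamma> y) = embed n \<gamma> (\<lambda>I. y I - (if I \<subseteq> {1..Suc m} then \<Sum>J\<in>Pow {1..Suc m}. refl_weight (Suc m) \<alpha> \<beta> \<gamma> J * y J else 0))"
    by auto
  let ?k = "Suc m"
  define w where "w = refl_weight ?k \<alpha> \<beta> \<gamma>"
  define c where "c = inverse (\<gamma> ?k)"
  have k: "?k \<in> {1..n}" using step by simp
  have g1: "\<gamma> j \<noteq> 1" "\<gamma> j \<noteq> 0" if "j \<in> {1..?k}" for j
    using that k gamma_neq_1_if_finite[OF fin] gnz by auto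
  have cact: "act n (circuit_mat n \<gamma> ?k) (embed n \<gamma> y) = embed n \<gamma> (\<lambda>I. (if ?k \<in> I then c else 1) * y I)" for y
    unfolding c_def using k g1[of ?k] by (intro act_circuit_embed) auto
  have tr: "(\<Sum>S\<in>Pow {1..m}. w S + c * w (insert ?k S)) = 1 + c"
    unfolding w_def c_def using step.prems g1 nz by (intro refl_weight_trace) auto
  let ?M = "circuit_mat n \<gamma> ?k"
  have MG: "?M \<in> G" using circuit_mat_in_G[OF k] .
  show ?case
  proof (intro bexI[of _ "g * (?M * (g * ?M))"] allI impI)
    show "g * (?M * (g * ?M)) \<in> G" using g MG by (intro Mon_mult)
    fix y :: "nat set \<Rightarrow> complex" assume y: "\<forall>I. \<not> I \<subseteq> {1..m} \<longrightarrow> y I = 0"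
    define s where "s = (\<Sum>J\<in>Pow {1..m}. w J * y J)"
    \<comment> \<open>the image of \<open>y\<close> after three of the four factors\<close>
    define z where "z I = y I - (if I \<subseteq> {1..?k} then (if ?k \<in> I then c else 1) * s else 0)" for I
    have yk: "y I = 0" if "?k \<in> I" for I
    proof -
      have "\<not> I \<subseteq> {1..m}" using that by auto
      then show ?thesis using y by blast
    qed
    have s1: "(\<Sum>J\<in>Pow {1..?k}. w J * y J) = s"
      unfolding sum_Pow_Suc s_def by (simp add: yk)
    have y0: "y I = 0" if "\<not> I \<subseteq> {1..?k}" for I
    proof -
      have "\<not> I \<subseteq> {1..m}" using that by force
      then show ?thesis using y by blast
    qed
    have s2: "(\<Sum>J\<in>Pow {1..?k}. w J * z J) = - c * s"
    proof -
      have "(\<Sum>J\<in>Pow {1..?k}. w J * z J) = (\<Sum>J\<in>Pow {1..m}. w J * y J - (w J + c * w (insert ?k J)) * s)"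
        unfolding sum_Pow_Suc
      proof (intro sum.cong refl)
        fix J assume "J \<in> Pow {1..m}"
        then have "J \<subseteq> {1..?k}" "insert ?k J \<subseteq> {1..?k}" "?k \<notin> J" by auto
        then show "w J * z J + w (insert ?k J) * z (insert ?k J) = w J * y J - (w J + c * w (insert ?k J)) * s"
          by (simp add: z_def yk algebra_simps)
      qed
      also have "\<dots> = s - (1 + c) * s"
        unfolding sum_subtractf sum_distrib_right[symmetric] tr s_def ..
      finally show ?thesis by (simp add: algebra_simps)
    qed
    have z0: "\<And>I. \<not> I \<subseteq> {1..?k} \<Longrightarrow> z I = 0" using y0 by (simp add: z_def)
    have 1: "act n ?M (embed n \<gamma> y) = embed n \<gamma> y"
      unfolding cact by (rule arg_cong[of _ _ "embed n \<gamma>"], rule ext) (simp add: yk)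
    have 2: "act n g (embed n \<gamma> y) = embed n \<gamma> (\<lambda>I. y I - (if I \<subseteq> {1..?k} then s else 0))"
      using gact[of y, OF y0] unfolding s1[unfolded w_def] .
    have 3: "act n ?M (embed n \<gamma> (\<lambda>I. y I - (if I \<subseteq> {1..?k} then s else 0))) = embed n \<gamma> z"
      unfolding cact
    proof (rule arg_cong[of _ _ "embed n \<gamma>"], rule ext)
      fix I show "(if ?k \<in> I then c else 1) * (y I - (if I \<subseteq> {1..?k} then s else 0)) = z I"
        by (cases "?k \<in> I") (simp_all add: z_def yk)
    qed
    have 4: "act n g (embed n \<gamma> z) = embed n \<gamma> (\<lambda>I. z I - (if I \<subseteq> {1..?k} then - c * s else 0))"
      using gact[of z, OF z0] unfolding s2[unfolded w_def] .
    have "act n (g * (?M * (g * ?M))) (embed n \<gamma> y) = embed n \<gamma> (\<lambda>I. z I - (if I \<subseteq> {1..?k} then - c * s else 0))"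
      using g MG by (simp only: act_G_mult Mon_mult 1 2 3 4)
    also have "\<dots> = embed n \<gamma> (\<lambda>I. y I - (if I \<subseteq> {1..m} then \<Sum>J\<in>Pow {1..m}. refl_weight m \<alpha> \<beta> \<gamma> J * y J else 0))"
    proof (rule arg_cong[of _ _ "embed n \<gamma>"], rule ext)
      fix I
      have "(\<Sum>J\<in>Pow {1..m}. refl_weight m \<alpha> \<beta> \<gamma> J * y J) = (1 - c) * s"
        unfolding refl_weight_Suc[of \<gamma> m, OF g1(2)[of ?k, simplified] g1(1)[of ?k, simplified]] s_def w_def c_def
        by (simp add: sum_distrib_left mult.assoc)
      moreover have "I \<subseteq> {1..m} \<longleftrightarrow> I \<subseteq> {1..?k} \<and> ?k \<notin> I"
        by (auto simp: subset_iff) (metis atLeastAtMost_iff le_Suc_eq)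
      ultimately show "z I - (if I \<subseteq> {1..?k} then - c * s else 0) = y I - (if I \<subseteq> {1..m} then \<Sum>J\<in>Pow {1..m}. refl_weight m \<alpha> \<beta> \<gamma> J * y J else 0)"
        by (cases "?k \<in> I") (simp_all add: z_def algebra_simps)
    qed
    finally show "act n (g * (?M * (g * ?M))) (embed n \<gamma> y) = embed n \<gamma> (\<lambda>I. y I - (if I \<subseteq> {1..m} then \<Sum>J\<in>Pow {1..m}. refl_weight m \<alpha> \<beta> \<gamma> J * y J else 0))" .
  qed
qed

text \<open>
  Going down to \<open>m = 1\<close>, the product of the restricted reflection and \<open>M\<^sub>1\<close> acts on a plane as the inverse of the local
  monodromy of the Gauss equation at infinity, with the eigenvalues \<open>\<alpha>\<^bsup>-1\<^esup>\<close> and \<open>\<beta>\<^bsup>-1\<^esup>\<close>.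
\<close>

lemma alpha_root_of_unity:
  assumes fin: "finite G" and a1: "\<alpha> \<noteq> 1" and ag: "\<alpha> \<noteq> \<gamma> 1"
  shows "\<exists>m>0. \<alpha> ^ m = 1"
proof -
  have one: "1 \<in> {1..n}" using n by simp
  have "0 < (1 :: nat)" "1 \<le> n" using n by simp_all
  from exists_restricted_reflection[OF fin this]
  obtain g where g: "g \<in> G" and gact: "\<forall>y. (\<forall>I. \<not> I \<subseteq> {1..1} \<longrightarrow> y I = 0) \<longrightarrow>
    act n g (embed n \<gamma> y) = embed n \<gamma> (\<lambda>I. y I - (if I \<subseteq> {1..1} then \<Sum>J\<in>Pow {1..1}. refl_weight 1 \<alpha> \<beta> \<gamma> J * y J else 0))"
    by blast
  define c where "c = \<gamma> 1"
  have c: "c \<noteq> 0" "c \<noteq> 1" using gnz[OF one] gamma_neq_1_if_finite[OF fin one] by (simp_all add: c_def)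
  \<comment> \<open>the eigenvector, normalized such that the reflection subtracts exactly \<open>1\<close>\<close>
  define y where "y I = (if I = {} then \<alpha> / (\<alpha> - 1) else if I = {1} then \<alpha> * c / (\<alpha> - c) else 0)" for I :: "nat set"
  define y' where "y' I = (if 1 \<in> I then inverse c else 1) * y I" for I
  have sub: "I \<subseteq> {1..1} \<longleftrightarrow> I = {} \<or> I = {1}" for I :: "nat set" by auto
  have P: "Pow {1..1 :: nat} = {{}, {1}}" by auto
  have "(\<Sum>J\<in>Pow {1..1}. refl_weight 1 \<alpha> \<beta> \<gamma> J * y' J) = refl_weight 1 \<alpha> \<beta> \<gamma> {} * y' {} + refl_weight 1 \<alpha> \<beta> \<gamma> {1} * y' {1}"
    unfolding P by simp
  also have "\<dots> = 1"
  proof -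
    have ac: "\<alpha> - c \<noteq> 0" "\<alpha> - 1 \<noteq> 0" "c - 1 \<noteq> 0" using ag a1 c by (auto simp: c_def)
    have cg: "\<gamma> (Suc 0) = c" by (simp add: c_def)
    have 1: "refl_weight 1 \<alpha> \<beta> \<gamma> {} * y' {} = - (c / ((c - 1) * (\<alpha> * \<beta>))) * (\<alpha> * (1 - \<beta>))"
      using ac nz by (simp add: refl_weight_def y'_def y_def cg divide_simps) (simp add: algebra_simps)
    have 2: "refl_weight 1 \<alpha> \<beta> \<gamma> {1} * y' {1} = c / ((c - 1) * (\<alpha> * \<beta>)) * (\<alpha> * (c - \<beta>) / c)"
      using ac nz c by (simp add: refl_weight_def y'_def y_def cg divide_simps) (simp add: algebra_simps)
    show ?thesis unfolding 1 2 using ac nz c by (simp add: divide_simps) (simp add: algebra_simps)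
  qed
  finally have s: "(\<Sum>J\<in>Pow {1..1}. refl_weight 1 \<alpha> \<beta> \<gamma> J * y' J) = 1" .
  have y'0: "\<forall>I. \<not> I \<subseteq> {1..1} \<longrightarrow> y' I = 0" unfolding sub by (simp add: y'_def y_def)
  have ev0: "act n (g * circuit_mat n \<gamma> 1) (embed n \<gamma> y) = embed n \<gamma> (\<lambda>I. inverse \<alpha> * y I)"
  proof -
    have "act n (circuit_mat n \<gamma> 1) (embed n \<gamma> y) = embed n \<gamma> y'"
      unfolding y'_def[abs_def] c_def using one c by (intro act_circuit_embed) (auto simp: c_def)
    then have "act n (g * circuit_mat n \<gamma> 1) (embed n \<gamma> y) = embed n \<gamma> (\<lambda>I. y' I - (if I \<subseteq> {1..1} then 1 else 0))"
      using act_G_mult[OF g circuit_mat_in_G[OF one]] gact[rule_format, of y'] y'0 unfolding s by presburger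
    also have "(\<lambda>I. y' I - (if I \<subseteq> {1..1} then 1 else 0)) = (\<lambda>I. inverse \<alpha> * y I)"
    proof
      fix I :: "nat set"
      have ac: "\<alpha> - c \<noteq> 0" "\<alpha> - 1 \<noteq> 0" using ag a1 by (auto simp: c_def)
      show "y' I - (if I \<subseteq> {1..1} then 1 else 0) = inverse \<alpha> * y I"
        unfolding sub using ac c nz by (auto simp: y'_def y_def divide_simps)
    qed
    finally show ?thesis .
  qed
  have ev: "act n (g * circuit_mat n \<gamma> 1) (embed n \<gamma> y) = (\<lambda>S. inverse \<alpha> * embed n \<gamma> y S)"
    unfolding ev0 by (auto simp: embed_def sum_distrib_left mult.assoc)
  have "\<exists>S. embed n \<gamma> y S \<noteq> 0"
  proof (rule ccontr)
    assume "\<nexists>S. embed n \<gamma> y S \<noteq> 0"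
    then have "coords n \<gamma> (embed n \<gamma> y) {} = 0" by (simp add: coords_def)
    then show False using coords_embed[of "{}" n \<gamma> y] gamma_neq_1_if_finite[OF fin] nz a1 by (simp add: y_def)
  qed
  then obtain S where "embed n \<gamma> y S \<noteq> 0" by blast
  from eigenvalue_root_of_unity[OF fin Mon_mult[OF g circuit_mat_in_G[OF one]] ev this] nz
  obtain m where "m > 0" "inverse \<alpha> ^ m = 1" by auto
  then show ?thesis by (intro exI[of _ m]) (simp add: power_inverse)
qed

end

section \<open>Finiteness and conjugate parameters\<close>

text \<open>
  Functions on the \<open>N\<close>-th roots of unity that are given by one integer polynomial. Inverses of powers of \<open>z\<close>
  are included because \<open>z\<^bsup>-1\<^esup> = z\<^bsup>N-1\<^esup>\<close>.
\<close>

definition poly_rep :: "nat \<Rightarrow> (complex \<Rightarrow> complex) \<Rightarrow> bool" where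
  "poly_rep N f \<longleftrightarrow> (\<exists>P. \<forall>z. z ^ N = 1 \<longrightarrow> f z = int_eval P z)"

lemma poly_repI: "(\<And>z. z ^ N = 1 \<Longrightarrow> f z = int_eval P z) \<Longrightarrow> poly_rep N f"
  by (auto simp: poly_rep_def)

lemma poly_rep_of_int: "poly_rep N (\<lambda>z. of_int c)"
  by (rule poly_repI[of _ _ "of_int c"]) simp

lemma poly_rep_0 [simp]: "poly_rep N (\<lambda>z. 0)" and poly_rep_1 [simp]: "poly_rep N (\<lambda>z. 1)"
  using poly_rep_of_int[of N 0] poly_rep_of_int[of N 1] by simp_all

lemma poly_rep_add: "poly_rep N f \<Longrightarrow> poly_rep N g \<Longrightarrow> poly_rep N (\<lambda>z. f z + g z)"
  unfolding poly_rep_def by (metis int_eval_simps(3))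

lemma poly_rep_mult: "poly_rep N f \<Longrightarrow> poly_rep N g \<Longrightarrow> poly_rep N (\<lambda>z. f z * g z)"
  unfolding poly_rep_def by (metis int_eval_simps(6))

lemma poly_rep_diff: "poly_rep N f \<Longrightarrow> poly_rep N g \<Longrightarrow> poly_rep N (\<lambda>z. f z - g z)"
  unfolding poly_rep_def by (metis int_eval_simps(4))

lemma poly_rep_minus: "poly_rep N f \<Longrightarrow> poly_rep N (\<lambda>z. - f z)"
  unfolding poly_rep_def by (metis int_eval_simps(5))

lemma poly_rep_power: "poly_rep N f \<Longrightarrow> poly_rep N (\<lambda>z. f z ^ m)"
  unfolding poly_rep_def by (metis int_eval_simps(7))

lemma poly_rep_var_power: "poly_rep N (\<lambda>z. z ^ k)"
  by (rule poly_repI[of _ _ "Polynomial.monom 1 k"]) simp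

lemma poly_rep_sum: "(\<And>x. x \<in> A \<Longrightarrow> poly_rep N (f x)) \<Longrightarrow> poly_rep N (\<lambda>z. \<Sum>x\<in>A. f x z)"
  by (induction A rule: infinite_finite_induct) (auto intro: poly_rep_add)

lemma poly_rep_prod: "(\<And>x. x \<in> A \<Longrightarrow> poly_rep N (f x)) \<Longrightarrow> poly_rep N (\<lambda>z. \<Prod>x\<in>A. f x z)"
  by (induction A rule: infinite_finite_induct) (auto intro: poly_rep_mult)

lemma poly_rep_if: "poly_rep N f \<Longrightarrow> poly_rep N g \<Longrightarrow> poly_rep N (\<lambda>z. if b then f z else g z)"
  by (cases b) simp_all

lemma poly_rep_inverse_power:
  assumes "N > 0"
  shows "poly_rep N (\<lambda>z. inverse (z ^ k))"
proof (rule poly_repI)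
  fix z :: complex assume z: "z ^ N = 1"
  have "z ^ (N - 1) * z = 1" unfolding power_minus_mult[OF assms] by (rule z)
  then have "inverse z = z ^ (N - 1)" by (metis inverse_unique mult.commute)
  then show "inverse (z ^ k) = int_eval (Polynomial.monom 1 ((N - 1) * k)) z"
    by (simp add: power_inverse[symmetric] power_mult)
qed

lemma poly_rep_refl_coeff:
  assumes "N > 0"
  shows "poly_rep N (\<lambda>z. refl_coeff n (z ^ A) (z ^ B) (\<lambda>k. z ^ C k) I)"
  unfolding refl_coeff_def divide_inverse inverse_mult_distrib
  by (intro poly_rep_if poly_rep_mult poly_rep_add poly_rep_diff poly_rep_prod poly_rep_power poly_rep_minus
      poly_rep_var_power poly_rep_inverse_power poly_rep_1 assms)

lemma poly_rep_generator:
  assumes "N > 0" "i < 2 ^ n" "j < 2 ^ n"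
  shows "poly_rep N (\<lambda>z. generator n (z ^ A) (z ^ B) (\<lambda>k. z ^ C k) k $$ (i, j))"
proof (cases "k = 0")
  case True
  show ?thesis unfolding generator_def if_P[OF True] refl_mat_index[OF assms(2,3)]
    by (intro poly_rep_if poly_rep_diff poly_rep_refl_coeff poly_rep_0 poly_rep_1 assms)
next
  case False
  show ?thesis using False unfolding generator_def if_not_P[OF False] circuit_mat_index[OF assms(2,3)]
    by (intro poly_rep_if poly_rep_add poly_rep_minus poly_rep_inverse_power poly_rep_0 poly_rep_1 assms)
qed

lemma poly_rep_word_mat:
  assumes "N > 0" "i < 2 ^ n" "j < 2 ^ n"
  shows "poly_rep N (\<lambda>z. word_mat n (z ^ A) (z ^ B) (\<lambda>k. z ^ C k) ks $$ (i, j))"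
  using assms(2)
proof (induction ks arbitrary: i)
  case Nil
  then show ?case using assms(3) by simp
next
  case (Cons k ks)
  have "word_mat n \<alpha> \<beta> \<gamma> (k # ks) $$ (i, j) =
    (\<Sum>l<2 ^ n. generator n \<alpha> \<beta> \<gamma> k $$ (i, l) * word_mat n \<alpha> \<beta> \<gamma> ks $$ (l, j))" for \<alpha> \<beta> \<gamma>
    using Cons.prems assms(3) carrier_matD[OF generator_carrier[of n \<alpha> \<beta> \<gamma> k]] carrier_matD[OF word_mat_carrier[of n \<alpha> \<beta> \<gamma> ks]]
    by (simp add: scalar_prod_def lessThan_atLeast0)
  then show ?case
    using Cons by (simp only:) (intro poly_rep_sum poly_rep_mult poly_rep_generator Cons.IH assms(1) Cons.prems; simp)
qed

text \<open>
  The entries of a word are polynomials in \<open>\<zeta>\<close>, and a relation between two words at \<open>\<zeta>\<close> persists at \<open>\<zeta>\<^sup>t\<close>. So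
  there are at most as many different words at \<open>\<zeta>\<^sup>t\<close> as at \<open>\<zeta>\<close>.
\<close>

lemma finite_words_conjugate:
  assumes N: "N > 0" "\<zeta> ^ N = 1" and t: "coprime t N"
    and fin: "finite (word_mats n (\<zeta> ^ A) (\<zeta> ^ B) (\<lambda>k. \<zeta> ^ C k))"
  shows "finite (word_mats n ((\<zeta> ^ t) ^ A) ((\<zeta> ^ t) ^ B) (\<lambda>k. (\<zeta> ^ t) ^ C k))"
  unfolding word_mats_def
proof (rule finite_image_factor[OF fin[unfolded word_mats_def]])
  fix ks ls
  assume eq: "word_mat n (\<zeta> ^ A) (\<zeta> ^ B) (\<lambda>k. \<zeta> ^ C k) ks = word_mat n (\<zeta> ^ A) (\<zeta> ^ B) (\<lambda>k. \<zeta> ^ C k) ls"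
  have tN: "(\<zeta> ^ t) ^ N = 1" using N(2) by (metis power_mult mult.commute power_one)
  show "word_mat n ((\<zeta> ^ t) ^ A) ((\<zeta> ^ t) ^ B) (\<lambda>k. (\<zeta> ^ t) ^ C k) ks
      = word_mat n ((\<zeta> ^ t) ^ A) ((\<zeta> ^ t) ^ B) (\<lambda>k. (\<zeta> ^ t) ^ C k) ls"
  proof (rule eq_matI)
    fix i j
    assume ij: "i < dim_row (word_mat n ((\<zeta> ^ t) ^ A) ((\<zeta> ^ t) ^ B) (\<lambda>k. (\<zeta> ^ t) ^ C k) ls)"
      "j < dim_col (word_mat n ((\<zeta> ^ t) ^ A) ((\<zeta> ^ t) ^ B) (\<lambda>k. (\<zeta> ^ t) ^ C k) ls)"
    then have ij': "i < 2 ^ n" "j < 2 ^ n" using carrier_matD[OF word_mat_carrier] by metis+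
    obtain P where P: "\<And>z. z ^ N = 1 \<Longrightarrow> word_mat n (z ^ A) (z ^ B) (\<lambda>k. z ^ C k) ks $$ (i, j) = int_eval P z"
      using poly_rep_word_mat[OF N(1) ij', of A B C ks] unfolding poly_rep_def by blast
    obtain Q where Q: "\<And>z. z ^ N = 1 \<Longrightarrow> word_mat n (z ^ A) (z ^ B) (\<lambda>k. z ^ C k) ls $$ (i, j) = int_eval Q z"
      using poly_rep_word_mat[OF N(1) ij', of A B C ls] unfolding poly_rep_def by blast
    have "int_eval (P - Q) \<zeta> = 0" using P[OF N(2)] Q[OF N(2)] eq by simp
    then have "int_eval (P - Q) (\<zeta> ^ t) = 0" by (rule int_eval_root_power_coprime[OF N(2,1) _ t])
    then show "word_mat n ((\<zeta> ^ t) ^ A) ((\<zeta> ^ t) ^ B) (\<lambda>k. (\<zeta> ^ t) ^ C k) ks $$ (i, j)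
      = word_mat n ((\<zeta> ^ t) ^ A) ((\<zeta> ^ t) ^ B) (\<lambda>k. (\<zeta> ^ t) ^ C k) ls $$ (i, j)"
      using P[OF tN] Q[OF tN] by simp
  qed (metis carrier_matD word_mat_carrier)+
qed

lemma finite_words_if_bounded:
  assumes N: "N > 0"
  defines "\<zeta> \<equiv> e2pi (1 / of_nat N)"
  assumes bd: "\<And>t ks i j. t \<in> units_mod N \<Longrightarrow> set ks \<subseteq> {0..n} \<Longrightarrow> i < 2 ^ n \<Longrightarrow> j < 2 ^ n \<Longrightarrow>
      norm (word_mat n ((\<zeta> ^ t) ^ A) ((\<zeta> ^ t) ^ B) (\<lambda>k. (\<zeta> ^ t) ^ C k) ks $$ (i, j)) \<le> R"
  shows "finite (word_mats n (\<zeta> ^ A) (\<zeta> ^ B) (\<lambda>k. \<zeta> ^ C k))"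
proof -
  define E where "E = {int_eval P \<zeta> | P. \<forall>t\<in>units_mod N. norm (int_eval P (\<zeta> ^ t)) \<le> R}"
  have finE: "finite E" unfolding E_def \<zeta>_def by (rule finite_bounded_conjugates[OF N])
  have zN: "\<zeta> ^ N = 1" unfolding \<zeta>_def e2pi_of_nat_mult[symmetric] using N by simp
  define D where "D = {..<(2::nat) ^ n} \<times> {..<(2::nat) ^ n}"
  have "word_mats n (\<zeta> ^ A) (\<zeta> ^ B) (\<lambda>k. \<zeta> ^ C k) \<subseteq> (\<lambda>f. mat (2 ^ n) (2 ^ n) f) ` PiE D (\<lambda>_. E)"
  proof
    fix M assume "M \<in> word_mats n (\<zeta> ^ A) (\<zeta> ^ B) (\<lambda>k. \<zeta> ^ C k)"
    then obtain ks where ks: "set ks \<subseteq> {0..n}" "M = word_mat n (\<zeta> ^ A) (\<zeta> ^ B) (\<lambda>k. \<zeta> ^ C k) ks"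
      unfolding word_mats_def by auto
    have ent: "M $$ (i, j) \<in> E" if ij: "i < 2 ^ n" "j < 2 ^ n" for i j
    proof -
      obtain P where P: "\<And>z. z ^ N = 1 \<Longrightarrow> word_mat n (z ^ A) (z ^ B) (\<lambda>k. z ^ C k) ks $$ (i, j) = int_eval P z"
        using poly_rep_word_mat[OF N ij, of A B C ks] unfolding poly_rep_def by blast
      have "(\<zeta> ^ t) ^ N = 1" for t using zN by (metis power_mult mult.commute power_one)
      then have "norm (int_eval P (\<zeta> ^ t)) \<le> R" if "t \<in> units_mod N" for t
        using bd[OF that ks(1) ij] P by metis
      then show ?thesis unfolding E_def ks(2) P[OF zN] by blast
    qed
    show "M \<in> (\<lambda>f. mat (2 ^ n) (2 ^ n) f) ` PiE D (\<lambda>_. E)"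
    proof (rule image_eqI)
      show "M = mat (2 ^ n) (2 ^ n) (restrict (\<lambda>ij. M $$ ij) D)"
        using carrier_matD[OF word_mat_carrier[of n "\<zeta> ^ A" "\<zeta> ^ B" "\<lambda>k. \<zeta> ^ C k" ks]] ks(2)
        by (intro eq_matI) (auto simp: D_def)
      show "restrict (\<lambda>ij. M $$ ij) D \<in> PiE D (\<lambda>_. E)"
        using ent by (auto simp: D_def)
    qed
  qed
  moreover have "finite (PiE D (\<lambda>_. E))" using finE by (intro finite_PiE) (simp_all add: D_def)
  ultimately show ?thesis using finite_subset by blast
qed

context nonzero_params
begin

text \<open>
  The sum is \<open>1 - \<delta>\<close> with \<open>\<delta>\<close> the determinant of \<open>M\<^sub>0\<close>; what matters is that \<open>\<delta>\<close> has absolute value \<open>1\<close> if the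
  parameters have.
\<close>

lemma sum_refl_weight:
  assumes g1: "\<And>k. k \<in> {1..n} \<Longrightarrow> \<gamma> k \<noteq> 1"
  shows "(\<Sum>S\<in>Pow {1..n}. refl_weight n \<alpha> \<beta> \<gamma> S) = 1 + (-1) ^ n * (\<Prod>k=1..n. \<gamma> k) / (\<alpha> * \<beta>)"
proof -
  define K where "K = (\<Prod>k=1..n. \<gamma> k / (\<gamma> k - 1))"
  have K1: "K * (\<Prod>k=1..n. 1 - \<gamma> k) = (-1) ^ n * (\<Prod>k=1..n. \<gamma> k)"
  proof -
    have "K * (\<Prod>k=1..n. 1 - \<gamma> k) = (\<Prod>k=1..n. \<gamma> k / (\<gamma> k - 1) * (1 - \<gamma> k))" unfolding K_def prod.distrib ..
    also have "\<dots> = (\<Prod>k=1..n. - 1 * \<gamma> k)" using g1 by (intro prod.cong refl) (simp add: field_simps)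
    also have "\<dots> = (-1) ^ n * (\<Prod>k=1..n. \<gamma> k)" unfolding prod.distrib by simp
    finally show ?thesis .
  qed
  have K2: "K * (\<Prod>k=1..n. 1 - inverse (\<gamma> k)) = 1"
  proof -
    have "K * (\<Prod>k=1..n. 1 - inverse (\<gamma> k)) = (\<Prod>k=1..n. \<gamma> k / (\<gamma> k - 1) * (1 - inverse (\<gamma> k)))" unfolding K_def prod.distrib ..
    also have "\<dots> = (\<Prod>k=1..n. 1)" using g1 gnz by (intro prod.cong refl) (simp add: field_simps)
    finally show ?thesis by simp
  qed
  have "refl_weight n \<alpha> \<beta> \<gamma> S = K / (\<alpha> * \<beta>) * ((-1) ^ card S * prod \<gamma> S) + K * ((-1) ^ card S * prod (\<lambda>k. inverse (\<gamma> k)) S)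
       - K * (\<alpha> + \<beta>) / (\<alpha> * \<beta>) * ((-1) ^ card S * prod (\<lambda>_. 1) S)" if S: "S \<subseteq> {1..n}" for S
  proof -
    define p where "p = prod \<gamma> S"
    have "finite S" using S finite_subset by blast
    then have p: "p \<noteq> 0" using gnz S by (auto simp: p_def prod_zero_iff)
    have i: "prod (\<lambda>k. inverse (\<gamma> k)) S = inverse p" using prod_inversef[of \<gamma> S] by (simp add: p_def o_def)
    have e: "(p - \<alpha>) * (p - \<beta>) / p = p + \<alpha> * \<beta> * inverse p - (\<alpha> + \<beta>)" using p by (simp add: field_simps)
    show ?thesis unfolding refl_weight_def K_def[symmetric] i p_def[symmetric] e
      using nz by (simp add: field_simps)
  qed
  then have "(\<Sum>S\<in>Pow {1..n}. refl_weight n \<alpha> \<beta> \<gamma> S) =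
     (\<Sum>S\<in>Pow {1..n}. K / (\<alpha> * \<beta>) * ((-1) ^ card S * prod \<gamma> S) + K * ((-1) ^ card S * prod (\<lambda>k. inverse (\<gamma> k)) S)
       - K * (\<alpha> + \<beta>) / (\<alpha> * \<beta>) * ((-1) ^ card S * prod (\<lambda>_. 1) S))"
    by (intro sum.cong refl) simp
  also have "\<dots> = K / (\<alpha> * \<beta>) * (\<Prod>k=1..n. 1 - \<gamma> k) + K * (\<Prod>k=1..n. 1 - inverse (\<gamma> k)) - K * (\<alpha> + \<beta>) / (\<alpha> * \<beta>) * (\<Prod>k=1..n. 1 - 1)"
    unfolding sum_subtractf sum.distrib sum_distrib_left[symmetric] sum_sign_prod[OF finite_atLeastAtMost] ..
  also have "(\<Prod>k=1..n. 1 - 1 :: complex) = 0" using n by simp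
  also have "K / (\<alpha> * \<beta>) * (\<Prod>k=1..n. 1 - \<gamma> k) = (-1) ^ n * (\<Prod>k=1..n. \<gamma> k) / (\<alpha> * \<beta>)" using K1 by simp
  finally show ?thesis unfolding K2 by simp
qed

text \<open>
  The diagonal form \<open>Q\<close> with the weights \<open>w\<^sub>I / w\<^sub>\<emptyset>\<close> is invariant under all generators; for \<open>M\<^sub>0\<close> this is the identity
  \<open>w_id\<close>, equivalent to \<open>|\<delta>| = 1\<close>. As the weights are positive, \<open>Q\<close> bounds the coordinates of the image of a
  unit vector under any word.
\<close>

lemma words_bounded:
  assumes g1: "\<And>k. k \<in> {1..n} \<Longrightarrow> \<gamma> k \<noteq> 1"
    and norms: "norm \<alpha> = 1" "norm \<beta> = 1" "\<And>k. k \<in> {1..n} \<Longrightarrow> norm (\<gamma> k) = 1"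
    and w0: "refl_weight n \<alpha> \<beta> \<gamma> {} \<noteq> 0"
    and pos: "\<And>I. I \<subseteq> {1..n} \<Longrightarrow> \<exists>r>0. refl_weight n \<alpha> \<beta> \<gamma> I = of_real r * refl_weight n \<alpha> \<beta> \<gamma> {}"
  shows "\<exists>R. \<forall>ks i j. set ks \<subseteq> {0..n} \<longrightarrow> i < 2 ^ n \<longrightarrow> j < 2 ^ n \<longrightarrow> norm (word_mat n \<alpha> \<beta> \<gamma> ks $$ (i, j)) \<le> R"
proof -
  define w where "w = refl_weight n \<alpha> \<beta> \<gamma> {}"
  obtain r where r: "\<And>I. I \<subseteq> {1..n} \<Longrightarrow> r I > 0 \<and> refl_weight n \<alpha> \<beta> \<gamma> I = of_real (r I) * w"
    unfolding w_def using pos by metis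
  define s where "s = (\<Sum>I\<in>Pow {1..n}. r I)"
  have s0: "s > 0" unfolding s_def using r by (intro sum_pos) auto
  define Q where "Q y = (\<Sum>I\<in>Pow {1..n}. of_real (r I) * (y I * cnj (y I)))" for y
  define \<delta> where "\<delta> = - ((-1) ^ n * (\<Prod>k=1..n. \<gamma> k) / (\<alpha> * \<beta>))"
  have dn: "\<delta> * cnj \<delta> = 1"
  proof -
    have "norm \<delta> = 1" unfolding \<delta>_def using norms by (simp add: norm_mult norm_divide norm_power flip: prod_norm)
    then show ?thesis by (simp flip: complex_norm_square)
  qed
  have "(\<Sum>I\<in>Pow {1..n}. refl_weight n \<alpha> \<beta> \<gamma> I) = of_real s * w"
    unfolding s_def of_real_sum sum_distrib_right using r by (intro sum.cong refl) simp
  then have sw: "\<delta> = 1 - of_real s * w" using sum_refl_weight[OF g1] by (simp add: \<delta>_def)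
  have w_id: "w + cnj w = w * cnj w * of_real s"
  proof -
    have "(1 - of_real s * w) * (1 - of_real s * cnj w) = 1" using dn unfolding sw by simp
    then have "of_real s * (w + cnj w) = of_real s * (w * cnj w * of_real s)" by (simp add: algebra_simps)
    then show ?thesis using s0 by simp
  qed
  have Qrefl: "Q (\<lambda>I. y I - (\<Sum>J\<in>Pow {1..n}. refl_weight n \<alpha> \<beta> \<gamma> J * y J)) = Q y" for y
  proof -
    define X where "X = (\<Sum>J\<in>Pow {1..n}. of_real (r J) * y J)"
    have m: "(\<Sum>J\<in>Pow {1..n}. refl_weight n \<alpha> \<beta> \<gamma> J * y J) = w * X"
      unfolding X_def sum_distrib_left using r by (intro sum.cong refl) simp
    have cX: "cnj X = (\<Sum>J\<in>Pow {1..n}. of_real (r J) * cnj (y J))" by (simp add: X_def)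
    have "Q (\<lambda>I. y I - w * X) = (\<Sum>I\<in>Pow {1..n}. of_real (r I) * (y I * cnj (y I))
        - cnj (w * X) * (of_real (r I) * y I) - (w * X) * (of_real (r I) * cnj (y I)) + (w * X * cnj (w * X)) * of_real (r I))"
      unfolding Q_def by (intro sum.cong refl) (simp add: algebra_simps)
    also have "\<dots> = Q y - cnj (w * X) * X - (w * X) * cnj X + (w * X * cnj (w * X)) * of_real s"
      unfolding sum.distrib sum_subtractf sum_distrib_left[symmetric] X_def[symmetric] cX[symmetric] Q_def s_def of_real_sum ..
    also have "\<dots> = Q y + X * cnj X * (w * cnj w * of_real s - (w + cnj w))" by (simp add: algebra_simps)
    also have "\<dots> = Q y" unfolding w_id by simp
    finally show ?thesis unfolding m .
  qed
  have Qcirc: "Q (\<lambda>I. (if k \<in> I then inverse (\<gamma> k) else 1) * y I) = Q y" if k: "k \<in> {1..n}" for k y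
  proof -
    have "\<gamma> k * cnj (\<gamma> k) = 1" using norms(3)[OF k] by (simp flip: complex_norm_square)
    then have "inverse (\<gamma> k) * cnj (inverse (\<gamma> k)) = 1" using gnz[OF k] by (simp add: field_simps)
    then have 1: "(if k \<in> I then inverse (\<gamma> k) else 1) * cnj (if k \<in> I then inverse (\<gamma> k) else 1) = 1" for I
      by simp
    have "((if k \<in> I then inverse (\<gamma> k) else 1) * y I) * cnj ((if k \<in> I then inverse (\<gamma> k) else 1) * y I) = y I * cnj (y I)" for I
    proof -
      have "(d * u) * cnj (d * u) = (d * cnj d) * (u * cnj u)" for d u by (simp add: mult_ac)
      then show ?thesis by (simp only: 1 mult_1_left)
    qed
    then show ?thesis unfolding Q_def by (simp only:)
  qed
  have words: "\<exists>y'. act n (word_mat n \<alpha> \<beta> \<gamma> ks) (embed n \<gamma> y) = embed n \<gamma> y' \<and> Q y' = Q y" if "set ks \<subseteq> {0..n}" for ks y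
    using that
  proof (induction ks)
    case Nil
    have "act n (1\<^sub>m (2 ^ n)) (embed n \<gamma> y) = embed n \<gamma> y" by (auto simp: act_one embed_def)
    then show ?case by auto
  next
    case (Cons k ks)
    then obtain y' where y': "act n (word_mat n \<alpha> \<beta> \<gamma> ks) (embed n \<gamma> y) = embed n \<gamma> y'" "Q y' = Q y" by auto
    have e: "act n (word_mat n \<alpha> \<beta> \<gamma> (k # ks)) (embed n \<gamma> y) = act n (generator n \<alpha> \<beta> \<gamma> k) (embed n \<gamma> y')"
      by (simp add: act_mult[OF generator_carrier word_mat_carrier] y'(1))
    show ?case
    proof (cases "k = 0")
      case True
      have "act n (refl_mat n \<alpha> \<beta> \<gamma>) (embed n \<gamma> y') = embed n \<gamma> (\<lambda>I. y' I - (\<Sum>J\<in>Pow {1..n}. refl_weight n \<alpha> \<beta> \<gamma> J * y' J))"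
        by (rule act_refl_embed) (use g1 gnz nz in auto)
      then show ?thesis unfolding e using True Qrefl[of y'] y'(2) by (auto simp: generator_def)
    next
      case False
      then have k: "k \<in> {1..n}" using Cons.prems by auto
      have "act n (circuit_mat n \<gamma> k) (embed n \<gamma> y') = embed n \<gamma> (\<lambda>I. (if k \<in> I then inverse (\<gamma> k) else 1) * y' I)"
        by (rule act_circuit_embed) (use k g1 gnz in auto)
      then show ?thesis unfolding e using False Qcirc[OF k, of y'] y'(2) by (auto simp: generator_def)
    qed
  qed
  define q where "q T = norm (Q (coords n \<gamma> (delta_fun T)))" for T
  define b where "b S T = (\<Sum>I\<in>Pow {1..n}. sqrt (q T / r I) * norm (eigvec n \<gamma> I S))" for S T
  have b0: "b S T \<ge> 0" for S T
  proof -
    have "sqrt (q T / r I) \<ge> 0" if "I \<subseteq> {1..n}" for I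
      using r[OF that] by (simp add: q_def)
    then show ?thesis unfolding b_def by (intro sum_nonneg mult_nonneg_nonneg) simp_all
  qed
  have entry: "norm (word_mat n \<alpha> \<beta> \<gamma> ks $$ (set_index S, set_index T)) \<le> b S T"
    if ks: "set ks \<subseteq> {0..n}" and S: "S \<subseteq> {1..n}" and T: "T \<subseteq> {1..n}" for ks S T
  proof -
    have emb: "embed n \<gamma> (coords n \<gamma> (delta_fun T)) = delta_fun T"
    proof
      fix U
      have "embed n \<gamma> (coords n \<gamma> (delta_fun T)) U = (if U \<subseteq> {1..n} then delta_fun T U else 0)"
        by (rule embed_coords) (use g1 in auto)
      then show "embed n \<gamma> (coords n \<gamma> (delta_fun T)) U = delta_fun T U" using T by (auto simp: delta_fun_def)
    qed
    obtain y' where y': "act n (word_mat n \<alpha> \<beta> \<gamma> ks) (delta_fun T) = embed n \<gamma> y'" "Q y' = Q (coords n \<gamma> (delta_fun T))"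
      using words[OF ks, of "coords n \<gamma> (delta_fun T)"] unfolding emb by blast
    have "word_mat n \<alpha> \<beta> \<gamma> ks $$ (set_index S, set_index T) = act n (word_mat n \<alpha> \<beta> \<gamma> ks) (delta_fun T) S"
      using S T by (simp add: act_def delta_fun_def if_distrib[of "\<lambda>u. _ * u"] cong: if_cong)
    also have "\<dots> = (\<Sum>I\<in>Pow {1..n}. y' I * eigvec n \<gamma> I S)" unfolding y'(1) using S by (simp add: embed_def)
    finally have ent: "word_mat n \<alpha> \<beta> \<gamma> ks $$ (set_index S, set_index T) = (\<Sum>I\<in>Pow {1..n}. y' I * eigvec n \<gamma> I S)" .
    have rp: "r I * (norm (y' I))\<^sup>2 \<ge> 0" if "I \<subseteq> {1..n}" for I
      using r[OF that] by simp
    have yb: "norm (y' I) \<le> sqrt (q T / r I)" if I: "I \<subseteq> {1..n}" for I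
    proof -
      have "Q y' = of_real (\<Sum>I\<in>Pow {1..n}. r I * (norm (y' I))\<^sup>2)" by (simp add: Q_def flip: complex_norm_square)
      then have "norm (Q y') = \<bar>\<Sum>I\<in>Pow {1..n}. r I * (norm (y' I))\<^sup>2\<bar>" by (simp only: norm_of_real)
      also have "\<dots> = (\<Sum>I\<in>Pow {1..n}. r I * (norm (y' I))\<^sup>2)" using rp by (intro abs_of_nonneg sum_nonneg) simp
      finally have "q T = (\<Sum>I\<in>Pow {1..n}. r I * (norm (y' I))\<^sup>2)" unfolding q_def y'(2)[symmetric] .
      moreover have "r I * (norm (y' I))\<^sup>2 \<le> (\<Sum>I\<in>Pow {1..n}. r I * (norm (y' I))\<^sup>2)"
        using rp I by (intro member_le_sum) simp_all
      ultimately have "(norm (y' I))\<^sup>2 \<le> q T / r I" using r[OF I] by (simp add: field_simps)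
      then show ?thesis by (rule real_le_rsqrt)
    qed
    show ?thesis unfolding ent b_def
    proof (rule sum_norm_le)
      fix I assume "I \<in> Pow {1..n}"
      then show "norm (y' I * eigvec n \<gamma> I S) \<le> sqrt (q T / r I) * norm (eigvec n \<gamma> I S)"
        using yb[of I] by (simp add: norm_mult mult_right_mono)
    qed
  qed
  show ?thesis
  proof (intro exI allI impI)
    fix ks :: "nat list" and i j :: nat assume ks: "set ks \<subseteq> {0..n}" and "i < 2 ^ n" "j < 2 ^ n"
    then have "i \<in> set_index ` Pow {1..n}" "j \<in> set_index ` Pow {1..n}"
      unfolding bij_betw_imp_surj_on[OF bij_betw_set_index[of n]] by simp_all
    then obtain S T where ST: "S \<subseteq> {1..n}" "i = set_index S" "T \<subseteq> {1..n}" "j = set_index T" by auto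
    have "norm (word_mat n \<alpha> \<beta> \<gamma> ks $$ (i, j)) \<le> b S T" unfolding ST(2,4) by (rule entry[OF ks ST(1,3)])
    also have "\<dots> \<le> (\<Sum>T\<in>Pow {1..n}. b S T)" using ST b0 by (intro member_le_sum) auto
    also have "\<dots> \<le> (\<Sum>S\<in>Pow {1..n}. \<Sum>T\<in>Pow {1..n}. b S T)"
      using ST b0 by (intro member_le_sum[where f = "\<lambda>S. \<Sum>T\<in>Pow {1..n}. b S T"] sum_nonneg) auto
    finally show "norm (word_mat n \<alpha> \<beta> \<gamma> ks $$ (i, j)) \<le> (\<Sum>S\<in>Pow {1..n}. \<Sum>T\<in>Pow {1..n}. b S T)" .
  qed
qed

end


lemma refl_coeff_swap: "refl_coeff n \<alpha> \<beta> \<gamma> I = refl_coeff n \<beta> \<alpha> \<gamma> I"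
  unfolding refl_coeff_def mult.commute[of "\<alpha> - 1" "\<beta> - 1"] mult.commute[of \<alpha> \<beta>] ..

lemma Mon_swap: "Mon n \<alpha> \<beta> \<gamma> = Mon n \<beta> \<alpha> \<gamma>"
  unfolding Mon_def refl_mat_def using refl_coeff_swap[of n \<alpha> \<beta> \<gamma>] by simp

lemma Mon_cong:
  assumes "\<alpha> = \<alpha>'" "\<beta> = \<beta>'" "\<And>k. k \<in> {1..n} \<Longrightarrow> \<gamma> k = \<gamma>' k"
  shows "Mon n \<alpha> \<beta> \<gamma> = Mon n \<alpha>' \<beta>' \<gamma>'"
proof -
  have "circuit_mat n \<gamma> ` {1..n} = circuit_mat n \<gamma>' ` {1..n}"
  proof (rule image_cong[OF refl])
    fix k assume "k \<in> {1..n}"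
    then show "circuit_mat n \<gamma> k = circuit_mat n \<gamma>' k" unfolding circuit_mat_def by (simp only: assms(3))
  qed
  moreover have "(\<Prod>k=1..n. f (\<gamma> k) k) = (\<Prod>k=1..n. f (\<gamma>' k) k)" for f :: "complex \<Rightarrow> nat \<Rightarrow> complex"
    using assms(3) by (intro prod.cong) simp_all
  from this[of "\<lambda>g k. g"] this[of "\<lambda>g k. g ^ digit _ k"] this[of "\<lambda>g k. g ^ (1 - digit _ k)"]
  have "refl_coeff n \<alpha> \<beta> \<gamma> I = refl_coeff n \<alpha>' \<beta>' \<gamma>' I" for I
    unfolding refl_coeff_def assms(1,2) by (simp only:)
  then have "refl_mat n \<alpha> \<beta> \<gamma> = refl_mat n \<alpha>' \<beta>' \<gamma>'" by (simp add: refl_mat_def)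
  ultimately show ?thesis by (simp add: Mon_def)
qed

section \<open>The monodromy group in terms of real exponents\<close>

lemma e2pi_diff_factor:
  "e2pi (of_real s) - e2pi (of_real a) = 2 * \<i> * e2pi (of_real ((s + a) / 2)) * of_real (sin (pi * (s - a)))"
proof -
  have 1: "e2pi (of_real s) = e2pi (of_real ((s + a) / 2)) * cis (pi * (s - a))"
    "e2pi (of_real a) = e2pi (of_real ((s + a) / 2)) * cis (- (pi * (s - a)))"
    unfolding e2pi_of_real cis_mult by (intro arg_cong[of _ _ cis]; simp add: field_simps)+
  have 2: "cis u - cis (- u) = 2 * \<i> * of_real (sin u)" for u by (simp add: complex_eq_iff)
  have "e2pi (of_real s) - e2pi (of_real a) = e2pi (of_real ((s + a) / 2)) * (cis (pi * (s - a)) - cis (- (pi * (s - a))))"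
    by (simp only: 1 right_diff_distrib)
  then show ?thesis unfolding 2 by (simp only: mult_ac)
qed

lemma e2pi_product_factor:
  "(e2pi (of_real s) - e2pi (of_real a)) * (e2pi (of_real s) - e2pi (of_real b)) / e2pi (of_real s)
    = - 4 * e2pi (of_real ((a + b) / 2)) * of_real (sin_prod a b s)"
proof -
  have "e2pi (of_real ((s + a) / 2)) * e2pi (of_real ((s + b) / 2)) = e2pi (of_real s) * e2pi (of_real ((a + b) / 2))"
    unfolding e2pi_add[symmetric] by (intro arg_cong[of _ _ e2pi]) (simp add: field_simps)
  moreover have "(u * p * x) * (u * q * y) = (u * u) * (p * q) * (x * y)" for u p q x y :: complex
    by (simp only: mult_ac)
  moreover have "(2 * \<i>) * (2 * \<i>) = - 4" by (simp add: complex_eq_iff)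
  ultimately have "(2 * \<i> * e2pi (of_real ((s + a) / 2)) * x) * (2 * \<i> * e2pi (of_real ((s + b) / 2)) * y)
     = - 4 * (e2pi (of_real s) * e2pi (of_real ((a + b) / 2))) * (x * y)" for x y
    by (simp only:)
  moreover have "- 4 * (e * f) * z / e = - 4 * f * z" if "e \<noteq> 0" for e f z :: complex
    using that by (simp add: field_simps)
  ultimately show ?thesis
    unfolding e2pi_diff_factor[of s a] e2pi_diff_factor[of s b] sin_prod_def of_real_mult
    by (simp only: e2pi_nonzero not_False_eq_True)
qed

lemma e2pi_sum: "(\<Prod>k\<in>S. e2pi (f k)) = e2pi (sum f S)"
  by (induction S rule: infinite_finite_induct) (simp_all add: e2pi_add)

lemma refl_weight_e2pi:
  assumes g1: "\<And>k. k \<in> {1..n} \<Longrightarrow> e2pi (of_real (c k)) \<noteq> 1"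
  shows "\<exists>K. K \<noteq> 0 \<and> (\<forall>I. refl_weight n (e2pi (of_real a)) (e2pi (of_real b)) (\<lambda>k. e2pi (of_real (c k))) I
     = K * of_real ((-1) ^ card I * sin_prod a b (sum c I)))"
proof (intro exI conjI allI)
  define K where "K = (\<Prod>k=1..n. e2pi (of_real (c k)) / (e2pi (of_real (c k)) - 1)) / (e2pi (of_real a) * e2pi (of_real b))
     * (- 4 * e2pi (of_real ((a + b) / 2)))"
  show "K \<noteq> 0" using g1 by (auto simp: K_def prod_zero_iff)
  show "refl_weight n (e2pi (of_real a)) (e2pi (of_real b)) (\<lambda>k. e2pi (of_real (c k))) I
     = K * of_real ((-1) ^ card I * sin_prod a b (sum c I))" for I
    unfolding refl_weight_def e2pi_sum of_real_sum[symmetric] e2pi_product_factor K_def by simp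
qed

text \<open>
  The factor \<open>e((a + b) / 2)\<close> and the constant of \<open>refl_weight\<close> are the same for all subsets, so the ratios
  \<open>w\<^sub>I / w\<^sub>\<emptyset>\<close> are real and their signs are those of the sine products. The condition \<open>\<gamma>\<^sub>k \<noteq> 1\<close> follows from the sign condition:
  for integral \<open>c\<^sub>k\<close> the products for \<open>{}\<close> and \<open>{k}\<close> are equal, but have to have opposite signs.
\<close>

lemma alternating_iff_refl_weight:
  fixes n :: nat and a b :: real and c :: "nat \<Rightarrow> real"
  defines "\<gamma> \<equiv> \<lambda>k. e2pi (of_real (c k))"
  defines "w \<equiv> refl_weight n (e2pi (of_real a)) (e2pi (of_real b)) \<gamma>"
  shows "alternating n a b c \<longleftrightarrow> (\<forall>k\<in>{1..n}. \<gamma> k \<noteq> 1) \<and> w {} \<noteq> 0 \<and> (\<forall>I\<subseteq>{1..n}. \<exists>r>0. w I = of_real r * w {})"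
proof
  assume alt: "alternating n a b c"
  have alt': "(-1) ^ card I * sin_prod a b (sum c I) * sin_prod a b 0 > 0" if "I \<subseteq> {1..n}" for I
    using alt that unfolding alternating_def by blast
  have g1: "\<gamma> k \<noteq> 1" if k: "k \<in> {1..n}" for k
  proof
    assume "\<gamma> k = 1"
    then have "(of_real (c k) :: complex) \<in> \<int>" unfolding \<gamma>_def e2pi_eq_1_iff .
    then have "c k \<in> \<int>" by (metis Ints_cases Ints_of_int of_real_eq_iff of_real_of_int_eq)
    then have "sin_prod a b (c k) = sin_prod a b 0" using sin_prod_cong[of "c k" 0 a b] by simp
    then show False using alt'[of "{k}"] alt'[of "{}"] k by simp
  qed
  then obtain K where K: "K \<noteq> 0" "\<And>I. w I = K * of_real ((-1) ^ card I * sin_prod a b (sum c I))"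
    unfolding w_def \<gamma>_def using refl_weight_e2pi[of n c a b] by (auto simp: \<gamma>_def)
  have s0: "sin_prod a b 0 \<noteq> 0" using alt'[of "{}"] by auto
  show "(\<forall>k\<in>{1..n}. \<gamma> k \<noteq> 1) \<and> w {} \<noteq> 0 \<and> (\<forall>I\<subseteq>{1..n}. \<exists>r>0. w I = of_real r * w {})"
  proof (intro conjI ballI allI impI g1)
    show "w {} \<noteq> 0" unfolding K(2) using K(1) s0 by simp
    fix I assume I: "I \<subseteq> {1..n}"
    let ?x = "(-1) ^ card I * sin_prod a b (sum c I)"
    have "?x / sin_prod a b 0 > 0" using alt'[OF I] by (simp add: zero_less_divide_iff zero_less_mult_iff)
    moreover have "w I = of_real (?x / sin_prod a b 0) * w {}" unfolding K(2) using s0 by simp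
    ultimately show "\<exists>r>0. w I = of_real r * w {}" by blast
  qed
next
  assume R: "(\<forall>k\<in>{1..n}. \<gamma> k \<noteq> 1) \<and> w {} \<noteq> 0 \<and> (\<forall>I\<subseteq>{1..n}. \<exists>r>0. w I = of_real r * w {})"
  then obtain K where K: "K \<noteq> 0" "\<And>I. w I = K * of_real ((-1) ^ card I * sin_prod a b (sum c I))"
    unfolding w_def \<gamma>_def using refl_weight_e2pi[of n c a b] by auto
  have s0: "sin_prod a b 0 \<noteq> 0" using R K(2)[of "{}"] by auto
  show "alternating n a b c" unfolding alternating_def
  proof (intro allI impI)
    fix I assume "I \<subseteq> {1..n}"
    then obtain r where r: "r > 0" "w I = of_real r * w {}" using R by blast
    let ?x = "(-1) ^ card I * sin_prod a b (sum c I)"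
    have "K * of_real ?x = K * of_real (r * sin_prod a b 0)" using r(2) unfolding K(2) by simp
    then have "of_real ?x = (of_real (r * sin_prod a b 0) :: complex)" using K(1) by simp
    then have x: "?x = r * sin_prod a b 0" by (simp only: of_real_eq_iff)
    show "?x * sin_prod a b 0 > 0" unfolding x using r(1) s0 by (auto simp: mult.assoc zero_less_mult_iff linorder_neq_iff)
  qed
qed


lemma real_if_mult_Ints:
  assumes "N > 0" "of_nat N * (z :: complex) \<in> \<int>"
  shows "z = of_real (Re z)" "real N * Re z \<in> \<int>"
proof -
  obtain k where k: "of_nat N * z = of_int k" using assms(2) by (rule Ints_cases)
  have "Im (of_nat N * z) = 0" "Re (of_nat N * z) = of_int k" unfolding k by simp_all
  then have "Im z = 0" "real N * Re z = of_int k" using assms(1) by simp_all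
  then show "z = of_real (Re z)" "real N * Re z \<in> \<int>" by (simp_all add: complex_eq_iff)
qed

lemma exponent_of_root_of_unity:
  assumes N: "N > 0" and a: "real N * a \<in> \<int>"
  obtains A where "\<And>t. e2pi (of_real (real t * a)) = (e2pi (1 / of_nat N) ^ t) ^ A"
proof -
  obtain k where k: "real N * a = of_int k" using a by (rule Ints_cases)
  define A where "A = nat (k mod int N)"
  have "int A = k mod int N" using N by (simp add: A_def)
  then have "k = int A + int N * (k div int N)" by simp
  then have "real N * a = real A + real N * of_int (k div int N)" using k by (metis of_int_add of_int_mult of_int_of_nat_eq)
  then have aA: "a = real A / real N + of_int (k div int N)" using N by (simp add: field_simps)
  have "e2pi (of_real (real t * a)) = (e2pi (1 / of_nat N) ^ t) ^ A" for t
  proof -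
    have "of_real (real t * a) = (of_nat (t * A) * (1 / of_nat N) + of_int (int t * (k div int N)) :: complex)"
      unfolding aA by (simp add: distrib_left)
    then show ?thesis by (simp only: e2pi_add_of_int e2pi_of_nat_mult power_mult)
  qed
  then show thesis by (rule that)
qed

text \<open>
  The words at all conjugate parameters are bounded by \<open>words_bounded\<close>, so there are only finitely many at the given
  ones. Irreducibility holds because the weights do not vanish.
\<close>

lemma rationally_alternating_imp_finite_irreducible:
  assumes n: "n > 0" and R: "rationally_alternating n a b c N"
  shows "finite_irreducible (2 ^ n) (Mon n (e2pi (of_real a)) (e2pi (of_real b)) (\<lambda>k. e2pi (of_real (c k))))"
proof -
  have N: "N > 0" "real N * a \<in> \<int>" "real N * b \<in> \<int>" "\<And>k. k \<in> {1..n} \<Longrightarrow> real N * c k \<in> \<int>"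
    and alt: "\<And>t. coprime t N \<Longrightarrow> alternating n (real t * a) (real t * b) (\<lambda>k. real t * c k)"
    using R by (auto simp: rationally_alternating_def)
  define \<zeta> where "\<zeta> = e2pi (1 / of_nat N)"
  obtain A where A: "\<And>t. e2pi (of_real (real t * a)) = (\<zeta> ^ t) ^ A"
    using exponent_of_root_of_unity[OF N(1,2)] unfolding \<zeta>_def by blast
  obtain B where B: "\<And>t. e2pi (of_real (real t * b)) = (\<zeta> ^ t) ^ B"
    using exponent_of_root_of_unity[OF N(1,3)] unfolding \<zeta>_def by blast
  have "\<exists>C. \<forall>t. e2pi (of_real (real t * c k)) = (\<zeta> ^ t) ^ C" if "k \<in> {1..n}" for k
    using exponent_of_root_of_unity[OF N(1) N(4)[OF that]] unfolding \<zeta>_def by metis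
  then obtain C where C: "\<And>k t. k \<in> {1..n} \<Longrightarrow> e2pi (of_real (real t * c k)) = (\<zeta> ^ t) ^ C k" by metis
  have par: "nonzero_params n ((\<zeta> ^ t) ^ A) ((\<zeta> ^ t) ^ B) (\<lambda>k. (\<zeta> ^ t) ^ C k)" for t
    using n by unfold_locales (simp_all add: \<zeta>_def)
  have nrm: "norm ((\<zeta> ^ t) ^ m) = 1" for t m
    using norm_e2pi_of_real[of "1 / real N"] by (simp add: \<zeta>_def norm_power)
  have W: "(\<forall>k\<in>{1..n}. (\<zeta> ^ t) ^ C k \<noteq> 1) \<and> refl_weight n ((\<zeta> ^ t) ^ A) ((\<zeta> ^ t) ^ B) (\<lambda>k. (\<zeta> ^ t) ^ C k) {} \<noteq> 0 \<and>
     (\<forall>I\<subseteq>{1..n}. \<exists>r>0. refl_weight n ((\<zeta> ^ t) ^ A) ((\<zeta> ^ t) ^ B) (\<lambda>k. (\<zeta> ^ t) ^ C k) I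
        = of_real r * refl_weight n ((\<zeta> ^ t) ^ A) ((\<zeta> ^ t) ^ B) (\<lambda>k. (\<zeta> ^ t) ^ C k) {})"
    if t: "coprime t N" for t
  proof -
    let ?g = "\<lambda>k. e2pi (of_real (real t * c k))"
    have rw: "refl_weight n \<alpha> \<beta> ?g I = refl_weight n \<alpha> \<beta> (\<lambda>k. (\<zeta> ^ t) ^ C k) I" if "I \<subseteq> {1..n}" for I \<alpha> \<beta>
    proof -
      have "prod ?g I = (\<Prod>k\<in>I. (\<zeta> ^ t) ^ C k)" using that C by (intro prod.cong) auto
      moreover have "(\<Prod>k=1..n. ?g k / (?g k - 1)) = (\<Prod>k=1..n. (\<zeta> ^ t) ^ C k / ((\<zeta> ^ t) ^ C k - 1))"
        using C by (intro prod.cong) auto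
      ultimately show ?thesis by (simp only: refl_weight_def)
    qed
    note al = alt[OF t, unfolded alternating_iff_refl_weight A B]
    show ?thesis
    proof (intro conjI ballI allI impI)
      show "(\<zeta> ^ t) ^ C k \<noteq> 1" if "k \<in> {1..n}" for k
        using al C[OF that, of t] that by (metis (no_types, lifting))
      show "refl_weight n ((\<zeta> ^ t) ^ A) ((\<zeta> ^ t) ^ B) (\<lambda>k. (\<zeta> ^ t) ^ C k) {} \<noteq> 0"
        using al rw[of "{}"] by (metis (no_types, lifting) empty_subsetI)
      show "\<exists>r>0. refl_weight n ((\<zeta> ^ t) ^ A) ((\<zeta> ^ t) ^ B) (\<lambda>k. (\<zeta> ^ t) ^ C k) I
        = of_real r * refl_weight n ((\<zeta> ^ t) ^ A) ((\<zeta> ^ t) ^ B) (\<lambda>k. (\<zeta> ^ t) ^ C k) {}" if I: "I \<subseteq> {1..n}" for I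
        using al[THEN conjunct2, THEN conjunct2, rule_format, OF I] unfolding rw[OF I] rw[of "{}", OF empty_subsetI] .
    qed
  qed
  have "\<exists>R. \<forall>ks i j. set ks \<subseteq> {0..n} \<longrightarrow> i < 2 ^ n \<longrightarrow> j < 2 ^ n \<longrightarrow>
      norm (word_mat n ((\<zeta> ^ t) ^ A) ((\<zeta> ^ t) ^ B) (\<lambda>k. (\<zeta> ^ t) ^ C k) ks $$ (i, j)) \<le> R"
    if t: "t \<in> units_mod N" for t
  proof -
    have "coprime t N" using t by (simp add: units_mod_def)
    from W[OF this] show ?thesis by (intro nonzero_params.words_bounded[OF par] nrm) auto
  qed
  then obtain R where R: "\<And>t ks i j. t \<in> units_mod N \<Longrightarrow> set ks \<subseteq> {0..n} \<Longrightarrow> i < 2 ^ n \<Longrightarrow> j < 2 ^ n \<Longrightarrow>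
      norm (word_mat n ((\<zeta> ^ t) ^ A) ((\<zeta> ^ t) ^ B) (\<lambda>k. (\<zeta> ^ t) ^ C k) ks $$ (i, j)) \<le> R t" by metis
  have "finite (word_mats n (\<zeta> ^ A) (\<zeta> ^ B) (\<lambda>k. \<zeta> ^ C k))"
  proof (rule finite_words_if_bounded[OF N(1), folded \<zeta>_def])
    fix t ks and i j :: nat assume h: "t \<in> units_mod N" "set ks \<subseteq> {0..n}" "i < 2 ^ n" "j < 2 ^ n"
    have "R t \<le> (\<Sum>t\<in>units_mod N. \<bar>R t\<bar>)"
      using h(1) member_le_sum[of t "units_mod N" "\<lambda>t. \<bar>R t\<bar>"] by simp
    then show "norm (word_mat n ((\<zeta> ^ t) ^ A) ((\<zeta> ^ t) ^ B) (\<lambda>k. (\<zeta> ^ t) ^ C k) ks $$ (i, j)) \<le> (\<Sum>t\<in>units_mod N. \<bar>R t\<bar>)"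
      using R[OF h] by linarith
  qed
  then have fin: "finite (Mon n (\<zeta> ^ A) (\<zeta> ^ B) (\<lambda>k. \<zeta> ^ C k))"
    using nonzero_params.Mon_eq_words[OF par[of 1]] by simp
  have "coprime 1 N" by simp
  note W1 = W[OF this, unfolded power_one_right]
  have irr: "irreducible_on (2 ^ n) (Mon n (\<zeta> ^ A) (\<zeta> ^ B) (\<lambda>k. \<zeta> ^ C k))"
  proof (rule nonzero_params.irreducible_if_refl_weight_nonzero[OF par[of 1], unfolded power_one_right])
    show "\<zeta> ^ C k \<noteq> 1" if "k \<in> {1..n}" for k using W1 that by blast
    fix I assume "I \<subseteq> {1..n}"
    then obtain r where "r > 0" "refl_weight n (\<zeta> ^ A) (\<zeta> ^ B) (\<lambda>k. \<zeta> ^ C k) I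
        = of_real r * refl_weight n (\<zeta> ^ A) (\<zeta> ^ B) (\<lambda>k. \<zeta> ^ C k) {}" using W1 by blast
    then show "refl_weight n (\<zeta> ^ A) (\<zeta> ^ B) (\<lambda>k. \<zeta> ^ C k) I \<noteq> 0" using W1 by (metis mult_eq_0_iff of_real_eq_0_iff less_irrefl)
  qed
  have "Mon n (e2pi (of_real a)) (e2pi (of_real b)) (\<lambda>k. e2pi (of_real (c k))) = Mon n (\<zeta> ^ A) (\<zeta> ^ B) (\<lambda>k. \<zeta> ^ C k)"
    using A[of 1] B[of 1] C[of _ 1] by (intro Mon_cong) simp_all
  then show ?thesis using fin irr by (simp add: finite_irreducible_def)
qed

lemma coprime_power_eq_1:
  fixes x :: complex
  assumes "x ^ N = 1" "x ^ t = 1" "coprime t N"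
  shows "x = 1"
proof -
  obtain s where "[t * s = 1] (mod N)" using cong_solve_coprime_nat[OF assms(3)] by auto
  then have "x ^ (t * s mod N) = x ^ (1 mod N)" by (simp only: cong_def)
  then have "x ^ (t * s) = x ^ 1" unfolding power_mod_root[OF assms(1)] .
  then show ?thesis using assms(2) by (simp add: power_mult)
qed

text \<open>
  Irreducibility enters only through \<open>\<alpha> \<noteq> 1\<close> and \<open>\<beta> \<noteq> 1\<close>, that is, \<open>w\<^sub>\<emptyset> \<noteq> 0\<close>; positivity then gives \<open>w\<^sub>I \<noteq> 0\<close> for all
  \<open>I\<close>. That \<open>\<beta>\<close> is a root of unity follows by exchanging \<open>\<alpha>\<close> and \<open>\<beta>\<close>.
\<close>

lemma finite_irreducible_imp_rationally_alternating:
  assumes n: "n > 0" and F: "finite_irreducible (2 ^ n) (Mon_EC n a b c)"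
  shows "\<exists>N. a = of_real (Re a) \<and> b = of_real (Re b) \<and> (\<forall>k\<in>{1..n}. c k = of_real (Re (c k))) \<and>
     rationally_alternating n (Re a) (Re b) (\<lambda>k. Re (c k)) N"
proof -
  define \<alpha> \<beta> \<gamma> where "\<alpha> = e2pi a" and "\<beta> = e2pi b" and "\<gamma> = (\<lambda>k. e2pi (c k))"
  interpret P: nonzero_params n \<alpha> \<beta> \<gamma> using n by unfold_locales (simp_all add: \<alpha>_def \<beta>_def \<gamma>_def)
  interpret P': nonzero_params n \<beta> \<alpha> \<gamma> using n by unfold_locales (simp_all add: \<alpha>_def \<beta>_def \<gamma>_def)
  have fin: "finite P.G" and irr: "irreducible_on (2 ^ n) P.G"
    using F by (simp_all add: finite_irreducible_def Mon_EC_def \<alpha>_def \<beta>_def \<gamma>_def)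
  have fin': "finite P'.G" using fin Mon_swap by metis
  have ab1: "\<alpha> \<noteq> 1" "\<beta> \<noteq> 1" using P.irreducible_imp_neq_1[OF fin irr] by auto
  have w0: "refl_weight n \<alpha> \<beta> \<gamma> {} \<noteq> 0"
    using P.refl_weight_empty_nonzero P.gamma_neq_1_if_finite[OF fin] ab1 by blast
  have one: "{1} \<subseteq> {1..n}" using n by simp
  obtain r where "r > 0" "refl_weight n \<alpha> \<beta> \<gamma> {1} = of_real r * refl_weight n \<alpha> \<beta> \<gamma> {}"
    using P.refl_weight_ratio_pos[OF fin w0 one] by blast
  then have "refl_weight n \<alpha> \<beta> \<gamma> {1} \<noteq> 0" using w0 by simp
  then have ag: "\<alpha> \<noteq> \<gamma> 1" "\<beta> \<noteq> \<gamma> 1" by (auto simp: refl_weight_def)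
  obtain p where p: "p > 0" "\<alpha> ^ p = 1" using P.alpha_root_of_unity[OF fin ab1(1) ag(1)] by blast
  obtain q where q: "q > 0" "\<beta> ^ q = 1" using P'.alpha_root_of_unity[OF fin' ab1(2) ag(2)] by blast
  obtain m where m: "\<And>k. k \<in> {1..n} \<Longrightarrow> m k > 0 \<and> \<gamma> k ^ m k = 1" using P.gamma_root_of_unity[OF fin] by metis
  \<comment> \<open>a common multiple of the orders of all parameters\<close>
  define N where "N = p * q * (\<Prod>k=1..n. m k)"
  have N0: "N > 0" using p q m by (simp add: N_def prod_pos)
  have dv: "p dvd N" "q dvd N" "\<And>k. k \<in> {1..n} \<Longrightarrow> m k dvd N"
  proof -
    show "p dvd N" "q dvd N" by (simp_all add: N_def)
    fix k assume "k \<in> {1..n}"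
    then have "m k dvd (\<Prod>k=1..n. m k)" by (intro dvd_prodI) auto
    then show "m k dvd N" by (simp add: N_def)
  qed
  have ord: "of_nat N * z \<in> \<int>" if "e2pi z ^ j = 1" "j dvd N" for z j
  proof -
    obtain i where "N = j * i" using \<open>j dvd N\<close> by blast
    then have "e2pi z ^ N = 1" using that(1) by (simp add: power_mult)
    then show ?thesis unfolding e2pi_of_nat_mult[symmetric] e2pi_eq_1_iff .
  qed
  have NZ: "of_nat N * a \<in> \<int>" "of_nat N * b \<in> \<int>" "\<And>k. k \<in> {1..n} \<Longrightarrow> of_nat N * c k \<in> \<int>"
    using ord p q m dv unfolding \<alpha>_def \<beta>_def \<gamma>_def by blast+
  define a' b' c' where "a' = Re a" and "b' = Re b" and "c' = (\<lambda>k. Re (c k))"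
  have re: "a = of_real a'" "b = of_real b'" "\<And>k. k \<in> {1..n} \<Longrightarrow> c k = of_real (c' k)"
    and NR: "real N * a' \<in> \<int>" "real N * b' \<in> \<int>" "\<And>k. k \<in> {1..n} \<Longrightarrow> real N * c' k \<in> \<int>"
    unfolding a'_def b'_def c'_def using real_if_mult_Ints[OF N0] NZ by blast+
  define \<zeta> where "\<zeta> = e2pi (1 / of_nat N)"
  have zN: "\<zeta> ^ N = 1" unfolding \<zeta>_def e2pi_of_nat_mult[symmetric] using N0 by simp
  obtain A where A: "\<And>t. e2pi (of_real (real t * a')) = (\<zeta> ^ t) ^ A"
    using exponent_of_root_of_unity[OF N0 NR(1)] unfolding \<zeta>_def by blast
  obtain B where B: "\<And>t. e2pi (of_real (real t * b')) = (\<zeta> ^ t) ^ B"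
    using exponent_of_root_of_unity[OF N0 NR(2)] unfolding \<zeta>_def by blast
  have "\<exists>C. \<forall>t. e2pi (of_real (real t * c' k)) = (\<zeta> ^ t) ^ C" if "k \<in> {1..n}" for k
    using exponent_of_root_of_unity[OF N0 NR(3)[OF that]] unfolding \<zeta>_def by metis
  then obtain C where C: "\<And>k t. k \<in> {1..n} \<Longrightarrow> e2pi (of_real (real t * c' k)) = (\<zeta> ^ t) ^ C k" by metis
  have "P.G = Mon n (\<zeta> ^ A) (\<zeta> ^ B) (\<lambda>k. \<zeta> ^ C k)"
    using A[of 1] B[of 1] C[of _ 1] re by (intro Mon_cong) (simp_all add: \<alpha>_def \<beta>_def \<gamma>_def)
  moreover have par: "nonzero_params n ((\<zeta> ^ t) ^ A) ((\<zeta> ^ t) ^ B) (\<lambda>k. (\<zeta> ^ t) ^ C k)" for t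
    using n by unfold_locales (simp_all add: \<zeta>_def)
  ultimately have fw: "finite (word_mats n (\<zeta> ^ A) (\<zeta> ^ B) (\<lambda>k. \<zeta> ^ C k))"
    using nonzero_params.finite_words_if_finite_Mon[OF par[of 1]] fin by simp
  have alt: "alternating n (real t * a') (real t * b') (\<lambda>k. real t * c' k)" if t: "coprime t N" for t
  proof -
    let ?g = "\<lambda>k. e2pi (of_real (real t * c' k))"
    let ?a = "e2pi (of_real (real t * a'))" and ?b = "e2pi (of_real (real t * b'))"
    interpret Q: nonzero_params n ?a ?b ?g using n by unfold_locales simp_all
    have "finite (word_mats n ((\<zeta> ^ t) ^ A) ((\<zeta> ^ t) ^ B) (\<lambda>k. (\<zeta> ^ t) ^ C k))"
      by (rule finite_words_conjugate[OF N0 zN t fw])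
    then have "finite (Mon n ((\<zeta> ^ t) ^ A) ((\<zeta> ^ t) ^ B) (\<lambda>k. (\<zeta> ^ t) ^ C k))"
      using nonzero_params.Mon_eq_words[OF par[of t]] by simp
    moreover have "Q.G = Mon n ((\<zeta> ^ t) ^ A) ((\<zeta> ^ t) ^ B) (\<lambda>k. (\<zeta> ^ t) ^ C k)"
      using A B C by (intro Mon_cong) simp_all
    ultimately have finQ: "finite Q.G" by simp
    have pw: "?a = \<alpha> ^ t" "?b = \<beta> ^ t"
      unfolding \<alpha>_def \<beta>_def e2pi_of_nat_mult[symmetric] using re by simp_all
    have "\<alpha> ^ N = 1" "\<beta> ^ N = 1" using NZ unfolding \<alpha>_def \<beta>_def e2pi_of_nat_mult[symmetric] e2pi_eq_1_iff by blast+
    then have "?a \<noteq> 1" "?b \<noteq> 1" unfolding pw using coprime_power_eq_1[OF _ _ t] ab1 by blast+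
    then have w: "refl_weight n ?a ?b ?g {} \<noteq> 0"
      using Q.refl_weight_empty_nonzero Q.gamma_neq_1_if_finite[OF finQ] by blast
    show ?thesis unfolding alternating_iff_refl_weight
      using Q.gamma_neq_1_if_finite[OF finQ] w Q.refl_weight_ratio_pos[OF finQ w] by blast
  qed
  have "rationally_alternating n a' b' c' N"
    unfolding rationally_alternating_def using N0 NR alt by blast
  then show ?thesis using re unfolding a'_def b'_def c'_def by blast
qed


theorem finite_irreducible_Mon_EC_iff:
  assumes "n > 0"
  shows "finite_irreducible (2 ^ n) (Mon_EC n a b c) \<longleftrightarrow>
    (\<exists>N. a = of_real (Re a) \<and> b = of_real (Re b) \<and> (\<forall>k\<in>{1..n}. c k = of_real (Re (c k))) \<and>
       rationally_alternating n (Re a) (Re b) (\<lambda>k. Re (c k)) N)" (is "_ \<longleftrightarrow> ?R")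
proof
  assume ?R
  then obtain N where a: "a = of_real (Re a)" and b: "b = of_real (Re b)" and c: "\<And>k. k \<in> {1..n} \<Longrightarrow> c k = of_real (Re (c k))"
    and R: "rationally_alternating n (Re a) (Re b) (\<lambda>k. Re (c k)) N" by blast
  have "Mon_EC n a b c = Mon n (e2pi (of_real (Re a))) (e2pi (of_real (Re b))) (\<lambda>k. e2pi (of_real (Re (c k))))"
    unfolding Mon_EC_def using a b c by (intro Mon_cong) simp_all
  then show "finite_irreducible (2 ^ n) (Mon_EC n a b c)"
    using rationally_alternating_imp_finite_irreducible[OF assms R] by simp
qed (rule finite_irreducible_imp_rationally_alternating[OF assms])

lemma of_real_in_Ints_complex_iff: "(of_real x :: complex) \<in> \<int> \<longleftrightarrow> x \<in> \<int>"
proof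
  assume "(of_real x :: complex) \<in> \<int>"
  then obtain k where "of_real x = (of_int k :: complex)" by (rule Ints_cases)
  then have "x = of_int k" by (metis of_real_of_int_eq of_real_eq_iff)
  then show "x \<in> \<int>" by simp
qed (auto elim!: Ints_cases)

lemma cong_half_of_real: "cong_half (of_real x) \<longleftrightarrow> half_mod_1 x"
proof -
  have "of_real x - 1 / 2 = (of_real (x - 1 / 2) :: complex)" by simp
  then show ?thesis unfolding cong_half_def half_mod_1_def by (simp only: of_real_in_Ints_complex_iff)
qed

lemma length_filter_cong_half:
  assumes "a = of_real (Re a)" "b = of_real (Re b)" "\<And>k. k \<in> {1..n} \<Longrightarrow> c k = of_real (Re (c k))"
  shows "length (filter cong_half (exponent_list n a b c)) = count_half n (Re a) (Re b) (\<lambda>k. Re (c k))"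
proof -
  have "length (filter cong_half (map c [1..<n + 1])) = card {k\<in>{1..n}. cong_half (c k)}"
  proof -
    have "length (filter (\<lambda>k. cong_half (c k)) [1..<n + 1]) = card (set (filter (\<lambda>k. cong_half (c k)) [1..<n + 1]))"
      by (rule distinct_card[symmetric]) simp
    also have "set (filter (\<lambda>k. cong_half (c k)) [1..<n + 1]) = {k\<in>{1..n}. cong_half (c k)}" by auto
    finally show ?thesis by (simp add: filter_map o_def)
  qed
  also have "{k\<in>{1..n}. cong_half (c k)} = {k\<in>{1..n}. half_mod_1 (Re (c k))}"
    using assms(3) cong_half_of_real by metis
  finally have 1: "length (filter cong_half (map c [1..<n + 1])) = card {k\<in>{1..n}. half_mod_1 (Re (c k))}" .
  have ba: "b - a = of_real (Re b - Re a)" using assms(1,2) by (metis of_real_diff)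
  have "(\<Sum>k=1..n. c k) = of_real (\<Sum>k=1..n. Re (c k))"
    unfolding of_real_sum using assms(3) by (rule sum.cong[OF refl])
  moreover have "of_real ((\<Sum>k=1..n. Re (c k)) - Re a - Re b - (real n - 1) / 2)
      = of_real (\<Sum>k=1..n. Re (c k)) - of_real (Re a) - of_real (Re b) - ((of_nat n - 1) / 2 :: complex)"
    by (simp del: of_real_sum)
  ultimately have e: "(\<Sum>k=1..n. c k) - a - b - (of_nat n - 1) / 2 = of_real ((\<Sum>k=1..n. Re (c k)) - Re a - Re b - (real n - 1) / 2)"
    using assms(1,2) by (simp only:)
  have two: "length (filter P [x, y]) = of_bool (P x) + of_bool (P y)" for P and x y :: complex by simp
  show ?thesis
    unfolding exponent_list_def filter_append length_append 1 count_half_def ba e two cong_half_of_real by simp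
qed

lemma half_mod_1_odd_multiple:
  assumes "half_mod_1 x" "odd t"
  shows "half_mod_1 (real t * x)"
proof -
  obtain j where j: "t = 2 * j + 1" using assms(2) by (rule oddE)
  obtain k where k: "x - 1 / 2 = of_int k" using assms(1) unfolding half_mod_1_def by (rule Ints_cases)
  have "real t * x - 1 / 2 = real t * (x - 1 / 2) + real j" unfolding j by (simp add: field_simps)
  also have "\<dots> = of_int (int t * k + int j)" unfolding k by simp
  finally show ?thesis unfolding half_mod_1_def by (simp only: Ints_of_int)
qed

lemma count_half_odd_multiple:
  assumes t: "odd t"
  shows "count_half n a b c \<le> count_half n (real t * a) (real t * b) (\<lambda>k. real t * c k)"
proof -
  define e where "e = (\<Sum>k=1..n. c k) - a - b - (real n - 1) / 2"
  have "half_mod_1 ((\<Sum>k=1..n. real t * c k) - real t * a - real t * b - (real n - 1) / 2)" if h: "half_mod_1 e"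
  proof -
    obtain j where j: "t = 2 * j + 1" using t by (rule oddE)
    have "(\<Sum>k=1..n. real t * c k) - real t * a - real t * b - (real n - 1) / 2 = real t * e + real j * (real n - 1)"
      unfolding sum_distrib_left[symmetric] e_def j by (simp add: field_simps)
    moreover have "real j * (real n - 1) \<in> \<int>" by (intro Ints_mult Ints_diff) auto
    ultimately show ?thesis using half_mod_1_odd_multiple[OF h t] Ints_add
      unfolding half_mod_1_def by (metis add_diff_eq add.commute)
  qed
  moreover have "half_mod_1 (b - a) \<Longrightarrow> half_mod_1 (real t * b - real t * a)"
    using half_mod_1_odd_multiple[OF _ t, of "b - a"] by (simp add: right_diff_distrib)
  moreover have "card {k\<in>{1..n}. half_mod_1 (c k)} \<le> card {k\<in>{1..n}. half_mod_1 (real t * c k)}"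
    using half_mod_1_odd_multiple[OF _ t] by (intro card_mono) auto
  ultimately show ?thesis unfolding count_half_def e_def[symmetric] by (intro add_mono) (auto simp: of_bool_def)
qed

text \<open>
  Both sides are sign conditions. From right to left, the numbers \<open>N\<close> belonging to the Gauss equations are
  replaced by their product. It is even, since (B) provides a half among the \<open>c\<^sub>k\<close>; so the relevant \<open>t\<close>
  are odd, and (B) holds for \<open>(ta, tb, tc)\<close> as well.
\<close>

theorem theorem1p1:
  fixes n :: nat and a b :: complex and c :: "nat \<Rightarrow> complex"
  assumes "n \<ge> 3"
  shows "finite_irreducible (2 ^ n) (Mon_EC n a b c) \<longleftrightarrow>
    (\<forall>k\<in>{1..n}. finite_irreducible 2 (Mon_Gauss a b (c k)))
    \<and> length (filter cong_half (exponent_list n a b c)) \<ge> n"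
proof -
  have n0: "n > 0" using assms by simp
  define a' b' c' where "a' = Re a" and "b' = Re b" and "c' = (\<lambda>k. Re (c k))"
  have gauss: "finite_irreducible 2 (Mon_Gauss a b (c k)) \<longleftrightarrow>
      (\<exists>N. a = of_real a' \<and> b = of_real b' \<and> c k = of_real (c' k) \<and> rationally_alternating 1 a' b' (\<lambda>_. c' k) N)" for k
    using finite_irreducible_Mon_EC_iff[of 1 a b "\<lambda>_. c k"] by (simp add: Mon_Gauss_def a'_def b'_def c'_def)
  have sub1: "S = {} \<or> S = {1}" if "S \<subseteq> {1..1}" for S :: "nat set" using that by auto
  show ?thesis
  proof
    assume "finite_irreducible (2 ^ n) (Mon_EC n a b c)"
    then obtain N where re: "a = of_real a'" "b = of_real b'" "\<And>k. k \<in> {1..n} \<Longrightarrow> c k = of_real (c' k)"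
      and R: "rationally_alternating n a' b' c' N"
      unfolding finite_irreducible_Mon_EC_iff[OF n0] a'_def b'_def c'_def by blast
    have "rationally_alternating 1 a' b' (\<lambda>_. c' k) N" if k: "k \<in> {1..n}" for k
    proof -
      have "alternating 1 (real t * a') (real t * b') (\<lambda>_. real t * c' k)" if t: "coprime t N" for t
        unfolding alternating_def
      proof (intro allI impI)
        fix S :: "nat set" assume S: "S \<subseteq> {1..1}"
        have *: "(-1) ^ card T * sin_prod (real t * a') (real t * b') (sum (\<lambda>k. real t * c' k) T) * sin_prod (real t * a') (real t * b') 0 > 0"
          if "T \<subseteq> {1..n}" for T
          using R t that unfolding rationally_alternating_def alternating_def by blast
        show "(-1) ^ card S * sin_prod (real t * a') (real t * b') (\<Sum>_\<in>S. real t * c' k) * sin_prod (real t * a') (real t * b') 0 > 0"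
          using sub1[OF S] *[of "{}"] *[of "{k}"] k by auto
      qed
      then show ?thesis using R k unfolding rationally_alternating_def by auto
    qed
    then have "\<forall>k\<in>{1..n}. finite_irreducible 2 (Mon_Gauss a b (c k))" unfolding gauss using re by blast
    moreover have "length (filter cong_half (exponent_list n a b c)) = count_half n a' b' c'"
      unfolding a'_def b'_def c'_def
      by (rule length_filter_cong_half) (use re[unfolded a'_def b'_def c'_def] in blast)+
    then have "length (filter cong_half (exponent_list n a b c)) \<ge> n"
      using count_half_ge_if_rationally_alternating[OF assms R] by (simp only:)
    ultimately show "(\<forall>k\<in>{1..n}. finite_irreducible 2 (Mon_Gauss a b (c k)))
      \<and> length (filter cong_half (exponent_list n a b c)) \<ge> n" by blast
  next
    assume AB: "(\<forall>k\<in>{1..n}. finite_irreducible 2 (Mon_Gauss a b (c k)))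
      \<and> length (filter cong_half (exponent_list n a b c)) \<ge> n"
    then have "\<forall>k\<in>{1..n}. \<exists>N. a = of_real a' \<and> b = of_real b' \<and> c k = of_real (c' k) \<and>
        rationally_alternating 1 a' b' (\<lambda>_. c' k) N"
      unfolding gauss by blast
    from bchoice[OF this] obtain M where M': "\<forall>k\<in>{1..n}. a = of_real a' \<and> b = of_real b' \<and> c k = of_real (c' k) \<and>
        rationally_alternating 1 a' b' (\<lambda>_. c' k) (M k)"
      by (rule exE)
    note M = M'[rule_format]
    have one: "1 \<in> {1..n}" using assms by simp
    have re: "a = of_real a'" "b = of_real b'" "\<And>k. k \<in> {1..n} \<Longrightarrow> c k = of_real (c' k)" using M one by blast+
    have "length (filter cong_half (exponent_list n a b c)) = count_half n a' b' c'"
      unfolding a'_def b'_def c'_def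
      by (rule length_filter_cong_half) (use re[unfolded a'_def b'_def c'_def] in blast)+
    then have cnt: "count_half n a' b' c' \<ge> n" using AB by (simp only:)
    define N where "N = (\<Prod>k=1..n. M k)"
    have M0: "M k > 0" if "k \<in> {1..n}" for k using M[OF that] by (simp add: rationally_alternating_def)
    have N0: "N > 0" unfolding N_def using M0 by (intro prod_pos) auto
    have dv: "M k dvd N" if "k \<in> {1..n}" for k unfolding N_def using that by (intro dvd_prodI) auto
    have NZ: "real N * x \<in> \<int>" if x: "real (M k) * x \<in> \<int>" and k: "k \<in> {1..n}" for x k
    proof -
      obtain i where i: "N = M k * i" using dv[OF k] by (rule dvdE)
      have "real i * (real (M k) * x) \<in> \<int>" by (rule Ints_mult[OF Ints_of_nat x])
      moreover have "real N * x = real i * (real (M k) * x)" unfolding i by simp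
      ultimately show ?thesis by (simp only:)
    qed
    have Mk: "real (M k) * a' \<in> \<int>" "real (M k) * b' \<in> \<int>" "real (M k) * c' k \<in> \<int>" if "k \<in> {1..n}" for k
      using M[OF that] unfolding rationally_alternating_def by auto
    have Nab: "real N * a' \<in> \<int>" "real N * b' \<in> \<int>" using NZ[OF Mk(1)[OF one] one] NZ[OF Mk(2)[OF one] one] .
    have Nc: "real N * c' k \<in> \<int>" if "k \<in> {1..n}" for k using NZ[OF Mk(3)[OF that] that] .
    have "even N"
    proof -
      have "card {k\<in>{1..n}. half_mod_1 (c' k)} > 0"
        using cnt assms unfolding count_half_def by (auto simp: of_bool_def split: if_splits)
      then obtain k where k: "k \<in> {1..n}" "half_mod_1 (c' k)" by (auto simp: card_gt_0_iff)
      obtain i where i: "c' k - 1 / 2 = of_int i" using k(2) unfolding half_mod_1_def by (rule Ints_cases)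
      obtain j where j: "real N * c' k = of_int j" using Nc[OF k(1)] by (rule Ints_cases)
      have "real N = 2 * (real N * c' k) - 2 * real N * (c' k - 1 / 2)" by (simp add: algebra_simps)
      then have "real_of_int (int N) = of_int (2 * (j - int N * i))" unfolding i j by simp
      then have "int N = 2 * (j - int N * i)" by (simp only: of_int_eq_iff)
      then show ?thesis by presburger
    qed
    have "alternating n (real t * a') (real t * b') (\<lambda>k. real t * c' k)" if t: "coprime t N" for t
    proof (rule alternating_if_count_half_ge[OF assms])
      have "odd t" using t \<open>even N\<close> by (meson coprime_common_divisor odd_one)
      then show "n \<le> count_half n (real t * a') (real t * b') (\<lambda>k. real t * c' k)"
        using cnt count_half_odd_multiple[of t n a' b' c'] by linarith
      fix k assume k: "k \<in> {1..n}"
      have "coprime t (M k)" using coprime_divisors[OF dvd_refl dv[OF k] t] .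
      then show "alternating 1 (real t * a') (real t * b') (\<lambda>_. real t * c' k)"
        using M[OF k] unfolding rationally_alternating_def by blast
    qed
    then have "rationally_alternating n a' b' c' N"
      unfolding rationally_alternating_def using N0 Nab Nc by blast
    then show "finite_irreducible (2 ^ n) (Mon_EC n a b c)"
      unfolding finite_irreducible_Mon_EC_iff[OF n0] a'_def b'_def c'_def using re unfolding a'_def b'_def c'_def by blast
  qed
qed

end
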